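(* Let $G=(V,E)$ be a finite graph, let $q\ge 1$ be an integer, and let $J=(J_{ij})_{(i,j)\in E}$ be real edge weights with $J_{ij}>0$ for all $(i,j)\in E$ (the ferromagnetic Potts model with no external field). Let $Z_{\mathrm{Potts}}(G;J,q)=\sum_{\sigma\in\{1,\dots,q\}^{|V|}}\prod_{(i,j)\in E}e^{J_{ij}\delta(\sigma_i,\sigma_j)}$, and let $Z_{\mathrm{B}}(G;J,q)$ and $Z_{\mathrm{MF}}(G;J,q)$ be the Bethe partition function and the naïve mean-field partition function of this graphical model. Then $$Z_{\mathrm{MF}}(G;J,q)\le Z_{\mathrm{B}}(G;J,q)\le Z_{\mathrm{Potts}}(G;J,q).$$
   Context: Graphs are finite, simple and undirected; $\delta(s,t)=1$ if $s=t$ and $0$ otherwise. Graphical models: for a finite set $\mathcal{X}$ and a hypergraph $G=(V,\mathcal{A})$ with potentials $\phi_i:\mathcal{X}\to\mathbb{R}_{\ge0}$ ($i\in V$) and $\psi_\alpha:\mathcal{X}^{|\alpha|}\to\mathbb{R}_{\ge0}$ ($\alpha\in\mathcal{A}$), the local marginal polytope $\mathcal{T}$ is the set of nonnegative $\tau=(\tau_i(x_i),\tau_\alpha(x_\alpha))$ with $\sum_{x_i}\tau_i(x_i)=1$ for all $i\in V$ and $\sum_{x_{\alpha\setminus i}}\tau_\alpha(x_\alpha)=\tau_i(x_i)$ for all $\alpha\in\mathcal{A}$, $i\in\alpha$ and $x_i \in \mathcal{X}$. For $\tau\in\mathcal{T}$, $$\log Z_{\mathrm B}(G,\tau;\phi,\psi)=\sum_{i\in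 V}\sum_{x_i}\tau_i(x_i)\log\phi_i(x_i)+\sum_{\alpha\in\mathcal{A}}\sum_{x_\alpha}\tau_\alpha(x_\alpha)\log\psi_\alpha(x_\alpha)-\sum_{i\in V}\sum_{x_i}\tau_i(x_i)\log\tau_i(x_i)-\sum_{\alpha\in\mathcal{A}}\sum_{x_\alpha}\tau_\alpha(x_\alpha)\log\frac{\tau_\alpha(x_\alpha)}{\prod_{i\in\alpha}\tau_i(x_i)}$$ (with $0\log 0=0$ and the usual conventions). The Bethe partition function is $Z_{\mathrm B}(G;\phi,\psi)=\max_{\tau\in\mathcal{T}}Z_{\mathrm B}(G,\tau;\phi,\psi)$. The naïve mean-field partition function $Z_{\mathrm{MF}}(G;\phi,\psi)$ is the maximum of the same expression over those $\tau\in\mathcal{T}$ with $\tau_\alpha(x_\alpha)=\prod_{i\in\alpha}\tau_i(x_i)$ for all $\alpha\in\mathcal{A}$. For the Potts model, $\mathcal{X}=\{1,\dots,q\}$, $\mathcal{A}=E$, $\phi_i\equiv1$ and $\psi_{ij}(\sigma_i,\sigma_j)=e^{J_{ij}\delta(\sigma_i,\sigma_j)}$. *)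

theory Defs
  imports "HOL-Analysis.Analysis"
begin

section \<open>Graphical models\<close>

text \<open>
  A hypergraph is a vertex set \<open>V\<close> with a set \<open>A\<close> of hyperedges (subsets of \<open>V\<close>). A configuration
  of a hyperedge \<open>\<alpha>\<close> with values in \<open>X\<close> is an element of \<open>\<alpha> \<rightarrow>\<^sub>E X\<close>.
\<close>

type_synonym ('v, 'x) vertex_fun = "'v \<Rightarrow> 'x \<Rightarrow> real"
type_synonym ('v, 'x) hyperedge_fun = "'v set \<Rightarrow> ('v \<Rightarrow> 'x) \<Rightarrow> real"
type_synonym ('v, 'x) pseudomarginal = "('v, 'x) vertex_fun \<times> ('v, 'x) hyperedge_fun"

definition local_marginal_polytope ::
  "'v set \<Rightarrow> 'v set set \<Rightarrow> 'x set \<Rightarrow> ('v, 'x) pseudomarginal set" where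
  "local_marginal_polytope V A X = {(t, T).
     (\<forall>i\<in>V. \<forall>s\<in>X. 0 \<le> t i s) \<and>
     (\<forall>\<alpha>\<in>A. \<forall>x\<in>\<alpha> \<rightarrow>\<^sub>E X. 0 \<le> T \<alpha> x) \<and>
     (\<forall>i\<in>V. (\<Sum>s\<in>X. t i s) = 1) \<and>
     (\<forall>\<alpha>\<in>A. \<forall>i\<in>\<alpha>. \<forall>s\<in>X. (\<Sum>x\<in>{x \<in> \<alpha> \<rightarrow>\<^sub>E X. x i = s}. T \<alpha> x) = t i s)}"

text \<open>
  Potentials may vanish, so logarithms are taken in the extended reals, with \<open>log 0 = -\<infinity>\<close>;
  the convention \<open>0 * log 0 = 0\<close> is then the rule \<open>0 * -\<infinity> = 0\<close> of \<open>ereal\<close>. On the local marginal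
  polytope the two entropy sums below are finite, because \<open>T \<alpha> x > 0\<close> forces \<open>t i (x i) > 0\<close>
  for all \<open>i \<in> \<alpha>\<close>; hence no difference of infinities occurs.
\<close>

definition elog :: "real \<Rightarrow> ereal" where
  "elog r = (if r = 0 then -\<infinity> else ereal (ln r))"

definition eexp :: "ereal \<Rightarrow> real" where
  "eexp z = (if z = -\<infinity> then 0 else exp (real_of_ereal z))"

definition log_bethe ::
  "'v set \<Rightarrow> 'v set set \<Rightarrow> 'x set \<Rightarrow> ('v, 'x) vertex_fun \<Rightarrow> ('v, 'x) hyperedge_fun \<Rightarrow>
    ('v, 'x) pseudomarginal \<Rightarrow> ereal" where
  "log_bethe V A X \<phi> \<psi> = (\<lambda>(t, T).
     (\<Sum>i\<in>V. \<Sum>s\<in>X. ereal (t i s) * elog (\<phi> i s))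
   + (\<Sum>\<alpha>\<in>A. \<Sum>x\<in>\<alpha> \<rightarrow>\<^sub>E X. ereal (T \<alpha> x) * elog (\<psi> \<alpha> x))
   - (\<Sum>i\<in>V. \<Sum>s\<in>X. ereal (t i s) * elog (t i s))
   - (\<Sum>\<alpha>\<in>A. \<Sum>x\<in>\<alpha> \<rightarrow>\<^sub>E X. ereal (T \<alpha> x) * elog (T \<alpha> x / (\<Prod>i\<in>\<alpha>. t i (x i)))))"

definition bethe_partition_function ::
  "'v set \<Rightarrow> 'v set set \<Rightarrow> 'x set \<Rightarrow> ('v, 'x) vertex_fun \<Rightarrow> ('v, 'x) hyperedge_fun \<Rightarrow> real" where
  "bethe_partition_function V A X \<phi> \<psi> =
     (GREATEST z. \<exists>\<tau>\<in>local_marginal_polytope V A X. z = eexp (log_bethe V A X \<phi> \<psi> \<tau>))"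

definition product_form ::
  "'v set set \<Rightarrow> 'x set \<Rightarrow> ('v, 'x) pseudomarginal \<Rightarrow> bool" where
  "product_form A X = (\<lambda>(t, T). \<forall>\<alpha>\<in>A. \<forall>x\<in>\<alpha> \<rightarrow>\<^sub>E X. T \<alpha> x = (\<Prod>i\<in>\<alpha>. t i (x i)))"

definition mean_field_partition_function ::
  "'v set \<Rightarrow> 'v set set \<Rightarrow> 'x set \<Rightarrow> ('v, 'x) vertex_fun \<Rightarrow> ('v, 'x) hyperedge_fun \<Rightarrow> real" where
  "mean_field_partition_function V A X \<phi> \<psi> =
     (GREATEST z. \<exists>\<tau>\<in>local_marginal_polytope V A X.
        product_form A X \<tau> \<and> z = eexp (log_bethe V A X \<phi> \<psi> \<tau>))"

section \<open>The Potts model\<close>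

definition finite_simple_graph :: "'v set \<Rightarrow> 'v set set \<Rightarrow> bool" where
  "finite_simple_graph V E \<longleftrightarrow> finite V \<and> (\<forall>e\<in>E. e \<subseteq> V \<and> card e = 2)"

text \<open>
  Since an edge \<open>e = {i, j}\<close> is an unordered pair, \<open>\<delta>(\<sigma>\<^sub>i, \<sigma>\<^sub>j)\<close> is written as the indicator that
  \<open>\<sigma>\<close> is constant on \<open>e\<close>.
\<close>

definition edge_delta :: "'v set \<Rightarrow> ('v \<Rightarrow> 'x) \<Rightarrow> real" where
  "edge_delta e \<sigma> = (if \<forall>i\<in>e. \<forall>j\<in>e. \<sigma> i = \<sigma> j then 1 else 0)"

lemma edge_delta_pair: "edge_delta {i, j} \<sigma> = (if \<sigma> i = \<sigma> j then 1 else 0)"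
  by (auto simp: edge_delta_def)

definition potts_potential :: "('v set \<Rightarrow> real) \<Rightarrow> ('v, nat) hyperedge_fun" where
  "potts_potential J e \<sigma> = exp (J e * edge_delta e \<sigma>)"

definition Z_Potts :: "'v set \<Rightarrow> 'v set set \<Rightarrow> ('v set \<Rightarrow> real) \<Rightarrow> nat \<Rightarrow> real" where
  "Z_Potts V E J q = (\<Sum>\<sigma>\<in>V \<rightarrow>\<^sub>E {1..q}. \<Prod>e\<in>E. exp (J e * edge_delta e \<sigma>))"

definition Z_B :: "'v set \<Rightarrow> 'v set set \<Rightarrow> ('v set \<Rightarrow> real) \<Rightarrow> nat \<Rightarrow> real" where
  "Z_B V E J q = bethe_partition_function V E {1..q} (\<lambda>i s. 1) (potts_potential J)"

definition Z_MF :: "'v set \<Rightarrow> 'v set set \<Rightarrow> ('v set \<Rightarrow> real) \<Rightarrow> nat \<Rightarrow> real" where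
  "Z_MF V E J q = mean_field_partition_function V E {1..q} (\<lambda>i s. 1) (potts_potential J)"

end

theory Submission
  imports Defs "HOL-Combinatorics.Permutations" "HOL-Real_Asymp.Real_Asymp"
begin

text \<open>
  The Bethe value of a pseudomarginal \<open>\<tau>\<close> is the exponential growth rate, averaged over random \<open>N\<close>-fold
  covers of the graph, of the weight of the configurations with empirical vertex and edge
  statistics \<open>\<tau>\<close>. It therefore suffices that the partition function of every \<open>N\<close>-fold cover is at most
  the \<open>N\<close>-th power of that of the graph. In the random cluster representation the configurations of
  the cover are edge sets \<open>A\<close>, weighted by the log-supermodular function
  \<open>f A = (\<Prod>e\<in>A. w e) * q ^ c A\<close> with \<open>c A\<close> the number of components. A contraction argument bounds \<open>f A\<close>
  by the product over \<open>j < N\<close> of the weights of the base edge sets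
  \<open>{e. A contains more than j lifts of e}\<close>. Summing out one base edge at a time, the comparison of
  the two sums follows by uncrossing and weak majorisation.
\<close>

section \<open>Colourings constant on edge sets\<close>

text \<open>Adding up the bounds on \<open>f A\<close> term by term is not enough. For a single base
  edge every set of \<open>k\<close> lifts receives the same bound
  \<open>r 0 * ... * r (k - 1)\<close>, but in the product of the factors \<open>1 + r l\<close>
  this monomial occurs only once, and the other monomials of degree \<open>k\<close> may be smaller.
  Log-supermodularity keeps too many sets from reaching their bound together:
  \<open>u {i} * u {j} \<le> u {i, j} * u {} \<le> r 0 * r 1\<close>, so two singletons cannot both
  attain \<open>r 0\<close> when \<open>r 1 < r 0\<close>. Components are never formed. The factor
  \<open>q ^ c A\<close> is the number of colourings that are constant along the edges of
  \<open>A\<close>, and subtraction of colourings modulo \<open>q\<close> replaces rank arguments.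
  Ferromagnetism makes the random cluster weights \<open>exp (J e) - 1\<close> positive. A cover has
  integral statistics whose margins agree exactly, which forces a rounding scheme and a limit. Both
  variational quantities are defined as greatest elements, so attainment has to be proved before
  they can be compared; the first inequality is then an inclusion of feasible sets.\<close>

lemma card_le_fibres:
  assumes "finite B" "f ` A \<subseteq> B" "\<And>b. b \<in> B \<Longrightarrow> card {a \<in> A. f a = b} \<le> k"
  shows "card A \<le> card B * k"
proof -
  have "A = (\<Union>b\<in>B. {a \<in> A. f a = b})" using assms(2) by auto
  hence "card A \<le> (\<Sum>b\<in>B. card {a \<in> A. f a = b})"
    using card_UN_le[OF assms(1)] by metis
  also have "\<dots> \<le> card B * k" using sum_bounded_above[of B, OF assms(3)] by simp
  finally show ?thesis .
qed

text \<open>For finite \<open>S\<close> and edges inside \<open>S\<close>, the cardinality is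
  \<open>q\<close> to the number of components of the multigraph with edges \<open>c p\<close>.
  Edges are indices with an end map because contraction creates loops and parallel edges.\<close>

definition colourings :: "'s set \<Rightarrow> nat \<Rightarrow> ('p \<Rightarrow> 's \<times> 's) \<Rightarrow> 'p set \<Rightarrow> ('s \<Rightarrow> nat) set" where
  "colourings S q c P = {\<sigma> \<in> S \<rightarrow>\<^sub>E {1..q}. \<forall>p\<in>P. \<sigma> (fst (c p)) = \<sigma> (snd (c p))}"

lemma finite_colourings [simp]: "finite S \<Longrightarrow> finite (colourings S q c P)"
  unfolding colourings_def by (auto intro!: finite_PiE)

lemma colourings_antimono: "P \<subseteq> P' \<Longrightarrow> colourings S q c P' \<subseteq> colourings S q c P"
  by (auto simp: colourings_def)

lemma card_colourings_empty: "finite S \<Longrightarrow> card (colourings S q c {}) = q ^ card S"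
  by (simp add: colourings_def card_PiE)

lemma card_colourings_pos:
  assumes "finite S" "q \<ge> 1" "\<And>p. p \<in> P \<Longrightarrow> c p \<in> S \<times> S"
  shows "card (colourings S q c P) > 0"
proof -
  have "restrict (\<lambda>_. 1) S \<in> colourings S q c P"
    using assms(2,3) by (fastforce simp: colourings_def mem_Times_iff)
  thus ?thesis using assms(1) by (auto simp: card_gt_0_iff)
qed

text \<open>Subtraction modulo \<open>q\<close>, with representatives moved into
  \<open>{1..q}\<close>. The shift by one is harmless because differences are only ever compared
  with each other.\<close>

definition colour_diff :: "nat \<Rightarrow> nat \<Rightarrow> nat \<Rightarrow> nat" where
  "colour_diff q x y = nat ((int x - int y) mod int q) + 1"

lemma colour_diff_in: "q \<ge> 1 \<Longrightarrow> colour_diff q x y \<in> {1..q}"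
  by (simp add: colour_diff_def Suc_le_eq nat_less_iff)

lemma colour_diff_eq_iff:
  assumes "q \<ge> 1"
  shows "colour_diff q x y = colour_diff q x' y' \<longleftrightarrow> int q dvd (int x - int y) - (int x' - int y')"
  using assms by (simp add: colour_diff_def mod_eq_dvd_iff eq_nat_nat_iff)

lemma colour_cong_eq:
  "\<lbrakk>int q dvd (int x) - (int y); x \<in> {1..q}; y \<in> {1..q}\<rbrakk> \<Longrightarrow> x = y"
proof -
  assume a: "int q dvd (int x) - (int y)" "x \<in> {1..q}" "y \<in> {1..q}"
  hence "int q dvd int x - int y" by simp
  moreover have "\<bar>int x - int y\<bar> < int q" using a by auto
  ultimately show "x = y" using dvd_imp_le_int[of "int x - int y" "int q"] by fastforce
qed

definition colouring_diff :: "'s set \<Rightarrow> nat \<Rightarrow> ('s \<Rightarrow> nat) \<Rightarrow> ('s \<Rightarrow> nat) \<Rightarrow> 's \<Rightarrow> nat" where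
  "colouring_diff S q \<sigma> \<sigma>' = restrict (\<lambda>s. colour_diff q (\<sigma> s) (\<sigma>' s)) S"

lemma colouring_diff_in:
  assumes "q \<ge> 1" "\<And>p. p \<in> P \<Longrightarrow> c p \<in> S \<times> S"
    "\<And>p. p \<in> P \<Longrightarrow> colour_diff q (\<sigma> (fst (c p))) (\<sigma>' (fst (c p))) = colour_diff q (\<sigma> (snd (c p))) (\<sigma>' (snd (c p)))"
  shows "colouring_diff S q \<sigma> \<sigma>' \<in> colourings S q c P"
  using assms colour_diff_in[OF assms(1)]
  by (fastforce simp: colourings_def colouring_diff_def mem_Times_iff)

lemma colouring_diff_inj:
  assumes "q \<ge> 1" "\<sigma> \<in> S \<rightarrow>\<^sub>E {1..q}" "\<sigma>' \<in> S \<rightarrow>\<^sub>E {1..q}"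
    "colouring_diff S q \<sigma> \<rho> = colouring_diff S q \<sigma>' \<rho>"
  shows "\<sigma> = \<sigma>'"
proof (rule PiE_ext[OF assms(2,3)])
  fix s assume s: "s \<in> S"
  have "colour_diff q (\<sigma> s) (\<rho> s) = colour_diff q (\<sigma>' s) (\<rho> s)"
    using fun_cong[OF assms(4), of s] s by (simp add: colouring_diff_def)
  hence "int q dvd (int (\<sigma> s) - int (\<rho> s)) - (int (\<sigma>' s) - int (\<rho> s))"
    using colour_diff_eq_iff[OF assms(1)] by blast
  hence "int q dvd (int (\<sigma> s)) - (int (\<sigma>' s))" by simp
  thus "\<sigma> s = \<sigma>' s" using s assms(2,3) by (intro colour_cong_eq) auto
qed

text \<open>The colourings of \<open>P\<close> form a subgroup of \<open>(\<int>/q)\<^sup>S\<close>; a fibre of the subtraction map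
  \<open>K P \<times> K P' \<rightarrow> K (P \<inter> P')\<close> is a coset of \<open>K P \<inter> K P' = K (P \<union> P')\<close>.\<close>

lemma card_colourings_supermodular:
  assumes "finite S" "q \<ge> 1" and c: "\<And>p. p \<in> P \<union> P' \<Longrightarrow> c p \<in> S \<times> S"
  shows "card (colourings S q c P) * card (colourings S q c P')
    \<le> card (colourings S q c (P \<union> P')) * card (colourings S q c (P \<inter> P'))"
proof -
  let ?K = "colourings S q c" and ?d = "colouring_diff S q"
  have "card (?K P \<times> ?K P') \<le> card (?K (P \<inter> P')) * card (?K (P \<union> P'))"
  proof (rule card_le_fibres[where f = "\<lambda>(a, b). ?d a b"])
    show "finite (?K (P \<inter> P'))" using assms by simp
    show "(\<lambda>(a, b). ?d a b) ` (?K P \<times> ?K P') \<subseteq> ?K (P \<inter> P')"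
    proof (rule image_subsetI)
      fix x assume "x \<in> ?K P \<times> ?K P'"
      then obtain a b where x: "x = (a, b)" and ab: "a \<in> ?K P" "b \<in> ?K P'" by blast
      have "?d a b \<in> ?K (P \<inter> P')"
      proof (rule colouring_diff_in[OF assms(2)])
        fix p assume p: "p \<in> P \<inter> P'"
        show "c p \<in> S \<times> S" using p by (intro c) blast
        have "a (fst (c p)) = a (snd (c p))" "b (fst (c p)) = b (snd (c p))"
          using ab p unfolding colourings_def by blast+
        thus "colour_diff q (a (fst (c p))) (b (fst (c p))) = colour_diff q (a (snd (c p))) (b (snd (c p)))"
          by metis
      qed
      thus "(case x of (a, b) \<Rightarrow> ?d a b) \<in> ?K (P \<inter> P')" by (simp add: x)
    qed
    fix k
    let ?F = "{x \<in> ?K P \<times> ?K P'. (case x of (a, b) \<Rightarrow> ?d a b) = k}"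
    show "card ?F \<le> card (?K (P \<union> P'))"
    proof (cases "?F = {}")
      case False
      then obtain a0 b0 where 0: "a0 \<in> ?K P" "b0 \<in> ?K P'" "?d a0 b0 = k" by auto
      have cg: "int q dvd (int (a s) - int (b s)) - (int (a0 s) - int (b0 s))"
        if "?d a b = k" "s \<in> S" for a b s
        using fun_cong[OF trans[OF that(1) 0(3)[symmetric]], of s] that(2)
        by (simp add: colouring_diff_def colour_diff_eq_iff[OF assms(2)])
      \<comment> \<open>Within one fibre \<open>a - b = a0 - b0\<close>, hence
        \<open>a - a0 = b - b0\<close>. This common difference respects \<open>P\<close> because
        \<open>a\<close> and \<open>a0\<close> do, and \<open>P'\<close> because \<open>b\<close>
        and \<open>b0\<close> do.\<close>
      have swap: "colour_diff q (a s) (a0 s) = colour_diff q (b s) (b0 s)"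
        if "?d a b = k" "s \<in> S" for a b s
        using cg[OF that] by (simp add: colour_diff_eq_iff[OF assms(2)] algebra_simps)
      show ?thesis
      proof (rule card_inj_on_le[where f = "\<lambda>(a, b). ?d a a0"])
        show "finite (?K (P \<union> P'))" using assms by simp
        show "(\<lambda>(a, b). ?d a a0) ` ?F \<subseteq> ?K (P \<union> P')"
        proof clarify
          fix a b assume ab: "a \<in> ?K P" "b \<in> ?K P'" and k: "k = ?d a b"
          show "?d a a0 \<in> ?K (P \<union> P')"
          proof (rule colouring_diff_in[OF assms(2) c])
            fix p assume p: "p \<in> P \<union> P'"
            have sw: "colour_diff q (a s) (a0 s) = colour_diff q (b s) (b0 s)" if "s \<in> S" for s
              using swap[of a b s] k that by simp
            have "fst (c p) \<in> S" "snd (c p) \<in> S" using c[OF p] by auto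
            thus "colour_diff q (a (fst (c p))) (a0 (fst (c p))) = colour_diff q (a (snd (c p))) (a0 (snd (c p)))"
              using p ab 0 sw by (cases "p \<in> P") (auto simp: colourings_def)
          qed
        qed
        show "inj_on (\<lambda>(a, b). ?d a a0) ?F"
        proof (rule inj_onI)
          fix x x' assume xx: "x \<in> ?F" "x' \<in> ?F"
            and e0: "(case x of (a, b) \<Rightarrow> ?d a a0) = (case x' of (a, b) \<Rightarrow> ?d a a0)"
          obtain a b a' b' where x: "x = (a, b)" "x' = (a', b')" by (metis surj_pair)
          have ab: "a \<in> ?K P" "b \<in> ?K P'" "a' \<in> ?K P" "b' \<in> ?K P'"
            and k: "?d a' b' = ?d a b" and e: "?d a a0 = ?d a' a0"
            using xx e0 by (auto simp: x)
          have a: "a = a'" using ab by (intro colouring_diff_inj[OF assms(2) _ _ e]) (auto simp: colourings_def)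
          have "b = b'"
          proof (rule PiE_ext)
            show "b \<in> S \<rightarrow>\<^sub>E {1..q}" "b' \<in> S \<rightarrow>\<^sub>E {1..q}" using ab by (auto simp: colourings_def)
            fix s assume s: "s \<in> S"
            have "int q dvd (int (a s) - int (b' s)) - (int (a s) - int (b s))"
              using fun_cong[OF k, of s] s a
              by (simp add: colouring_diff_def colour_diff_eq_iff[OF assms(2)])
            hence "int q dvd (int (b s)) - (int (b' s))"
              by simp
            thus "b s = b' s" using s ab by (intro colour_cong_eq) (auto simp: colourings_def)
          qed
          with a show "x = x'" by (simp add: x)
        qed
      qed
    next
      case True thus ?thesis by (metis card.empty le0)
    qed
  qed
  thus ?thesis by (simp add: card_cartesian_product mult.commute)
qed

text \<open>The colour difference along \<open>p0\<close> takes at most \<open>q\<close> values, and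
  two colourings with the same value differ by a colouring that also respects
  \<open>p0\<close>.\<close>

lemma card_colourings_insert:
  assumes "finite S" "q \<ge> 1" and c: "\<And>p. p \<in> insert p0 P \<Longrightarrow> c p \<in> S \<times> S"
  shows "card (colourings S q c P) \<le> q * card (colourings S q c (insert p0 P))"
proof -
  let ?K = "colourings S q c" and ?d = "colouring_diff S q"
  let ?f = "\<lambda>\<sigma>. colour_diff q (\<sigma> (fst (c p0))) (\<sigma> (snd (c p0)))"
  have "card (?K P) \<le> card {1..q} * card (?K (insert p0 P))"
  proof (rule card_le_fibres[where f = ?f])
    show "?f ` ?K P \<subseteq> {1..q}" using colour_diff_in[OF assms(2)] by blast
    fix k
    let ?F = "{\<sigma> \<in> ?K P. ?f \<sigma> = k}"
    show "card ?F \<le> card (?K (insert p0 P))"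
    proof (cases "?F = {}")
      case False
      then obtain s0 where 0: "s0 \<in> ?K P" "?f s0 = k" by auto
      show ?thesis
      proof (rule card_inj_on_le[where f = "\<lambda>a. ?d a s0"])
        show "finite (?K (insert p0 P))" using assms by simp
        show "(\<lambda>a. ?d a s0) ` ?F \<subseteq> ?K (insert p0 P)"
        proof clarify
          fix a assume a: "a \<in> ?K P" "k = ?f a"
          have "?f a = ?f s0" using a 0 by simp
          hence "colour_diff q (a (fst (c p0))) (s0 (fst (c p0))) = colour_diff q (a (snd (c p0))) (s0 (snd (c p0)))"
            by (simp add: colour_diff_eq_iff[OF assms(2)] algebra_simps)
          thus "?d a s0 \<in> ?K (insert p0 P)"
            using a 0 by (intro colouring_diff_in[OF assms(2) c]) (auto simp: colourings_def)
        qed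
        show "inj_on (\<lambda>a. ?d a s0) ?F"
          by (rule inj_onI, rule colouring_diff_inj[OF assms(2)]) (auto simp: colourings_def)
      qed
    next
      case True thus ?thesis by (metis card.empty le0)
    qed
  qed simp
  thus ?thesis by simp
qed

lemma card_colourings_union:
  assumes "finite S" "q \<ge> 1" "finite D" "\<And>p. p \<in> P \<union> D \<Longrightarrow> c p \<in> S \<times> S"
  shows "card (colourings S q c P) \<le> q ^ card D * card (colourings S q c (P \<union> D))"
  using assms(3,4)
proof (induction D rule: finite_induct)
  case (insert d D)
  have "card (colourings S q c P) \<le> q ^ card D * card (colourings S q c (P \<union> D))"
    by (rule insert.IH, rule insert.prems) auto
  also have "\<dots> \<le> q ^ card D * (q * card (colourings S q c (insert d (P \<union> D))))"
    by (rule mult_le_mono2, rule card_colourings_insert[OF assms(1,2)], rule insert.prems) auto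
  finally show ?case using insert.hyps by (simp add: algebra_simps)
qed simp

section \<open>Sums of log-supermodular functions\<close>

lemma ex_monotone_enumeration:
  fixes d :: "'a \<Rightarrow> 'b::linorder"
  assumes "finite I"
  shows "\<exists>\<rho>. bij_betw \<rho> I {..<card I} \<and> (\<forall>x\<in>I. \<forall>y\<in>I. d x < d y \<longrightarrow> \<rho> x < \<rho> y)"
  using assms
proof (induction rule: finite_ranking_induct[where f = d])
  case empty
  show ?case by (simp add: bij_betw_def)
next
  case (insert x S)
  then obtain \<rho> where \<rho>: "bij_betw \<rho> S {..<card S}" "\<And>x y. \<lbrakk>x \<in> S; y \<in> S; d x < d y\<rbrakk> \<Longrightarrow> \<rho> x < \<rho> y"
    by blast
  show ?case
  proof (cases "x \<in> S")
    case True
    thus ?thesis using \<rho> by (auto simp: insert_absorb)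
  next
    case False
    let ?r = "\<rho>(x := card S)"
    have "bij_betw ?r S {..<card S}" using \<rho>(1) False by (subst bij_betw_cong[of _ _ \<rho>]) auto
    hence "bij_betw ?r (S \<union> {x}) ({..<card S} \<union> {card S})"
      by (intro bij_betw_combine) (auto simp: bij_betw_def)
    hence "bij_betw ?r (insert x S) {..<card (insert x S)}"
      using insert.hyps False by (simp add: lessThan_Suc)
    moreover have "?r a < ?r b" if "a \<in> insert x S" "b \<in> insert x S" "d a < d b" for a b
      using that \<rho> insert.hyps(2) False bij_betwE[OF \<rho>(1)] by (auto simp: not_less[symmetric])
    ultimately show ?thesis by blast
  qed
qed

lemma ex_antimono_enumeration:
  fixes x :: "'a \<Rightarrow> real"
  assumes "finite D"
  obtains a where "bij_betw a {..<card D} D" "\<And>i j. i \<le> j \<Longrightarrow> j < card D \<Longrightarrow> x (a j) \<le> x (a i)"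
proof -
  obtain \<rho> where \<rho>: "bij_betw \<rho> D {..<card D}" "\<And>u v. \<lbrakk>u \<in> D; v \<in> D; - x u < - x v\<rbrakk> \<Longrightarrow> \<rho> u < \<rho> v"
    using ex_monotone_enumeration[OF assms, of "\<lambda>u. - x u"] by blast
  let ?a = "inv_into D \<rho>"
  have a: "bij_betw ?a {..<card D} D" using bij_betw_inv_into[OF \<rho>(1)] .
  have "x (?a j) \<le> x (?a i)" if "i \<le> j" "j < card D" for i j
  proof (rule ccontr)
    assume "\<not> ?thesis"
    moreover have "?a i \<in> D" "?a j \<in> D" using a that by (auto simp: bij_betw_def)
    ultimately have "\<rho> (?a j) < \<rho> (?a i)" using \<rho>(2) by simp
    moreover have "\<rho> (?a i) = i" "\<rho> (?a j) = j" using \<rho>(1) that by (simp_all add: bij_betw_inv_into_right)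
    ultimately show False using that by simp
  qed
  with a show ?thesis using that by blast
qed

text \<open>An exchange argument with the threshold \<open>y (card L)\<close>: indices of
  \<open>L\<close> beyond the initial segment are worth at most this, the missing initial ones at
  least this, and there are equally many of both.\<close>

lemma sum_le_sum_initial:
  fixes y :: "nat \<Rightarrow> real"
  assumes "L \<subseteq> {..<n}" "\<And>i j. i \<le> j \<Longrightarrow> j < n \<Longrightarrow> y j \<le> y i"
  shows "sum y L \<le> sum y {..<card L}"
proof -
  let ?m = "card L"
  have fin: "finite L" using assms(1) finite_subset by blast
  have le: "?m \<le> n" using card_mono[OF _ assms(1)] by simp
  show ?thesis
  proof (cases "?m = n")
    \<comment> \<open>Here the threshold \<open>y ?m\<close> would lie outside the range in which
      \<open>y\<close> is known to be sorted.\<close>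
    case True
    hence "L = {..<n}" using assms(1) by (intro card_subset_eq) auto
    thus ?thesis by simp
  next
    case False
    hence mn: "?m < n" using le by simp
    have c: "card (L - {..<?m}) = card ({..<?m} - L)"
    proof -
      have "card (L - {..<?m}) = ?m - card (L \<inter> {..<?m})" using fin by (simp add: card_Diff_subset_Int)
      moreover have "card ({..<?m} - L) = ?m - card ({..<?m} \<inter> L)" by (simp add: card_Diff_subset_Int)
      ultimately show ?thesis by (simp add: Int_commute)
    qed
    have "sum y L = sum y (L \<inter> {..<?m}) + sum y (L - {..<?m})"
      using fin by (rule sum.Int_Diff)
    also have "sum y (L - {..<?m}) \<le> card (L - {..<?m}) * y ?m"
      using assms by (intro sum_bounded_above) auto
    also have "\<dots> = card ({..<?m} - L) * y ?m" using c by simp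
    also have "\<dots> \<le> sum y ({..<?m} - L)"
      using assms(2) mn by (intro sum_bounded_below) auto
    also have "sum y (L \<inter> {..<?m}) + sum y ({..<?m} - L) = sum y {..<?m}"
      by (subst sum.Int_Diff[of "{..<?m}" y L]) (auto simp: Int_commute)
    finally show ?thesis by simp
  qed
qed

lemma abel_sum_nonneg:
  fixes c z :: "nat \<Rightarrow> real"
  assumes "\<And>m. m \<le> n \<Longrightarrow> (\<Sum>i<m. z i) \<ge> 0" "\<And>i j. i \<le> j \<Longrightarrow> j < n \<Longrightarrow> c j \<le> c i"
    "\<And>i. i < n \<Longrightarrow> c i \<ge> 0"
  shows "(\<Sum>i<n. c i * z i) \<ge> 0"
proof (cases n)
  case (Suc k)
  \<comment> \<open>Summation by parts as an induction: passing from \<open>c m\<close> to the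
    smaller \<open>c (Suc m)\<close> only decreases the left side, because the partial sum it
    multiplies is nonnegative.\<close>
  have "m < n \<Longrightarrow> c m * (\<Sum>i<Suc m. z i) \<le> (\<Sum>i<Suc m. c i * z i)" for m
  proof (induction m)
    case (Suc m)
    have "c (Suc m) * (\<Sum>i<Suc m. z i) \<le> c m * (\<Sum>i<Suc m. z i)"
      using assms(1)[of "Suc m"] assms(2)[of m "Suc m"] Suc.prems by (intro mult_right_mono) auto
    thus ?case using Suc by (simp add: algebra_simps)
  qed simp
  from this[of k] assms(1)[of n] assms(3)[of k] Suc show ?thesis
    by (metis lessI mult_nonneg_nonneg order.refl order.trans)
qed simp

text \<open>Weak majorisation (Tomic--Weyl): by convexity \<open>exp y - exp x \<ge> exp x * (y - x)\<close>, and the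
  latter sums to something nonnegative by Abel summation once both families are sorted.\<close>

lemma sum_exp_weak_majorization:
  fixes x :: "'a \<Rightarrow> real" and y :: "'b \<Rightarrow> real"
  assumes fin: "finite D" "finite D'" and card: "card D' = card D"
    and maj: "\<And>M. M \<subseteq> D \<Longrightarrow> \<exists>M'\<subseteq>D'. card M' = card M \<and> sum x M \<le> sum y M'"
  shows "(\<Sum>i\<in>D. exp (x i)) \<le> (\<Sum>i\<in>D'. exp (y i))"
proof -
  define n where "n = card D"
  obtain a where a: "bij_betw a {..<n} D" "\<And>i j. i \<le> j \<Longrightarrow> j < n \<Longrightarrow> x (a j) \<le> x (a i)"
    using ex_antimono_enumeration[OF fin(1), of x] unfolding n_def by metis
  obtain b where b: "bij_betw b {..<n} D'" "\<And>i j. i \<le> j \<Longrightarrow> j < n \<Longrightarrow> y (b j) \<le> y (b i)"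
    using ex_antimono_enumeration[OF fin(2), of y] unfolding n_def card by metis
  \<comment> \<open>\<open>maj\<close> yields some \<open>M'\<close> of size \<open>m\<close> for
    the \<open>m\<close> largest values of \<open>x\<close>; replacing \<open>M'\<close> by the
    positions of the \<open>m\<close> largest values of \<open>y\<close> can only increase its
    sum.\<close>
  have part: "(\<Sum>i<m. y (b i) - x (a i)) \<ge> 0" if m: "m \<le> n" for m
  proof -
    have inj: "inj_on a {..<m}" using a(1) m by (auto simp: bij_betw_def intro: inj_on_subset)
    have "a ` {..<m} \<subseteq> D" using a(1) m by (auto simp: bij_betw_def)
    then obtain M' where M': "M' \<subseteq> D'" "card M' = m" "sum x (a ` {..<m}) \<le> sum y M'"
      using maj[of "a ` {..<m}"] inj by (auto simp: card_image)
    define L where "L = {i \<in> {..<n}. b i \<in> M'}"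
    have bL: "bij_betw b L M'" using b(1) M'(1) unfolding L_def bij_betw_def inj_on_def by auto
    have "sum y M' = (\<Sum>i\<in>L. y (b i))" using sum.reindex_bij_betw[OF bL, of y] by simp
    also have "\<dots> \<le> (\<Sum>i<card L. y (b i))"
      using b(2) by (intro sum_le_sum_initial[where n = n]) (auto simp: L_def)
    also have "card L = m" using bij_betw_same_card[OF bL] M'(2) by simp
    finally show ?thesis using M'(3) inj by (simp add: sum.reindex sum_subtractf)
  qed
  have "0 \<le> (\<Sum>i<n. exp (x (a i)) * (y (b i) - x (a i)))"
    using part a(2) by (intro abel_sum_nonneg) auto
  also have "\<dots> \<le> (\<Sum>i<n. exp (y (b i)) - exp (x (a i)))"
  proof (rule sum_mono)
    fix i
    have "exp (x (a i)) * (1 + (y (b i) - x (a i))) \<le> exp (x (a i)) * exp (y (b i) - x (a i))"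
      by (intro mult_left_mono exp_ge_add_one_self) auto
    thus "exp (x (a i)) * (y (b i) - x (a i)) \<le> exp (y (b i)) - exp (x (a i))"
      by (simp add: exp_diff algebra_simps)
  qed
  also have "\<dots> = (\<Sum>i\<in>D'. exp (y i)) - (\<Sum>i\<in>D. exp (x i))"
    using sum.reindex_bij_betw[OF a(1), of "\<lambda>i. exp (x i)"] sum.reindex_bij_betw[OF b(1), of "\<lambda>i. exp (y i)"]
    by (simp add: sum_subtractf)
  finally show ?thesis by simp
qed

section \<open>Uncrossing a family of sets into a chain\<close>

lemma prod_list_map_mono:
  fixes f g :: "'a \<Rightarrow> real"
  shows "(\<And>x. x \<in> set xs \<Longrightarrow> 0 \<le> f x \<and> f x \<le> g x) \<Longrightarrow>
    0 \<le> prod_list (map f xs) \<and> prod_list (map f xs) \<le> prod_list (map g xs)"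
  by (induction xs) (fastforce intro!: mult_mono)+

lemma prod_list_map_pos:
  fixes f :: "'a \<Rightarrow> real"
  shows "(\<And>x. x \<in> set xs \<Longrightarrow> 0 < f x) \<Longrightarrow> 0 < prod_list (map f xs)"
  by (induction xs) simp_all

definition log_supermodular_on :: "'a set \<Rightarrow> ('a set \<Rightarrow> real) \<Rightarrow> bool" where
  "log_supermodular_on S f \<longleftrightarrow> (\<forall>A\<subseteq>S. \<forall>B\<subseteq>S. f A * f B \<le> f (A \<union> B) * f (A \<inter> B))"

text \<open>Insertion of \<open>B\<close> into a chain: a member and the travelling set are replaced
  by their union and their intersection, and the intersection travels on. The number of sets
  containing a given point never changes.\<close>

fun uncross :: "'a set \<Rightarrow> 'a set list \<Rightarrow> 'a set list" where
  "uncross B [] = [B]"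
| "uncross B (T # Ts) = (T \<union> B) # uncross (T \<inter> B) Ts"

lemma uncross_subset: "\<lbrakk>B \<subseteq> I; \<Union>(set Ts) \<subseteq> I\<rbrakk> \<Longrightarrow> X \<in> set (uncross B Ts) \<Longrightarrow> X \<subseteq> I"
  by (induction B Ts rule: uncross.induct) auto

lemma uncross_chain:
  "sorted_wrt (\<supseteq>) Ts \<Longrightarrow> sorted_wrt (\<supseteq>) (uncross B Ts)"
proof (induction B Ts rule: uncross.induct)
  case (2 B T Ts)
  have "X \<subseteq> T \<union> B" if "X \<in> set (uncross (T \<inter> B) Ts)" for X
    using 2(2) by (intro uncross_subset[OF _ _ that]) auto
  thus ?case using 2 by simp
qed simp

text \<open>Each member of the list costs one application of log-supermodularity.\<close>

lemma prod_list_uncross_le: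
  assumes "log_supermodular_on I u" "\<And>A. A \<subseteq> I \<Longrightarrow> u A > 0" "B \<subseteq> I" "\<Union>(set Ts) \<subseteq> I"
  shows "u B * prod_list (map u Ts) \<le> prod_list (map u (uncross B Ts))"
  using assms(3,4)
proof (induction B Ts rule: uncross.induct)
  case (2 B T Ts)
  have pos: "prod_list (map u Ts) > 0" using 2(3) assms(2) by (intro prod_list_map_pos) auto
  have "u B * prod_list (map u (T # Ts)) = (u T * u B) * prod_list (map u Ts)" by simp
  also have "\<dots> \<le> (u (T \<union> B) * u (T \<inter> B)) * prod_list (map u Ts)"
    using assms(1) 2 pos unfolding log_supermodular_on_def by (intro mult_right_mono) auto
  also have "\<dots> \<le> u (T \<union> B) * prod_list (map u (uncross (T \<inter> B) Ts))"
    unfolding mult.assoc using 2 assms(2)[of "T \<union> B"] by (intro mult_left_mono) auto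
  finally show ?case by simp
qed simp

text \<open>For a modular weight each exchange is an equality. This is what allows a bound obtained
  on the chain to be carried back to the original sets.\<close>

lemma prod_list_uncross_eq:
  fixes s :: "'a \<Rightarrow> real"
  assumes "finite I" "B \<subseteq> I" "\<Union>(set Ts) \<subseteq> I"
  shows "prod s B * prod_list (map (prod s) Ts) = prod_list (map (prod s) (uncross B Ts))"
  using assms(2,3)
proof (induction B Ts rule: uncross.induct)
  case (2 B T Ts)
  have "finite B" "finite T" using 2 assms(1) finite_subset by auto
  hence "prod s T * prod s B = prod s (T \<union> B) * prod s (T \<inter> B)" by (simp add: prod.union_inter)
  moreover have "prod s (T \<inter> B) * prod_list (map (prod s) Ts) = prod_list (map (prod s) (uncross (T \<inter> B) Ts))"
    using 2 by auto
  ultimately have "prod s B * (prod s T * prod_list (map (prod s) Ts))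
      = prod s (T \<union> B) * prod_list (map (prod s) (uncross (T \<inter> B) Ts))"
    by (metis mult.assoc mult.commute)
  thus ?case by simp
qed simp

text \<open>Entry \<open>j\<close> of the result is the set of points contained in more than
  \<open>j\<close> members of \<open>As\<close>, since uncrossing preserves multiplicities and
  produces a decreasing chain.\<close>

definition nested :: "'a set list \<Rightarrow> 'a set list" where
  "nested As = foldr uncross As []"

lemma nested_subset: "\<Union>(set As) \<subseteq> I \<Longrightarrow> \<Union>(set (nested As)) \<subseteq> I"
proof (induction As)
  case (Cons A As)
  hence *: "A \<subseteq> I" "\<Union>(set (nested As)) \<subseteq> I" by auto
  show ?case
  proof (rule Union_least)
    fix X assume "X \<in> set (nested (A # As))"
    hence "X \<in> set (uncross A (nested As))" by (simp add: nested_def)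
    thus "X \<subseteq> I" by (rule uncross_subset[OF *])
  qed
qed (simp add: nested_def)

lemma nested_chain: "sorted_wrt (\<supseteq>) (nested As)"
  by (induction As) (simp_all add: nested_def uncross_chain)

lemma prod_list_nested_le:
  assumes "log_supermodular_on I u" "\<And>A. A \<subseteq> I \<Longrightarrow> u A > 0" "\<Union>(set As) \<subseteq> I"
  shows "prod_list (map u As) \<le> prod_list (map u (nested As))"
  using assms(3)
proof (induction As)
  case (Cons A As)
  have "prod_list (map u (A # As)) \<le> u A * prod_list (map u (nested As))"
    using Cons assms(2)[of A] by (auto intro!: mult_left_mono)
  also have "\<dots> \<le> prod_list (map u (nested (A # As)))"
    using prod_list_uncross_le[OF assms(1,2), of A "nested As"] nested_subset[of As I] Cons.prems
    by (simp add: nested_def)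
  finally show ?case .
qed (simp add: nested_def)

lemma prod_list_nested_eq:
  fixes s :: "'a \<Rightarrow> real"
  assumes "finite I" "\<Union>(set As) \<subseteq> I"
  shows "prod_list (map (prod s) As) = prod_list (map (prod s) (nested As))"
  using assms(2)
proof (induction As)
  case (Cons A As)
  thus ?case
    using prod_list_uncross_eq[OF assms(1), of A "nested As" s] nested_subset[of As I]
    by (simp add: nested_def)
qed (simp add: nested_def)

section \<open>Relabelling a chain by initial segments\<close>

lemma down_closed_eq_lessThan:
  fixes A :: "nat set"
  assumes "finite A" "\<And>m n. n \<in> A \<Longrightarrow> m < n \<Longrightarrow> m \<in> A"
  shows "A = {..<card A}"
proof (cases "A = {}")
  case False
  have "A = {..Max A}"
    using assms Max_in[OF assms(1) False] Max_ge[OF assms(1)] by (auto simp: order_le_less)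
  moreover from this have "card A = Suc (Max A)" by (metis card_atMost)
  ultimately show ?thesis by (simp add: lessThan_Suc_atMost)
qed simp

text \<open>Enumerate first the points that lie in many members of the chain; a member then precedes
  its complement.\<close>

lemma ex_chain_straightening:
  assumes "finite I" "\<And>T. T \<in> C \<Longrightarrow> T \<subseteq> I" "\<And>T T'. T \<in> C \<Longrightarrow> T' \<in> C \<Longrightarrow> T \<subseteq> T' \<or> T' \<subseteq> T"
  obtains \<rho> where "bij_betw \<rho> I {..<card I}" "\<And>T. T \<in> C \<Longrightarrow> \<rho> ` T = {..<card T}"
proof -
  have finC: "finite C" using assms(1,2) by (intro finite_subset[of C "Pow I"]) auto
  let ?d = "\<lambda>x. - int (card {T \<in> C. x \<in> T})"
  obtain \<rho> where \<rho>: "bij_betw \<rho> I {..<card I}" "\<And>x y. \<lbrakk>x \<in> I; y \<in> I; ?d x < ?d y\<rbrakk> \<Longrightarrow> \<rho> x < \<rho> y"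
    using ex_monotone_enumeration[OF assms(1), of ?d] by blast
  have "\<rho> ` T = {..<card T}" if T: "T \<in> C" for T
  proof -
    have fT: "finite T" using assms(1,2) T finite_subset by blast
    have "m \<in> \<rho> ` T" if n: "n \<in> \<rho> ` T" "m < n" for m n
    proof -
      obtain x where x: "x \<in> T" "n = \<rho> x" using n by auto
      have xI: "x \<in> I" using x T assms(2) by auto
      have "m \<in> {..<card I}" using bij_betwE[OF \<rho>(1)] xI n x by force
      then obtain y where y: "y \<in> I" "m = \<rho> y" using \<rho>(1) by (auto simp: bij_betw_def)
      have "y \<in> T"
      proof (rule ccontr)
        assume "y \<notin> T"
        \<comment> \<open>A member containing \<open>y\<close> is comparable with \<open>T\<close>
          but not inside it, so it contains \<open>T\<close> and hence \<open>x\<close>. The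
          inclusion is strict because \<open>T\<close> contains \<open>x\<close> and not
          \<open>y\<close>.\<close>
        hence "{T \<in> C. y \<in> T} \<subset> {T \<in> C. x \<in> T}" using T x assms(3)[OF T] by blast
        hence "card {T \<in> C. y \<in> T} < card {T \<in> C. x \<in> T}" using finC by (intro psubset_card_mono) auto
        hence "\<rho> x < \<rho> y" using \<rho>(2) xI y by simp
        thus False using n x y by simp
      qed
      thus ?thesis using y by auto
    qed
    hence "\<rho> ` T = {..<card (\<rho> ` T)}" using fT by (intro down_closed_eq_lessThan) auto
    also have "card (\<rho> ` T) = card T"
      using \<rho>(1) assms(2)[OF T] by (meson bij_betw_def card_image inj_on_subset)
    finally show ?thesis .
  qed
  thus ?thesis using that \<rho>(1) by blast
qed

text \<open>Uncrossing turns a family of distinct sets into a chain; relabelling \<open>I\<close> so that this chain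
  consists of initial segments gives distinct subsets of \<open>{..<card I}\<close> whose weights dominate.\<close>

lemma sum_log_supermodular_le:
  fixes u :: "'a set \<Rightarrow> real" and r :: "nat \<Rightarrow> real"
  assumes fin: "finite I" and lsm: "log_supermodular_on I u"
    and pos: "\<And>A. A \<subseteq> I \<Longrightarrow> u A > 0" and r: "\<And>l. r l > 0"
    and le: "\<And>A. A \<subseteq> I \<Longrightarrow> u A \<le> (\<Prod>l<card A. r l)"
  shows "(\<Sum>A\<in>Pow I. u A) \<le> (\<Prod>l<card I. 1 + r l)"
proof -
  define v where "v = (\<lambda>A. \<Prod>l\<in>A. r l)"
  have vpos: "v A > 0" for A unfolding v_def using r by (simp add: prod_pos)
  have "(\<Sum>A\<in>Pow I. exp (ln (u A))) \<le> (\<Sum>A\<in>Pow {..<card I}. exp (ln (v A)))"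
  proof (rule sum_exp_weak_majorization)
    show "finite (Pow I)" "finite (Pow {..<card I})" "card (Pow {..<card I}) = card (Pow I)"
      using fin by (auto simp: card_Pow)
    fix M assume M: "M \<subseteq> Pow I"
    have finM: "finite M" using M fin finite_subset by blast
    obtain As where As: "set As = M" "distinct As" using finite_distinct_list[OF finM] by blast
    let ?N = "nested As"
    have sub: "\<Union>(set As) \<subseteq> I" using As M by auto
    have Nsub: "T \<subseteq> I" if "T \<in> set ?N" for T using nested_subset[OF sub] that by auto
    have chain: "T \<subseteq> T' \<or> T' \<subseteq> T" if "T \<in> set ?N" "T' \<in> set ?N" for T T'
      using nested_chain[of As] that by (metis in_set_conv_nth linorder_neqE_nat order_refl sorted_wrt_nth_less)
    obtain \<rho> where \<rho>: "bij_betw \<rho> I {..<card I}" "\<And>T. T \<in> set ?N \<Longrightarrow> \<rho> ` T = {..<card T}"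
      using ex_chain_straightening[OF fin Nsub chain] by blast
    have inj: "inj_on \<rho> A" if "A \<subseteq> I" for A using \<rho>(1) that by (meson bij_betw_def inj_on_subset)
    have v_img: "v (\<rho> ` A) = (\<Prod>x\<in>A. r (\<rho> x))" if "A \<subseteq> I" for A
      unfolding v_def using inj[OF that] by (simp add: prod.reindex)
    have inj2: "inj_on ((`) \<rho>) M"
      using \<rho>(1) M by (meson bij_betw_def inj_on_image_Pow inj_on_subset)
    have "(\<Prod>A\<in>M. u A) = prod_list (map u As)"
      unfolding As(1)[symmetric] by (rule prod.distinct_set_conv_list[OF As(2)])
    also have "\<dots> \<le> prod_list (map u ?N)" by (rule prod_list_nested_le[OF lsm pos sub])
    \<comment> \<open>Only here is \<open>le\<close> used: the image of a chain member under
      \<open>\<rho>\<close> is an initial segment, so its bound is a product of \<open>r\<close>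
      over that image.\<close>
    also have "\<dots> \<le> prod_list (map (\<lambda>T. \<Prod>x\<in>T. r (\<rho> x)) ?N)"
    proof -
      have "u T \<le> (\<Prod>x\<in>T. r (\<rho> x))" if "T \<in> set ?N" for T
        using le[OF Nsub[OF that]] v_img[OF Nsub[OF that]] \<rho>(2)[OF that] by (simp add: v_def)
      moreover have "0 \<le> u T" if "T \<in> set ?N" for T using pos[OF Nsub[OF that]] by simp
      ultimately show ?thesis
        by (intro conjunct2[OF prod_list_map_mono]) auto
    qed
    \<comment> \<open>The bound is modular in \<open>T\<close>, so the uncrossing can be undone. The
      relabelled sets of \<open>M\<close> are again distinct, as a family in the majorising sum has
      to be.\<close>
    also have "\<dots> = prod_list (map (\<lambda>T. \<Prod>x\<in>T. r (\<rho> x)) As)"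
      by (rule prod_list_nested_eq[OF fin sub, symmetric])
    also have "\<dots> = (\<Prod>A\<in>M. v (\<rho> ` A))"
    proof -
      have "(\<Prod>A\<in>M. v (\<rho> ` A)) = (\<Prod>A\<in>M. \<Prod>x\<in>A. r (\<rho> x))"
        using M v_img by (intro prod.cong) auto
      also have "\<dots> = prod_list (map (\<lambda>T. \<Prod>x\<in>T. r (\<rho> x)) As)"
        unfolding As(1)[symmetric] by (rule prod.distinct_set_conv_list[OF As(2)])
      finally show ?thesis by simp
    qed
    also have "\<dots> = (\<Prod>A\<in>(`) \<rho> ` M. v A)" using inj2 by (simp add: prod.reindex)
    finally have lnle: "ln (\<Prod>A\<in>M. u A) \<le> ln (\<Prod>A\<in>(`) \<rho> ` M. v A)"
      using pos M vpos by (intro ln_mono prod_pos) auto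
    have "(\<Sum>A\<in>M. ln (u A)) \<le> (\<Sum>A\<in>(`) \<rho> ` M. ln (v A))"
    proof -
      have "u A \<noteq> 0" if "A \<in> M" for A using pos[of A] M that by auto
      moreover have "v A \<noteq> 0" for A using vpos[of A] by simp
      ultimately show ?thesis using finM lnle by (simp add: ln_prod)
    qed
    moreover have "(`) \<rho> ` M \<subseteq> Pow {..<card I}" using M \<rho>(1) by (auto simp: bij_betw_def)
    moreover have "card ((`) \<rho> ` M) = card M" using inj2 by (rule card_image)
    ultimately show "\<exists>M'\<subseteq>Pow {..<card I}. card M' = card M \<and> (\<Sum>A\<in>M. ln (u A)) \<le> (\<Sum>A\<in>M'. ln (v A))"
      by blast
  qed
  also have "(\<Sum>A\<in>Pow {..<card I}. exp (ln (v A))) = (\<Sum>A\<in>Pow {..<card I}. v A)"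
    using vpos by simp
  also have "\<dots> = (\<Prod>l<card I. r l + 1)"
    by (subst prod_add) (auto simp: v_def)
  finally show ?thesis using pos by (simp add: add.commute)
qed

text \<open>The one-point case of the four functions theorem; the index tells whether the point is
  absent or present. Both cross terms are at most \<open>c1 * d0\<close>, and their product is at
  most \<open>c1 * d0\<close> times \<open>c0 * d1\<close>.\<close>

lemma four_numbers:
  fixes a0 :: real
  assumes "a0 * b0 \<le> c0 * d0" "a1 * b1 \<le> c1 * d1" "a0 * b1 \<le> c1 * d0" "a1 * b0 \<le> c1 * d0"
    and pos: "a0 > 0" "a1 > 0" "b0 > 0" "b1 > 0" "c0 > 0" "c1 > 0" "d0 > 0" "d1 > 0"
  shows "(a0 + a1) * (b0 + b1) \<le> (c0 + c1) * (d0 + d1)"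
proof -
  let ?M = "c1 * d0"
  have "(a0 * b1) * (a1 * b0) = (a0 * b0) * (a1 * b1)" by simp
  also have "\<dots> \<le> (c0 * d0) * (c1 * d1)" using assms(2) pos by (intro mult_mono[OF assms(1)]) auto
  finally have 1: "(a0 * b1) * (a1 * b0) \<le> ?M * (c0 * d1)" by (simp add: mult_ac)
  \<comment> \<open>Two numbers below \<open>?M\<close> with a given bound on their product have the
    largest sum when one of them equals \<open>?M\<close>.\<close>
  have "0 \<le> (?M - a0 * b1) * (?M - a1 * b0)" using assms by (intro mult_nonneg_nonneg) linarith+
  hence "?M * (a0 * b1 + a1 * b0) \<le> ?M * ?M + (a0 * b1) * (a1 * b0)" by (simp add: algebra_simps)
  also have "\<dots> \<le> ?M * (?M + c0 * d1)" using 1 by (simp add: algebra_simps)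
  finally have "a0 * b1 + a1 * b0 \<le> ?M + c0 * d1"
    using pos by (subst (asm) mult_le_cancel_left_pos) auto
  thus ?thesis using assms(1,2) by (simp add: algebra_simps)
qed

section \<open>Marginals of log-supermodular functions\<close>

lemma sum_Pow_Un:
  fixes h :: "'a set \<Rightarrow> 'b::comm_monoid_add"
  assumes "A \<inter> B = {}"
  shows "(\<Sum>X\<in>Pow (A \<union> B). h X) = (\<Sum>X\<in>Pow A. \<Sum>Y\<in>Pow B. h (X \<union> Y))"
proof -
  have "(\<Sum>X\<in>Pow A. \<Sum>Y\<in>Pow B. h (X \<union> Y)) = (\<Sum>(X, Y)\<in>Pow A \<times> Pow B. h (X \<union> Y))"
    by (rule sum.cartesian_product)
  also have "\<dots> = (\<Sum>X\<in>Pow (A \<union> B). h X)"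
    using assms
    by (intro sum.reindex_bij_witness[where i = "\<lambda>X. (X \<inter> A, X \<inter> B)" and j = "\<lambda>(X, Y). X \<union> Y"])
       (auto intro!: arg_cong[where f = h])
  finally show ?thesis by simp
qed

lemma sum_Pow_insert:
  fixes h :: "'a set \<Rightarrow> 'b::comm_monoid_add"
  assumes "p \<notin> A"
  shows "(\<Sum>X\<in>Pow (insert p A). h X) = (\<Sum>X\<in>Pow A. h X + h (insert p X))"
proof -
  have "Pow {p} = {{}, {p}}" by auto
  thus ?thesis using sum_Pow_Un[of A "{p}" h] assms by simp
qed

lemma log_supermodular_add_insert:
  assumes "log_supermodular_on (insert p S) f" "p \<notin> S" "\<And>A. A \<subseteq> insert p S \<Longrightarrow> f A > 0"
  shows "log_supermodular_on S (\<lambda>A. f A + f (insert p A))"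
  unfolding log_supermodular_on_def
proof (intro allI impI)
  fix A B assume AB: "A \<subseteq> S" "B \<subseteq> S"
  have lsm: "f X * f Y \<le> f (X \<union> Y) * f (X \<inter> Y)" if "X \<subseteq> insert p S" "Y \<subseteq> insert p S" for X Y
    using assms(1) that unfolding log_supermodular_on_def by blast
  have p: "p \<notin> A" "p \<notin> B" using AB assms(2) by auto
  show "(f A + f (insert p A)) * (f B + f (insert p B))
    \<le> (f (A \<union> B) + f (insert p (A \<union> B))) * (f (A \<inter> B) + f (insert p (A \<inter> B)))"
  proof (rule four_numbers)
    show "f A * f B \<le> f (A \<union> B) * f (A \<inter> B)" using AB by (intro lsm) auto
    show "f (insert p A) * f (insert p B) \<le> f (insert p (A \<union> B)) * f (insert p (A \<inter> B))"
      using AB lsm[of "insert p A" "insert p B"] by (auto simp: insert_commute)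
    show "f A * f (insert p B) \<le> f (insert p (A \<union> B)) * f (A \<inter> B)"
      using AB lsm[of A "insert p B"] p by auto
    show "f (insert p A) * f B \<le> f (insert p (A \<union> B)) * f (A \<inter> B)"
      using AB lsm[of "insert p A" B] p by auto
  qed (use AB in \<open>auto intro!: assms(3)\<close>)
qed

text \<open>Keeps the induction over base edges going: after all lifts of one edge are summed out,
  the remaining function must satisfy the same hypothesis.\<close>

lemma log_supermodular_marginal:
  assumes "finite D" "D \<inter> S = {}" "log_supermodular_on (D \<union> S) f" "\<And>A. A \<subseteq> D \<union> S \<Longrightarrow> f A > 0"
  shows "log_supermodular_on S (\<lambda>A. \<Sum>Y\<in>Pow D. f (A \<union> Y))"
  using assms
proof (induction D arbitrary: f rule: finite_induct)
  case (insert p D)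
  let ?f = "\<lambda>A. f A + f (insert p A)"
  have "log_supermodular_on (D \<union> S) ?f"
    using insert.prems insert.hyps by (intro log_supermodular_add_insert) auto
  hence "log_supermodular_on S (\<lambda>A. \<Sum>Y\<in>Pow D. ?f (A \<union> Y))"
  proof (rule insert.IH[rotated])
    fix A assume "A \<subseteq> D \<union> S"
    thus "?f A > 0" using insert.prems(3)[of A] insert.prems(3)[of "insert p A"] by fastforce
  qed (use insert.prems in auto)
  thus ?case using insert.hyps by (simp add: sum_Pow_insert)
qed simp

text \<open>The levels decrease in \<open>j\<close>, and an edge with \<open>k\<close> lifts in
  \<open>A\<close> lies in exactly the first \<open>k\<close> of them. They remember multiplicities
  and forget which lifts were taken.\<close>

definition level :: "'e set \<Rightarrow> ('e \<times> 'i) set \<Rightarrow> nat \<Rightarrow> 'e set" where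
  "level E A j = {e \<in> E. j < card (A `` {e})}"

text \<open>Summing out the lifts of \<open>e\<close> turns \<open>f\<close> into its marginal
  \<open>?F\<close> and \<open>g\<close> into \<open>?G\<close>, so both vary in the induction. That
  \<open>?F\<close> is again bounded through the levels is the single-edge inequality
  \<open>sum_log_supermodular_le\<close>.\<close>

lemma sum_cover_le:
  fixes f :: "('e \<times> 'i) set \<Rightarrow> real" and g :: "'e set \<Rightarrow> real"
  assumes "finite E" and I: "finite I" and "log_supermodular_on (E \<times> I) f"
    and "\<And>A. A \<subseteq> E \<times> I \<Longrightarrow> f A > 0" and "\<And>B. B \<subseteq> E \<Longrightarrow> g B > 0"
    and "\<And>A. A \<subseteq> E \<times> I \<Longrightarrow> f A \<le> (\<Prod>j<card I. g (level E A j))"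
  shows "(\<Sum>A\<in>Pow (E \<times> I). f A) \<le> (\<Sum>B\<in>Pow E. g B) ^ card I"
  using assms(1,3-)
proof (induction E arbitrary: f g rule: finite_induct)
  case empty
  thus ?case using empty(4)[of "{}"] by (simp add: level_def)
next
  case (insert e E)
  let ?F = "\<lambda>A. \<Sum>Y\<in>Pow ({e} \<times> I). f (A \<union> Y)" and ?G = "\<lambda>B. g B + g (insert e B)"
  have split: "insert e E \<times> I = {e} \<times> I \<union> E \<times> I" "({e} \<times> I) \<inter> (E \<times> I) = {}"
    using insert.hyps by auto
  have F: "?F A \<le> (\<Prod>j<card I. ?G (level E A j))" if A: "A \<subseteq> E \<times> I" for A
  proof -
    define L where "L = level E A"
    \<comment> \<open>\<open>P\<close> is the bound when no lift of \<open>e\<close> is taken, and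
      \<open>r l\<close> is the factor gained when \<open>e\<close> joins level \<open>l\<close>. A
      set \<open>Y\<close> of lifts puts \<open>e\<close> into the first \<open>card Y\<close>
      levels.\<close>
    define P where "P = (\<Prod>j<card I. g (L j))"
    define r where "r = (\<lambda>l. g (insert e (L l)) / g (L l))"
    define u where "u = (\<lambda>Y. f (A \<union> {e} \<times> Y) / P)"
    have LE: "L j \<subseteq> E" for j by (auto simp: L_def level_def)
    have gpos: "g (L j) > 0" "g (insert e (L j)) > 0" for j
      using LE[of j] by (auto intro!: insert.prems(3))
    have Ppos: "P > 0" unfolding P_def using gpos by (intro prod_pos) auto
    have upos: "u Y > 0" if "Y \<subseteq> I" for Y
      unfolding u_def using A that Ppos by (intro divide_pos_pos insert.prems(2)) auto
    have ule: "u Y \<le> (\<Prod>l<card Y. r l)" if Y: "Y \<subseteq> I" for Y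
    proof -
      have lev: "level (insert e E) (A \<union> {e} \<times> Y) j = (if j < card Y then insert e (L j) else L j)" for j
      proof -
        have "(A \<union> {e} \<times> Y) `` {e} = Y" using A insert.hyps by auto
        moreover have "(A \<union> {e} \<times> Y) `` {x} = A `` {x}" if "x \<in> E" for x using that insert.hyps by auto
        ultimately show ?thesis using insert.hyps unfolding level_def L_def by auto
      qed
      have cY: "card Y \<le> card I" using Y I by (rule card_mono[rotated])
      have "f (A \<union> {e} \<times> Y) \<le> (\<Prod>j<card I. g (level (insert e E) (A \<union> {e} \<times> Y) j))"
        using A Y by (intro insert.prems(4)) auto
      also have "\<dots> = (\<Prod>j<card I. g (L j) * (if j < card Y then r j else 1))"
        unfolding lev r_def using gpos by (intro prod.cong) (auto simp: less_imp_neq[symmetric])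
      also have "\<dots> = P * (\<Prod>j<card I. if j < card Y then r j else 1)"
        by (simp add: prod.distrib P_def)
      also have "(\<Prod>j<card I. if j < card Y then r j else 1) = (\<Prod>j<card Y. r j)"
        using cY by (intro prod.mono_neutral_cong_right) auto
      finally show ?thesis using Ppos by (simp add: u_def field_simps)
    qed
    have lsm: "log_supermodular_on I u"
      unfolding log_supermodular_on_def
    proof (intro allI impI)
      fix X Y assume XY: "X \<subseteq> I" "Y \<subseteq> I"
      have eq: "(A \<union> {e} \<times> X) \<union> (A \<union> {e} \<times> Y) = A \<union> {e} \<times> (X \<union> Y)"
        "(A \<union> {e} \<times> X) \<inter> (A \<union> {e} \<times> Y) = A \<union> {e} \<times> (X \<inter> Y)"
        by auto
      have "f (A \<union> {e} \<times> X) * f (A \<union> {e} \<times> Y) \<le> f (A \<union> {e} \<times> (X \<union> Y)) * f (A \<union> {e} \<times> (X \<inter> Y))"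
        using insert.prems(1)[unfolded log_supermodular_on_def, rule_format, of "A \<union> {e} \<times> X" "A \<union> {e} \<times> Y"] A XY
        unfolding eq by auto
      thus "u X * u Y \<le> u (X \<union> Y) * u (X \<inter> Y)"
        using Ppos by (simp add: u_def divide_right_mono)
    qed
    have "?F A = (\<Sum>Y\<in>Pow I. f (A \<union> {e} \<times> Y))"
      by (rule sum.reindex_bij_witness[where i = "\<lambda>Y. {e} \<times> Y" and j = "\<lambda>Y. Y `` {e}"])
         (auto intro!: arg_cong[where f = f])
    also have "\<dots> = P * (\<Sum>Y\<in>Pow I. u Y)"
      using Ppos by (simp add: u_def sum_distrib_left)
    also have "\<dots> \<le> P * (\<Prod>l<card I. 1 + r l)"
      using Ppos gpos by (intro mult_left_mono sum_log_supermodular_le I lsm upos ule) (auto simp: r_def)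
    also have "\<dots> = (\<Prod>l<card I. g (L l) * (1 + r l))" by (simp add: P_def prod.distrib)
    also have "\<dots> = (\<Prod>l<card I. ?G (L l))"
      unfolding r_def using gpos by (intro prod.cong) (auto simp: field_simps less_imp_neq[symmetric])
    finally show ?thesis by (simp add: L_def)
  qed
  have "(\<Sum>A\<in>Pow (insert e E \<times> I). f A) = (\<Sum>A\<in>Pow (E \<times> I). ?F A)"
    unfolding split(1) using split(2) by (subst Un_commute, subst sum_Pow_Un) auto
  also have "\<dots> \<le> (\<Sum>B\<in>Pow E. ?G B) ^ card I"
  proof (rule insert.IH)
    show "log_supermodular_on (E \<times> I) ?F"
      using insert.prems(1,2) split I by (intro log_supermodular_marginal) auto
    show "?F A > 0" if "A \<subseteq> E \<times> I" for A
      using that I by (intro sum_pos insert.prems(2)) auto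
    show "?G B > 0" if "B \<subseteq> E" for B
      using that insert.prems(3)[of B] insert.prems(3)[of "insert e B"] by fastforce
  qed (rule F)
  finally show ?case using insert.hyps by (simp add: sum_Pow_insert)
qed

section \<open>Components of covers\<close>

text \<open>A permutation at each end, although their quotient alone determines the cover up to
  relabelling of lifts: contraction twists the sheets over the removed vertex, and either end of an
  edge may lie there.\<close>

definition cover_ends ::
  "('e \<Rightarrow> 'v) \<Rightarrow> ('e \<Rightarrow> 'v) \<Rightarrow> ('e \<Rightarrow> 'i \<Rightarrow> 'i) \<Rightarrow> ('e \<Rightarrow> 'i \<Rightarrow> 'i) \<Rightarrow> 'e \<times> 'i \<Rightarrow> ('v \<times> 'i) \<times> ('v \<times> 'i)" where
  "cover_ends a b \<alpha> \<beta> = (\<lambda>(e, i). ((a e, \<alpha> e i), (b e, \<beta> e i)))"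

lemma level_subset: "level E A j \<subseteq> E"
  by (auto simp: level_def)

lemma level_Diff:
  "level (E - {e}) (A \<inter> ((E - {e}) \<times> I)) j = level E (A \<inter> (E \<times> I)) j - {e}"
proof -
  have "(A \<inter> ((E - {e}) \<times> I)) `` {x} = (A \<inter> (E \<times> I)) `` {x}" if "x \<noteq> e" for x using that by auto
  thus ?thesis by (auto simp: level_def)
qed

lemma colourings_loop:
  assumes "a e = b e"
  shows "colourings V q (\<lambda>e. (a e, b e)) (L - {e}) = colourings V q (\<lambda>e. (a e, b e)) L"
  using assms by (auto simp: colourings_def)

section \<open>Contraction of a base edge\<close>

definition identify :: "'v \<Rightarrow> 'v \<Rightarrow> 'v \<Rightarrow> 'v" where
  "identify u v x = (if x = v then u else x)"

text \<open>Giving \<open>v\<close> the colour of \<open>u\<close> extends a colouring of the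
  contracted graph to one that also respects \<open>e\<close>.\<close>

lemma card_colourings_contract:
  assumes "finite V" "u \<in> V" "v \<in> V" "u \<noteq> v" and e: "a e = u" "b e = v"
    and ends: "\<And>x. x \<in> L \<Longrightarrow> a x \<in> V \<and> b x \<in> V"
  shows "card (colourings (V - {v}) q (\<lambda>e. (identify u v (a e), identify u v (b e))) L)
    \<le> card (colourings V q (\<lambda>e. (a e, b e)) (insert e L))"
proof (rule card_inj_on_le[where f = "\<lambda>\<sigma>. restrict (\<lambda>w. \<sigma> (identify u v w)) V"])
  let ?K = "colourings (V - {v}) q (\<lambda>e. (identify u v (a e), identify u v (b e))) L"
  let ?f = "\<lambda>\<sigma>. restrict (\<lambda>w. \<sigma> (identify u v w)) V"
  have mV: "identify u v w \<in> V - {v}" if "w \<in> V" for w using that assms by (auto simp: identify_def)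
  show "finite (colourings V q (\<lambda>e. (a e, b e)) (insert e L))" using assms by simp
  show "inj_on ?f ?K"
  proof (rule inj_onI)
    fix \<sigma> \<sigma>' assume s: "\<sigma> \<in> ?K" "\<sigma>' \<in> ?K" "?f \<sigma> = ?f \<sigma>'"
    have "\<sigma> \<in> V - {v} \<rightarrow>\<^sub>E {1..q}" "\<sigma>' \<in> V - {v} \<rightarrow>\<^sub>E {1..q}" using s by (auto simp: colourings_def)
    thus "\<sigma> = \<sigma>'"
    proof (rule PiE_ext)
      fix w assume "w \<in> V - {v}"
      thus "\<sigma> w = \<sigma>' w" using fun_cong[OF s(3), of w] by (simp add: identify_def)
    qed
  qed
  show "?f ` ?K \<subseteq> colourings V q (\<lambda>e. (a e, b e)) (insert e L)"
  proof (rule image_subsetI)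
    fix \<sigma> assume s: "\<sigma> \<in> ?K"
    hence sP: "\<sigma> \<in> V - {v} \<rightarrow>\<^sub>E {1..q}"
      and sc: "\<And>x. x \<in> L \<Longrightarrow> \<sigma> (identify u v (a x)) = \<sigma> (identify u v (b x))"
      by (auto simp: colourings_def)
    have "?f \<sigma> \<in> V \<rightarrow>\<^sub>E {1..q}"
      using PiE_mem[OF sP mV] by (intro restrict_PiE_iff[THEN iffD2]) blast
    moreover have "?f \<sigma> (a x) = ?f \<sigma> (b x)" if "x \<in> insert e L" for x
    proof (cases "x = e")
      case True
      thus ?thesis using assms by (simp add: identify_def)
    next
      case False
      thus ?thesis using sc[of x] ends[of x] that by simp
    qed
    ultimately show "?f \<sigma> \<in> colourings V q (\<lambda>e. (a e, b e)) (insert e L)"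
      by (auto simp: colourings_def)
  qed
qed

text \<open>The lifts of \<open>e\<close> match the sheets over \<open>u\<close> perfectly with
  those over \<open>v\<close>, so the colours over \<open>v\<close> are those over \<open>u\<close>
  moved by \<open>r\<close>. Hence restriction loses nothing, and an edge end over \<open>v\<close>
  is redirected to \<open>u\<close> by composing its permutation with \<open>r\<close>.\<close>

lemma card_colourings_cover_contract:
  assumes "finite V" "finite I" "u \<in> V" "v \<in> V" "u \<noteq> v" and e: "a e = u" "b e = v"
    and perm: "\<alpha> e permutes I" "\<beta> e permutes I" and "{e} \<times> I \<subseteq> A" "A' \<subseteq> A"
    and ends: "\<And>x i. (x, i) \<in> A' \<Longrightarrow> a x \<in> V \<and> b x \<in> V \<and> \<alpha> x i \<in> I \<and> \<beta> x i \<in> I"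
    and r: "r = \<alpha> e \<circ> inv (\<beta> e)"
    and tw: "\<And>c \<gamma> x. tw c \<gamma> x = (if c x = v then r \<circ> \<gamma> x else \<gamma> x)"
  shows "card (colourings (V \<times> I) q (cover_ends a b \<alpha> \<beta>) A)
    \<le> card (colourings ((V - {v}) \<times> I) q
        (cover_ends (identify u v \<circ> a) (identify u v \<circ> b) (tw a \<alpha>) (tw b \<beta>)) A')"
proof (rule card_inj_on_le[where f = "\<lambda>\<sigma>. restrict \<sigma> ((V - {v}) \<times> I)"])
  let ?K = "colourings (V \<times> I) q (cover_ends a b \<alpha> \<beta>) A"
  let ?K' = "colourings ((V - {v}) \<times> I) q
        (cover_ends (identify u v \<circ> a) (identify u v \<circ> b) (tw a \<alpha>) (tw b \<beta>)) A'"
  show "finite ?K'" using assms by simp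
  have rI: "r i \<in> I" if "i \<in> I" for i
    using that perm r by (simp add: permutes_in_image permutes_inv)
  have rep: "\<sigma> (w, i) = \<sigma> (identify u v w, if w = v then r i else i)" if "\<sigma> \<in> ?K" "i \<in> I" for \<sigma> w i
  proof (cases "w = v")
    case True
    let ?m = "inv (\<beta> e) i"
    have "?m \<in> I" using that(2) perm(2) by (simp add: permutes_in_image permutes_inv)
    hence "(e, ?m) \<in> A" using assms by auto
    hence "\<sigma> (u, \<alpha> e ?m) = \<sigma> (v, \<beta> e ?m)"
      using that(1) e by (fastforce simp: colourings_def cover_ends_def)
    thus ?thesis using True perm(2) r by (simp add: identify_def permutes_inverses)
  qed (simp add: identify_def)
  show "inj_on (\<lambda>\<sigma>. restrict \<sigma> ((V - {v}) \<times> I)) ?K"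
  proof (rule inj_onI)
    fix \<sigma> \<sigma>' assume s: "\<sigma> \<in> ?K" "\<sigma>' \<in> ?K"
      "restrict \<sigma> ((V - {v}) \<times> I) = restrict \<sigma>' ((V - {v}) \<times> I)"
    have "\<sigma> \<in> V \<times> I \<rightarrow>\<^sub>E {1..q}" "\<sigma>' \<in> V \<times> I \<rightarrow>\<^sub>E {1..q}" using s by (auto simp: colourings_def)
    thus "\<sigma> = \<sigma>'"
    proof (rule PiE_ext)
      fix p assume "p \<in> V \<times> I"
      then obtain w i where p: "p = (w, i)" "w \<in> V" "i \<in> I" by auto
      let ?p = "(identify u v w, if w = v then r i else i)"
      have "?p \<in> (V - {v}) \<times> I" using p rI assms by (auto simp: identify_def)
      hence "\<sigma> ?p = \<sigma>' ?p" using fun_cong[OF s(3), of ?p] by (simp del: split_paired_All)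
      thus "\<sigma> p = \<sigma>' p" using rep[OF s(1) p(3), of w] rep[OF s(2) p(3), of w] p(1) by metis
    qed
  qed
  show "(\<lambda>\<sigma>. restrict \<sigma> ((V - {v}) \<times> I)) ` ?K \<subseteq> ?K'"
  proof (rule image_subsetI)
    fix \<sigma> assume s: "\<sigma> \<in> ?K"
    let ?s = "restrict \<sigma> ((V - {v}) \<times> I)"
    have sP: "\<sigma> \<in> V \<times> I \<rightarrow>\<^sub>E {1..q}" using s by (auto simp: colourings_def)
    have "?s \<in> (V - {v}) \<times> I \<rightarrow>\<^sub>E {1..q}"
      using PiE_mem[OF sP] by (intro restrict_PiE_iff[THEN iffD2]) blast
    moreover have eq: "?s (identify u v (a x), tw a \<alpha> x i) = ?s (identify u v (b x), tw b \<beta> x i)"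
      if xi: "(x, i) \<in> A'" for x i
    proof -
      have en: "a x \<in> V" "b x \<in> V" "\<alpha> x i \<in> I" "\<beta> x i \<in> I" using ends[OF xi] by auto
      have 1: "?s (identify u v (a x), tw a \<alpha> x i) = \<sigma> (a x, \<alpha> x i)"
        proof -
          have eq: "tw a \<alpha> x i = (if a x = v then r (\<alpha> x i) else \<alpha> x i)" by (simp add: tw)
          have "(identify u v (a x), tw a \<alpha> x i) \<in> (V - {v}) \<times> I"
            using en rI[OF en(3)] assms(3,5) \<open>u \<in> V\<close> unfolding eq by (auto simp: identify_def)
          thus ?thesis using rep[OF s en(3), of "a x"] unfolding eq by (metis restrict_apply')
        qed
      have 2: "?s (identify u v (b x), tw b \<beta> x i) = \<sigma> (b x, \<beta> x i)"
        proof -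
          have eq: "tw b \<beta> x i = (if b x = v then r (\<beta> x i) else \<beta> x i)" by (simp add: tw)
          have "(identify u v (b x), tw b \<beta> x i) \<in> (V - {v}) \<times> I"
            using en rI[OF en(4)] assms(3,5) \<open>u \<in> V\<close> unfolding eq by (auto simp: identify_def)
          thus ?thesis using rep[OF s en(4), of "b x"] unfolding eq by (metis restrict_apply')
        qed
      have "(x, i) \<in> A" using xi assms by auto
      hence "\<sigma> (a x, \<alpha> x i) = \<sigma> (b x, \<beta> x i)"
        using s by (fastforce simp: colourings_def cover_ends_def)
      thus ?thesis using 1 2 by simp
    qed
    moreover have "?s (fst (cover_ends (identify u v \<circ> a) (identify u v \<circ> b) (tw a \<alpha>) (tw b \<beta>) p))
        = ?s (snd (cover_ends (identify u v \<circ> a) (identify u v \<circ> b) (tw a \<alpha>) (tw b \<beta>) p))"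
      if "p \<in> A'" for p
    proof -
      obtain x i where p: "p = (x, i)" by force
      show ?thesis using eq[of x i] that unfolding p cover_ends_def by (simp only: prod.case fst_conv snd_conv o_apply)
    qed
    ultimately show "?s \<in> ?K'" unfolding colourings_def by blast
  qed
qed

text \<open>In terms of the number of components: an edge set \<open>A\<close> of an \<open>N\<close>-fold cover has at most as many
  components as its level sets \<open>{e. j < card (A `` {e})}\<close>, \<open>j < N\<close>, have together. Contract a base edge
  \<open>e\<close> of maximal multiplicity; completing its lift to a perfect matching costs
  \<open>N - card (A `` {e})\<close>, which is gained back on the levels not containing \<open>e\<close>, all of which are empty.\<close>

lemma card_colourings_cover_le:
  fixes a b :: "'e \<Rightarrow> 'v" and \<alpha> \<beta> :: "'e \<Rightarrow> 'i \<Rightarrow> 'i"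
  assumes "finite V" "finite E" "finite I" "q \<ge> 1" "A \<subseteq> E \<times> I"
    and "\<And>e. e \<in> E \<Longrightarrow> a e \<in> V \<and> b e \<in> V"
    and "\<And>e. e \<in> E \<Longrightarrow> \<alpha> e permutes I \<and> \<beta> e permutes I"
  shows "card (colourings (V \<times> I) q (cover_ends a b \<alpha> \<beta>) A)
    \<le> (\<Prod>j<card I. card (colourings V q (\<lambda>e. (a e, b e)) (level E A j)))"
  using assms(1,2,5-)
proof (induction "card E" arbitrary: E V A a b \<alpha> \<beta>)
  case 0
  thus ?case using assms(3)
    by (simp add: level_def card_colourings_empty card_cartesian_product power_mult)
next
  case (Suc n)
  define k where "k = (\<lambda>e. card (A `` {e}))"
  have "E \<noteq> {}" using Suc.hyps by auto
  hence "Max (k ` E) \<in> k ` E" using Suc.prems(2) by (intro Max_in) auto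
  then obtain e where e: "e \<in> E" "Max (k ` E) = k e" by blast
  hence max: "k x \<le> k e" if "x \<in> E" for x using that Suc.prems(2) by (metis Max_ge finite_imageI imageI)
  define E' A' where "E' = E - {e}" and "A' = A \<inter> (E' \<times> I)"
  have E': "card E' = n" "finite E'" "E' \<subseteq> E" using Suc.hyps Suc.prems e by (auto simp: E'_def)
  have AE: "A \<inter> (E \<times> I) = A" using Suc.prems by blast
  have lev: "level E' A' j = level E A j - {e}" for j
    using level_Diff[of E e A I j] by (simp add: A'_def E'_def AE)
  have ends: "a x \<in> V" "b x \<in> V" "\<alpha> x permutes I" "\<beta> x permutes I" if "x \<in> E" for x
    using Suc.prems that by auto
  have endsI: "\<alpha> x i \<in> I \<and> \<beta> x i \<in> I" if "x \<in> E" "i \<in> I" for x i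
    using ends[OF that(1)] that(2) by (simp add: permutes_in_image)
  have cover: "cover_ends a b \<alpha> \<beta> p \<in> (V \<times> I) \<times> (V \<times> I)" if "p \<in> E \<times> I" for p
    using that ends endsI by (auto simp: cover_ends_def)
  show ?case
  proof (cases "a e = b e")
    \<comment> \<open>Earlier contractions may have produced loops. A loop constrains no level, and
      dropping its lifts only increases the number of colourings of the cover.\<close>
    case True
    have "card (colourings (V \<times> I) q (cover_ends a b \<alpha> \<beta>) A)
        \<le> card (colourings (V \<times> I) q (cover_ends a b \<alpha> \<beta>) A')"
      using Suc.prems(1) assms(3) by (intro card_mono finite_colourings colourings_antimono) (auto simp: A'_def)
    also have "\<dots> \<le> (\<Prod>j<card I. card (colourings V q (\<lambda>e. (a e, b e)) (level E' A' j)))"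
      using E' ends Suc.prems(1) by (intro Suc.hyps(1)) (auto simp: A'_def)
    also have "\<dots> = (\<Prod>j<card I. card (colourings V q (\<lambda>e. (a e, b e)) (level E A j)))"
      unfolding lev colourings_loop[of a e b, OF True] ..
    finally show ?thesis .
  next
    case False
    let ?u = "a e" and ?v = "b e"
    let ?m = "identify ?u ?v" and ?V = "V - {b e}"
    define r where "r = \<alpha> e \<circ> inv (\<beta> e)"
    define tw where "tw = (\<lambda>(c :: 'e \<Rightarrow> 'v) (\<gamma> :: 'e \<Rightarrow> 'i \<Rightarrow> 'i) x. if c x = ?v then r \<circ> \<gamma> x else \<gamma> x)"
    have uv: "?u \<in> V" "?v \<in> V" using ends e by auto
    have rperm: "r permutes I" unfolding r_def using ends[OF e(1)] by (intro permutes_compose permutes_inv)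
    have Ae: "A `` {e} \<subseteq> I" using Suc.prems by auto
    let ?D = "{e} \<times> (I - A `` {e})"
    have cD: "card ?D = card I - k e" using Ae assms(3) finite_subset[OF Ae]
      by (simp add: card_cartesian_product card_Diff_subset k_def)
    have "card (colourings (V \<times> I) q (cover_ends a b \<alpha> \<beta>) A)
        \<le> q ^ card ?D * card (colourings (V \<times> I) q (cover_ends a b \<alpha> \<beta>) (A \<union> ?D))"
      using Suc.prems assms e by (intro card_colourings_union cover) auto
    also have "card (colourings (V \<times> I) q (cover_ends a b \<alpha> \<beta>) (A \<union> ?D))
        \<le> card (colourings (?V \<times> I) q (cover_ends (?m \<circ> a) (?m \<circ> b) (tw a \<alpha>) (tw b \<beta>)) A')"
    proof (rule card_colourings_cover_contract[where e = e and r = r and tw = tw])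
      show "{e} \<times> I \<subseteq> A \<union> ?D" "A' \<subseteq> A \<union> ?D" by (auto simp: A'_def)
      show "a x \<in> V \<and> b x \<in> V \<and> \<alpha> x i \<in> I \<and> \<beta> x i \<in> I" if "(x, i) \<in> A'" for x i
        using that ends endsI E' by (auto simp: A'_def)
    qed (use False uv assms(3) Suc.prems(1) ends[OF e(1)] in \<open>auto simp: r_def tw_def\<close>)
    also have "\<dots> \<le> (\<Prod>j<card I. card (colourings ?V q (\<lambda>e. ((?m \<circ> a) e, (?m \<circ> b) e)) (level E' A' j)))"
    proof (rule Suc.hyps(1))
      show "(?m \<circ> a) x \<in> ?V \<and> (?m \<circ> b) x \<in> ?V" if "x \<in> E'" for x
        using that ends[of x] E' uv False by (auto simp: identify_def)
      show "tw a \<alpha> x permutes I \<and> tw b \<beta> x permutes I" if "x \<in> E'" for x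
        using that ends[of x] E' rperm by (auto simp: tw_def intro: permutes_compose)
    qed (use E' Suc.prems(1) in \<open>auto simp: A'_def\<close>)
    finally have "card (colourings (V \<times> I) q (cover_ends a b \<alpha> \<beta>) A) \<le> q ^ (card I - k e) *
        (\<Prod>j<card I. card (colourings ?V q (\<lambda>e. (?m (a e), ?m (b e))) (level E' A' j)))"
      by (simp add: cD)
    \<comment> \<open>The cost of completing the matching is one factor \<open>q\<close> for each
      level that does not contain \<open>e\<close>.\<close>
    also have "q ^ (card I - k e) = (\<Prod>j<card I. if j < k e then 1 else q)"
    proof -
      have "k e \<le> card I" unfolding k_def using Ae assms(3) by (rule card_mono[rotated])
      moreover have "{..<card I} - {j. j < k e} = {k e..<card I}" by auto
      ultimately show ?thesis by (simp add: prod.If_cases Diff_eq)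
    qed
    also have "\<dots> * (\<Prod>j<card I. card (colourings ?V q (\<lambda>e. (?m (a e), ?m (b e))) (level E' A' j)))
        = (\<Prod>j<card I. (if j < k e then 1 else q) * card (colourings ?V q (\<lambda>e. (?m (a e), ?m (b e))) (level E' A' j)))"
      by (simp add: prod.distrib)
    also have "\<dots> \<le> (\<Prod>j<card I. card (colourings V q (\<lambda>e. (a e, b e)) (level E A j)))"
    proof (rule prod_mono, rule conjI)
      fix j
      show "(if j < k e then 1 else q) * card (colourings ?V q (\<lambda>e. (?m (a e), ?m (b e))) (level E' A' j))
          \<le> card (colourings V q (\<lambda>e. (a e, b e)) (level E A j))"
      proof (cases "j < k e")
        case True
        hence "e \<in> level E A j" using e by (auto simp: level_def k_def)
        hence ins: "insert e (level E' A' j) = level E A j" by (auto simp: lev)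
        have "card (colourings ?V q (\<lambda>e. (?m (a e), ?m (b e))) (level E' A' j))
            \<le> card (colourings V q (\<lambda>e. (a e, b e)) (insert e (level E' A' j)))"
          using uv False Suc.prems(1) ends level_subset[of E A j]
          by (intro card_colourings_contract) (auto simp: lev)
        thus ?thesis using True ins by simp
      next
        case False
        \<comment> \<open>Maximality of \<open>k e\<close> empties the level. The extra factor
          \<open>q\<close> then accounts for the colour of the vertex \<open>b e\<close> that the
          contraction removed.\<close>
        hence "level E A j = {}" using max by (fastforce simp: level_def k_def)
        moreover have "q * q ^ (card V - 1) = q ^ card V"
          using uv Suc.prems(1) card_gt_0_iff[of V] by (metis Suc_diff_1 empty_iff power_Suc)
        ultimately show ?thesis
          using False Suc.prems(1) uv by (simp add: lev card_colourings_empty card_Diff_subset)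
      qed
    qed simp
    finally show ?thesis by simp
  qed
qed

section \<open>Partition functions of covers\<close>

text \<open>The random cluster expansion: multiplying out, the edges at which the second summand is
  chosen form \<open>B\<close>, and the surviving colourings are those constant along
  \<open>B\<close>.\<close>

lemma fortuin_kasteleyn:
  fixes w :: "'p \<Rightarrow> real"
  assumes "finite S" "finite P"
  shows "(\<Sum>\<sigma>\<in>S \<rightarrow>\<^sub>E {1..q}. \<Prod>p\<in>P. 1 + w p * of_bool (\<sigma> (fst (c p)) = \<sigma> (snd (c p))))
    = (\<Sum>B\<in>Pow P. (\<Prod>p\<in>B. w p) * card (colourings S q c B))"
proof -
  let ?X = "S \<rightarrow>\<^sub>E {1..q}" and ?d = "\<lambda>\<sigma> p. \<sigma> (fst (c p)) = \<sigma> (snd (c p))"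
  have fin: "finite ?X" using assms by (intro finite_PiE) auto
  have "(\<Sum>\<sigma>\<in>?X. \<Prod>p\<in>P. 1 + w p * of_bool (?d \<sigma> p))
      = (\<Sum>\<sigma>\<in>?X. \<Sum>B\<in>Pow P. (\<Prod>p\<in>B. w p) * of_bool (\<forall>p\<in>B. ?d \<sigma> p))"
  proof (rule sum.cong[OF refl])
    fix \<sigma>
    have "(\<Prod>p\<in>B. of_bool (?d \<sigma> p)) = (of_bool (\<forall>p\<in>B. ?d \<sigma> p) :: real)" if "B \<subseteq> P" for B
      using finite_subset[OF that assms(2)] by (induction B rule: finite_induct) auto
    thus "(\<Prod>p\<in>P. 1 + w p * of_bool (?d \<sigma> p)) = (\<Sum>B\<in>Pow P. (\<Prod>p\<in>B. w p) * of_bool (\<forall>p\<in>B. ?d \<sigma> p))"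
      using prod_add[OF assms(2), of "\<lambda>p. w p * of_bool (?d \<sigma> p)" "\<lambda>_. 1"]
      by (simp add: add.commute prod.distrib)
  qed
  also have "\<dots> = (\<Sum>B\<in>Pow P. (\<Prod>p\<in>B. w p) * (\<Sum>\<sigma>\<in>?X. of_bool (\<forall>p\<in>B. ?d \<sigma> p)))"
    by (subst sum.swap) (simp add: sum_distrib_left)
  also have "\<dots> = (\<Sum>B\<in>Pow P. (\<Prod>p\<in>B. w p) * card (colourings S q c B))"
    using fin by (simp add: sum.If_cases of_bool_def colourings_def Int_def)
  finally show ?thesis .
qed

lemma prod_level:
  fixes w :: "'e \<Rightarrow> real"
  assumes "finite E" "finite I" "A \<subseteq> E \<times> I"
  shows "(\<Prod>p\<in>A. w (fst p)) = (\<Prod>j<card I. \<Prod>e\<in>level E A j. w e)"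
proof -
  let ?k = "\<lambda>e. card (A `` {e})"
  have A: "A = Sigma E (\<lambda>e. A `` {e})" using assms(3) by auto
  have fA: "finite (A `` {e})" for e using assms(3) by (intro finite_subset[OF _ assms(2)]) auto
  have k: "?k e \<le> card I" for e using assms(3) by (intro card_mono[OF assms(2)]) auto
  have "(\<Prod>p\<in>A. w (fst p)) = (\<Prod>e\<in>E. \<Prod>i\<in>A `` {e}. w e)"
    by (subst A, subst prod.Sigma) (use assms(1) fA in \<open>auto simp: split_beta\<close>)
  also have "\<dots> = (\<Prod>e\<in>E. \<Prod>j<card I. if j < ?k e then w e else 1)"
  proof (rule prod.cong[OF refl])
    fix e
    have "(\<Prod>j<card I. if j < ?k e then w e else 1) = (\<Prod>j<?k e. w e)"
      using k[of e] by (intro prod.mono_neutral_cong_right) auto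
    thus "(\<Prod>i\<in>A `` {e}. w e) = (\<Prod>j<card I. if j < ?k e then w e else 1)" by simp
  qed
  also have "\<dots> = (\<Prod>j<card I. \<Prod>e\<in>E. if j < ?k e then w e else 1)" by (rule prod.swap)
  also have "\<dots> = (\<Prod>j<card I. \<Prod>e\<in>level E A j. w e)"
    using assms(1) by (intro prod.cong refl prod.mono_neutral_cong_right) (auto simp: level_def)
  finally show ?thesis .
qed

text \<open>The Potts partition function for \<open>w e = exp (J e) - 1\<close>, written so that its
  product expands over edge sets, and with oriented edges as the covers require.\<close>

definition potts_sum :: "'v set \<Rightarrow> 'e set \<Rightarrow> ('e \<Rightarrow> 'v) \<Rightarrow> ('e \<Rightarrow> 'v) \<Rightarrow> nat \<Rightarrow> ('e \<Rightarrow> real) \<Rightarrow> real" where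
  "potts_sum V E a b q w = (\<Sum>\<sigma>\<in>V \<rightarrow>\<^sub>E {1..q}. \<Prod>e\<in>E. 1 + w e * of_bool (\<sigma> (a e) = \<sigma> (b e)))"

text \<open>The random cluster weights satisfy the hypotheses of \<open>sum_cover_le\<close>: the
  edge weights are modular and split exactly over the levels, while the colouring counts contribute
  both inequalities.\<close>

lemma potts_cover_le:
  fixes w :: "'e \<Rightarrow> real"
  assumes fin: "finite V" "finite E" "finite I" and q: "q \<ge> 1" and w: "\<And>e. e \<in> E \<Longrightarrow> w e > 0"
    and ends: "\<And>e. e \<in> E \<Longrightarrow> a e \<in> V \<and> b e \<in> V"
    and perm: "\<And>e. e \<in> E \<Longrightarrow> \<pi> e permutes I"
  shows "(\<Sum>\<sigma>\<in>V \<times> I \<rightarrow>\<^sub>E {1..q}. \<Prod>e\<in>E. \<Prod>i\<in>I. 1 + w e * of_bool (\<sigma> (a e, i) = \<sigma> (b e, \<pi> e i)))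
    \<le> potts_sum V E a b q w ^ card I"
proof -
  let ?c = "cover_ends a b (\<lambda>_ i. i) \<pi>" and ?ends = "\<lambda>e. (a e, b e)"
  let ?f = "\<lambda>A. (\<Prod>p\<in>A. w (fst p)) * card (colourings (V \<times> I) q ?c A)"
  let ?g = "\<lambda>B. (\<Prod>e\<in>B. w e) * card (colourings V q ?ends B)"
  have c: "?c p \<in> (V \<times> I) \<times> (V \<times> I)" if "p \<in> E \<times> I" for p
    using that ends perm by (auto simp: cover_ends_def permutes_in_image)
  have finEI: "finite (E \<times> I)" "finite (V \<times> I)" using fin by auto
  have wpos: "(\<Prod>p\<in>A. w (fst p)) > 0" if "A \<subseteq> E \<times> I" for A
    using that w by (intro prod_pos) auto
  have "(\<Sum>\<sigma>\<in>V \<times> I \<rightarrow>\<^sub>E {1..q}. \<Prod>e\<in>E. \<Prod>i\<in>I. 1 + w e * of_bool (\<sigma> (a e, i) = \<sigma> (b e, \<pi> e i)))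
      = (\<Sum>\<sigma>\<in>V \<times> I \<rightarrow>\<^sub>E {1..q}. \<Prod>p\<in>E \<times> I. 1 + w (fst p) * of_bool (\<sigma> (fst (?c p)) = \<sigma> (snd (?c p))))"
    by (simp add: prod.cartesian_product cover_ends_def split_beta)
  also have "\<dots> = (\<Sum>A\<in>Pow (E \<times> I). ?f A)"
    by (rule fortuin_kasteleyn[OF finEI(2,1)])
  also have "\<dots> \<le> (\<Sum>B\<in>Pow E. ?g B) ^ card I"
  proof (rule sum_cover_le[OF fin(2,3)])
    show "log_supermodular_on (E \<times> I) ?f"
      unfolding log_supermodular_on_def
    proof (intro allI impI)
      fix A B assume AB: "A \<subseteq> E \<times> I" "B \<subseteq> E \<times> I"
      have fAB: "finite A" "finite B" using AB finEI finite_subset by auto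
      have 1: "(\<Prod>p\<in>A. w (fst p)) * (\<Prod>p\<in>B. w (fst p))
          = (\<Prod>p\<in>A \<union> B. w (fst p)) * (\<Prod>p\<in>A \<inter> B. w (fst p))"
        using fAB by (simp add: prod.union_inter)
      have "card (colourings (V \<times> I) q ?c A) * card (colourings (V \<times> I) q ?c B)
          \<le> card (colourings (V \<times> I) q ?c (A \<union> B)) * card (colourings (V \<times> I) q ?c (A \<inter> B))"
        using AB by (intro card_colourings_supermodular finEI q c) auto
      from of_nat_mono[OF this, where 'a = real]
      have 2: "real (card (colourings (V \<times> I) q ?c A)) * card (colourings (V \<times> I) q ?c B)
          \<le> real (card (colourings (V \<times> I) q ?c (A \<union> B))) * card (colourings (V \<times> I) q ?c (A \<inter> B))"
        by simp
      have "?f A * ?f B = ((\<Prod>p\<in>A. w (fst p)) * (\<Prod>p\<in>B. w (fst p))) *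
          (real (card (colourings (V \<times> I) q ?c A)) * card (colourings (V \<times> I) q ?c B))"
        by (simp add: mult_ac)
      also have "\<dots> \<le> ((\<Prod>p\<in>A \<union> B. w (fst p)) * (\<Prod>p\<in>A \<inter> B. w (fst p))) *
          (real (card (colourings (V \<times> I) q ?c (A \<union> B))) * card (colourings (V \<times> I) q ?c (A \<inter> B)))"
        unfolding 1 using AB by (intro mult_left_mono 2 mult_nonneg_nonneg less_imp_le[OF wpos]) auto
      finally show "?f A * ?f B \<le> ?f (A \<union> B) * ?f (A \<inter> B)" by (simp add: mult_ac)
    qed
    show "?f A > 0" if A: "A \<subseteq> E \<times> I" for A
    proof -
      have "card (colourings (V \<times> I) q ?c A) > 0"
        using A by (intro card_colourings_pos finEI q c) auto
      thus ?thesis using wpos[OF A] by simp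
    qed
    show "?g B > 0" if B: "B \<subseteq> E" for B
    proof -
      have "card (colourings V q ?ends B) > 0" using B ends by (intro card_colourings_pos fin q) auto
      moreover have "(\<Prod>e\<in>B. w e) > 0" using B w by (intro prod_pos) auto
      ultimately show ?thesis by simp
    qed
    show "?f A \<le> (\<Prod>j<card I. ?g (level E A j))" if A: "A \<subseteq> E \<times> I" for A
    proof -
      have "card (colourings (V \<times> I) q ?c A) \<le> (\<Prod>j<card I. card (colourings V q ?ends (level E A j)))"
        using A ends perm by (intro card_colourings_cover_le fin q) (auto simp: permutes_id[unfolded id_def])
      from of_nat_mono[OF this, where 'a = real]
      have "real (card (colourings (V \<times> I) q ?c A)) \<le> (\<Prod>j<card I. real (card (colourings V q ?ends (level E A j))))"
        by simp
      hence "?f A \<le> (\<Prod>p\<in>A. w (fst p)) * (\<Prod>j<card I. real (card (colourings V q ?ends (level E A j))))"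
        using wpos[OF A] by (intro mult_left_mono) auto
      thus ?thesis using prod_level[OF fin(2,3) A, of w] by (simp add: prod.distrib)
    qed
  qed
  also have "(\<Sum>B\<in>Pow E. ?g B) = potts_sum V E a b q w"
    using fortuin_kasteleyn[OF fin(1,2), where q = q and w = w and c = ?ends] by (simp add: potts_sum_def)
  finally show ?thesis .
qed

section \<open>Averaging over covers\<close>

text \<open>A type class in the sense of information theory; it describes the colourings of the
  sheets over one vertex with prescribed colour frequencies.\<close>

definition seqs_of_type :: "'i set \<Rightarrow> 'y set \<Rightarrow> ('y \<Rightarrow> nat) \<Rightarrow> ('i \<Rightarrow> 'y) set" where
  "seqs_of_type I Y K = {z \<in> I \<rightarrow>\<^sub>E Y. \<forall>y\<in>Y. card {i \<in> I. z i = y} = K y}"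

lemma finite_seqs_of_type [simp]: "finite I \<Longrightarrow> finite Y \<Longrightarrow> finite (seqs_of_type I Y K)"
  unfolding seqs_of_type_def by (auto intro!: finite_PiE)

text \<open>Equal counts mean equal multisets of values, so some permutation of the positions
  carries one sequence to the other.\<close>

lemma seqs_of_type_transitive:
  assumes "finite I" "x \<in> seqs_of_type I Y K" "x' \<in> seqs_of_type I Y K"
  obtains \<rho> where "\<rho> permutes I" "\<And>i. i \<in> I \<Longrightarrow> x i = x' (\<rho> i)"
proof -
  have "image_mset x (mset_set I) = image_mset x' (mset_set I)"
  proof (rule multiset_eqI)
    fix y
    have *: "count (image_mset z (mset_set I)) y = (if y \<in> Y then K y else 0)"
      if "z \<in> seqs_of_type I Y K" for z
    proof -
      have "count (image_mset z (mset_set I)) y = card {i \<in> I. z i = y}"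
        using assms(1) by (simp add: count_image_mset vimage_def Int_def conj_commute)
      moreover have "card {i \<in> I. z i = y} = 0" if "y \<notin> Y"
      proof -
        have "{i \<in> I. z i = y} = {}" using that \<open>z \<in> _\<close> by (auto simp: seqs_of_type_def)
        thus ?thesis by (metis card.empty)
      qed
      ultimately show ?thesis using that by (auto simp: seqs_of_type_def)
    qed
    show "count (image_mset x (mset_set I)) y = count (image_mset x' (mset_set I)) y"
      using *[OF assms(2)] *[OF assms(3)] by simp
  qed
  from image_mset_eq_implies_permutes[OF assms(1) this] show ?thesis using that by metis
qed

text \<open>The lifts of one edge, given the colours \<open>x\<close> and \<open>y\<close> on the
  sheets over its ends, whose colour pairs occur with the frequencies \<open>K\<close>.\<close>

definition matchings ::
  "'i set \<Rightarrow> 'x set \<Rightarrow> ('x \<times> 'x \<Rightarrow> nat) \<Rightarrow> ('i \<Rightarrow> 'x) \<Rightarrow> ('i \<Rightarrow> 'x) \<Rightarrow> ('i \<Rightarrow> 'i) set" where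
  "matchings I X K x y = {\<pi>. \<pi> permutes I \<and> (\<forall>s\<in>X. \<forall>s'\<in>X. card {i \<in> I. x i = s \<and> y (\<pi> i) = s'} = K (s, s'))}"

lemma card_matchings_cong_right:
  assumes "\<rho> permutes I" "\<And>i. i \<in> I \<Longrightarrow> y i = y' (\<rho> i)"
  shows "card (matchings I X K x y) = card (matchings I X K x y')"
proof (rule bij_betw_same_card[where f = "\<lambda>\<pi>. \<rho> \<circ> \<pi>"], rule bij_betw_byWitness[where f' = "\<lambda>\<pi>. inv \<rho> \<circ> \<pi>"])
  have *: "{i \<in> I. x i = s \<and> y' ((\<rho> \<circ> \<pi>) i) = s'} = {i \<in> I. x i = s \<and> y (\<pi> i) = s'}" if "\<pi> permutes I" for s s' \<pi>
    using assms(2) permutes_in_image[OF that] by auto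
  show "(\<lambda>\<pi>. \<rho> \<circ> \<pi>) ` matchings I X K x y \<subseteq> matchings I X K x y'"
    using * assms(1) by (auto simp: matchings_def permutes_compose simp del: o_apply)
  have **: "{i \<in> I. x i = s \<and> y ((inv \<rho> \<circ> \<pi>) i) = s'} = {i \<in> I. x i = s \<and> y' (\<pi> i) = s'}" if "\<pi> permutes I" for s s' \<pi>
  proof -
    have "y ((inv \<rho> \<circ> \<pi>) i) = y' (\<pi> i)" if "i \<in> I" for i
    proof -
      have "inv \<rho> (\<pi> i) \<in> I" using \<open>\<pi> permutes I\<close> assms(1) that by (simp add: permutes_in_image permutes_inv)
      thus ?thesis using assms permutes_inverses(1)[OF assms(1)] by simp
    qed
    thus ?thesis by auto
  qed
  show "(\<lambda>\<pi>. inv \<rho> \<circ> \<pi>) ` matchings I X K x y' \<subseteq> matchings I X K x y"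
    using ** assms(1) by (auto simp: matchings_def permutes_compose permutes_inv simp del: o_apply)
qed (use assms(1) in \<open>auto simp: fun_eq_iff permutes_inverses\<close>)

lemma card_matchings_cong_left:
  assumes "\<rho> permutes I" "\<And>i. i \<in> I \<Longrightarrow> x i = x' (\<rho> i)"
  shows "card (matchings I X K x y) = card (matchings I X K x' y)"
proof (rule bij_betw_same_card[where f = "\<lambda>\<pi>. \<pi> \<circ> inv \<rho>"], rule bij_betw_byWitness[where f' = "\<lambda>\<pi>. \<pi> \<circ> \<rho>"])
  have card_eq: "card {i \<in> I. x' i = s \<and> y ((\<pi> \<circ> inv \<rho>) i) = s'} = card {i \<in> I. x i = s \<and> y (\<pi> i) = s'}" for s s' \<pi>
  proof (rule bij_betw_same_card[where f = "inv \<rho>"], rule bij_betw_byWitness[where f' = \<rho>])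
    show "inv \<rho> ` {i \<in> I. x' i = s \<and> y ((\<pi> \<circ> inv \<rho>) i) = s'} \<subseteq> {i \<in> I. x i = s \<and> y (\<pi> i) = s'}"
      using assms permutes_in_image[OF permutes_inv[OF assms(1)]] by (auto simp: permutes_inverses)
    show "\<rho> ` {i \<in> I. x i = s \<and> y (\<pi> i) = s'} \<subseteq> {i \<in> I. x' i = s \<and> y ((\<pi> \<circ> inv \<rho>) i) = s'}"
      using assms permutes_in_image[OF assms(1)] by (auto simp: permutes_inverses)
  qed (use assms(1) in \<open>auto simp: permutes_inverses\<close>)
  show "(\<lambda>\<pi>. \<pi> \<circ> inv \<rho>) ` matchings I X K x y \<subseteq> matchings I X K x' y"
    using card_eq assms(1) by (auto simp: matchings_def permutes_compose permutes_inv simp del: o_apply)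
  have "\<pi> = (\<pi> \<circ> \<rho>) \<circ> inv \<rho>" for \<pi> using assms(1) by (auto simp: fun_eq_iff permutes_inverses)
  hence card_eq': "card {i \<in> I. x i = s \<and> y ((\<pi> \<circ> \<rho>) i) = s'} = card {i \<in> I. x' i = s \<and> y (\<pi> i) = s'}" for s s' \<pi>
    using card_eq[of s "\<pi> \<circ> \<rho>" s'] by metis
  show "(\<lambda>\<pi>. \<pi> \<circ> \<rho>) ` matchings I X K x' y \<subseteq> matchings I X K x y"
    using card_eq' assms(1) by (auto simp: matchings_def permutes_compose simp del: o_apply)
qed (use assms(1) in \<open>auto simp: fun_eq_iff permutes_inverses\<close>)

text \<open>Double counting of triples \<open>(x, y, \<pi>)\<close>: the number of matchings depends only on the types of
  \<open>x\<close> and \<open>y\<close>, since permutations act transitively on type classes.\<close>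

lemma card_matchings:
  assumes I: "finite I" and X: "finite X"
    and margins: "\<And>s. s \<in> X \<Longrightarrow> (\<Sum>s'\<in>X. K (s, s')) = Ka s" "\<And>s'. s' \<in> X \<Longrightarrow> (\<Sum>s\<in>X. K (s, s')) = Kb s'"
    and xy: "x \<in> seqs_of_type I X Ka" "y \<in> seqs_of_type I X Kb"
  shows "card (seqs_of_type I X Ka) * card (seqs_of_type I X Kb) * card (matchings I X K x y)
    = fact (card I) * card (seqs_of_type I (X \<times> X) K)"
proof -
  let ?T = "seqs_of_type I X Ka \<times> seqs_of_type I X Kb" and ?S = "{\<pi>. \<pi> permutes I}"
  let ?match = "\<lambda>x y \<pi>. \<forall>s\<in>X. \<forall>s'\<in>X. card {i \<in> I. x i = s \<and> y (\<pi> i) = s'} = K (s, s')"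
  have finT: "finite ?T" using I X by simp
  have finS: "finite ?S" using I by (rule finite_permutations)
  have const: "card (matchings I X K x' y') = card (matchings I X K x y)"
    if x'y': "x' \<in> seqs_of_type I X Ka" "y' \<in> seqs_of_type I X Kb" for x' y'
  proof -
    obtain \<rho> where \<rho>: "\<rho> permutes I" "\<And>i. i \<in> I \<Longrightarrow> x' i = x (\<rho> i)"
      using seqs_of_type_transitive[OF I x'y'(1) xy(1)] by metis
    obtain \<rho>' where \<rho>': "\<rho>' permutes I" "\<And>i. i \<in> I \<Longrightarrow> y' i = y (\<rho>' i)"
      using seqs_of_type_transitive[OF I x'y'(2) xy(2)] by metis
    show ?thesis 
      using card_matchings_cong_left[of \<rho> I x' x X K y'] card_matchings_cong_right[of \<rho>' I y' y X K x] \<rho> \<rho>'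
      by simp
  qed
  \<comment> \<open>For fixed \<open>\<pi>\<close> a pair \<open>(x, y)\<close> amounts to the
    sequence of colour pairs \<open>(x i, y (\<pi> i))\<close>; the margins of \<open>K\<close> give
    its components the types \<open>Ka\<close> and \<open>Kb\<close>.\<close>
  have count: "card {p \<in> ?T. ?match (fst p) (snd p) \<pi>} = card (seqs_of_type I (X \<times> X) K)" if \<pi>: "\<pi> permutes I" for \<pi>
  proof (rule bij_betw_same_card[where f = "\<lambda>p. restrict (\<lambda>i. (fst p i, snd p (\<pi> i))) I"],
      rule bij_betw_byWitness[where f' = "\<lambda>z. (restrict (fst \<circ> z) I, restrict (\<lambda>i. snd (z (inv \<pi> i))) I)"])
    let ?f = "\<lambda>p. restrict (\<lambda>i. (fst p i, snd p (\<pi> i))) I"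
    let ?g = "\<lambda>z. (restrict (fst \<circ> z) I, restrict (\<lambda>i. snd (z (inv \<pi> i))) I)"
    have \<pi>I: "\<pi> i \<in> I \<longleftrightarrow> i \<in> I" "inv \<pi> i \<in> I \<longleftrightarrow> i \<in> I" for i
      using \<pi> by (simp_all add: permutes_in_image permutes_inv)
    note inv = permutes_inverses[OF \<pi>]
    show "\<forall>p\<in>{p \<in> ?T. ?match (fst p) (snd p) \<pi>}. ?g (?f p) = p"
    proof
      fix p assume "p \<in> {p \<in> ?T. ?match (fst p) (snd p) \<pi>}"
      then obtain x y where p: "p = (x, y)" "x \<in> I \<rightarrow>\<^sub>E X" "y \<in> I \<rightarrow>\<^sub>E X" by (auto simp: seqs_of_type_def)
      have "restrict (fst \<circ> ?f p) I = x" using p by (intro ext) auto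
      moreover have "restrict (\<lambda>i. snd (?f p (inv \<pi> i))) I = y"

      proof
        fix i
        show "restrict (\<lambda>i. snd (?f p (inv \<pi> i))) I i = y i"
          using p(1) PiE_arb[OF p(3), of i] \<pi>I(2)[of i] inv(1)[of i] by (cases "i \<in> I") simp_all
      qed
      ultimately show "?g (?f p) = p" by (simp add: p(1))
    qed
    show "\<forall>z\<in>seqs_of_type I (X \<times> X) K. ?f (?g z) = z"
      
    proof
      fix z assume "z \<in> seqs_of_type I (X \<times> X) K"
      hence z: "z \<in> I \<rightarrow>\<^sub>E X \<times> X" by (auto simp: seqs_of_type_def)
      show "?f (?g z) = z"
      proof
        fix i
        show "?f (?g z) i = z i"
          using PiE_arb[OF z, of i] \<pi>I(1)[of i] inv(2)[of i] by (cases "i \<in> I") simp_all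
      qed
    qed
    show "?f ` {p \<in> ?T. ?match (fst p) (snd p) \<pi>} \<subseteq> seqs_of_type I (X \<times> X) K"
    proof (rule image_subsetI)
      fix p assume "p \<in> {p \<in> ?T. ?match (fst p) (snd p) \<pi>}"
      then obtain x y where p: "p = (x, y)" "x \<in> I \<rightarrow>\<^sub>E X" "y \<in> I \<rightarrow>\<^sub>E X" "?match x y \<pi>"
        by (auto simp: seqs_of_type_def)
      have "{i \<in> I. ?f p i = (s, s')} = {i \<in> I. x i = s \<and> y (\<pi> i) = s'}" for s s' using p(1) by auto
      moreover have "?f p \<in> I \<rightarrow>\<^sub>E X \<times> X" using p \<pi>I by auto
      ultimately show "?f p \<in> seqs_of_type I (X \<times> X) K" using p(4) by (auto simp: seqs_of_type_def)
    qed
    show "?g ` seqs_of_type I (X \<times> X) K \<subseteq> {p \<in> ?T. ?match (fst p) (snd p) \<pi>}"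
    proof (rule image_subsetI)
      fix z assume z: "z \<in> seqs_of_type I (X \<times> X) K"
      hence zX: "fst (z i) \<in> X" "snd (z i) \<in> X" if "i \<in> I" for i
        using that by (auto simp: seqs_of_type_def dest!: PiE_mem)
      have zK: "card {i \<in> I. fst (z i) = s \<and> snd (z i) = s'} = K (s, s')" if "s \<in> X" "s' \<in> X" for s s'
      proof -
        have "{i \<in> I. fst (z i) = s \<and> snd (z i) = s'} = {i \<in> I. z i = (s, s')}" by (auto simp: prod_eq_iff)
        thus ?thesis using z that by (simp add: seqs_of_type_def)
      qed
      have ca: "card {i \<in> I. fst (z i) = s} = Ka s" if "s \<in> X" for s
      proof -
        have "{i \<in> I. fst (z i) = s} = (\<Union>s'\<in>X. {i \<in> I. fst (z i) = s \<and> snd (z i) = s'})" using zX by auto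
        also have "card \<dots> = (\<Sum>s'\<in>X. card {i \<in> I. fst (z i) = s \<and> snd (z i) = s'})"
          using X I by (intro card_UN_disjoint) auto
        also have "\<dots> = Ka s" using zK that margins(1) by simp
        finally show ?thesis .
      qed
      have cb: "card {i \<in> I. snd (z i) = s'} = Kb s'" if "s' \<in> X" for s'
      proof -
        have "{i \<in> I. snd (z i) = s'} = (\<Union>s\<in>X. {i \<in> I. fst (z i) = s \<and> snd (z i) = s'})" using zX by auto
        also have "card \<dots> = (\<Sum>s\<in>X. card {i \<in> I. fst (z i) = s \<and> snd (z i) = s'})"
          using X I by (intro card_UN_disjoint) auto
        also have "\<dots> = Kb s'" using zK that margins(2) by simp
        finally show ?thesis .
      qed
      have "card {i \<in> I. snd (z (inv \<pi> i)) = s'} = card {i \<in> I. snd (z i) = s'}" for s'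
        by (rule bij_betw_same_card[where f = "inv \<pi>"], rule bij_betw_byWitness[where f' = \<pi>])
           (use \<pi>I inv in auto)
      hence 1: "restrict (\<lambda>i. snd (z (inv \<pi> i))) I \<in> seqs_of_type I X Kb"
        using zX \<pi>I cb by (auto simp: seqs_of_type_def cong: conj_cong)
      have 2: "restrict (fst \<circ> z) I \<in> seqs_of_type I X Ka"
        using zX ca by (auto simp: seqs_of_type_def cong: conj_cong)
      have "{i \<in> I. restrict (fst \<circ> z) I i = s \<and> restrict (\<lambda>i. snd (z (inv \<pi> i))) I (\<pi> i) = s'}
          = {i \<in> I. fst (z i) = s \<and> snd (z i) = s'}" for s s'
        using \<pi>I inv by auto
      hence "?match (fst (?g z)) (snd (?g z)) \<pi>" using zK by simp
      with 1 2 show "?g z \<in> {p \<in> ?T. ?match (fst p) (snd p) \<pi>}" by simp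
    qed
  qed
  have "card ?T * card (matchings I X K x y) = (\<Sum>p\<in>?T. card (matchings I X K (fst p) (snd p)))"
    using const by (simp add: mem_Times_iff)
  also have "\<dots> = (\<Sum>p\<in>?T. \<Sum>\<pi>\<in>?S. of_bool (?match (fst p) (snd p) \<pi>))"
    unfolding matchings_def using finS by (intro sum.cong refl) (auto simp: of_bool_def sum.If_cases Int_def)
  also have "\<dots> = (\<Sum>\<pi>\<in>?S. \<Sum>p\<in>?T. of_bool (?match (fst p) (snd p) \<pi>))" by (rule sum.swap)
  also have "\<dots> = (\<Sum>\<pi>\<in>?S. card {p \<in> ?T. ?match (fst p) (snd p) \<pi>})"
    using finT by (intro sum.cong refl) (auto simp: of_bool_def sum.If_cases Int_def)
  also have "\<dots> = fact (card I) * card (seqs_of_type I (X \<times> X) K)"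
    using count card_permutations[OF refl I] by simp
  finally show ?thesis by (simp add: card_cartesian_product)
qed

text \<open>The multinomial coefficient, stated without division. The positions of one symbol are
  chosen first, and the rest is a sequence on the complement; hence \<open>I\<close> varies in the
  induction.\<close>

lemma card_seqs_of_type:
  assumes "finite Y" "finite I" "(\<Sum>y\<in>Y. K y) = card I"
  shows "card (seqs_of_type I Y K) * (\<Prod>y\<in>Y. fact (K y)) = fact (card I)"
  using assms
proof (induction Y arbitrary: I rule: finite_induct)
  case empty
  hence "I = {}" by simp
  thus ?case by (simp add: seqs_of_type_def)
next
  case (insert y Y)
  let ?Sub = "{S. S \<subseteq> I \<and> card S = K y}"
  let ?Sig = "SIGMA S:?Sub. seqs_of_type (I - S) Y K"
  have le: "K y \<le> card I" using insert by simp
  have "card (seqs_of_type I (insert y Y) K) = card ?Sig"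
  proof (rule bij_betw_same_card[where f = "\<lambda>z. ({i \<in> I. z i = y}, restrict z (I - {i \<in> I. z i = y}))"],
      rule bij_betw_byWitness[where f' = "\<lambda>(S, z). \<lambda>i. if i \<in> S then y else z i"])
    let ?f = "\<lambda>z. ({i \<in> I. z i = y}, restrict z (I - {i \<in> I. z i = y}))"
    let ?g = "\<lambda>(S, z). \<lambda>i. if i \<in> S then y else z i"
    show "\<forall>z\<in>seqs_of_type I (insert y Y) K. ?g (?f z) = z"
    proof
      fix z assume "z \<in> seqs_of_type I (insert y Y) K"
      hence z: "z \<in> I \<rightarrow>\<^sub>E insert y Y" by (simp add: seqs_of_type_def)
      show "?g (?f z) = z" using PiE_arb[OF z] by (intro ext) (simp add: restrict_def)
    qed
    have z: "\<And>i. i \<in> I \<Longrightarrow> i \<notin> S \<Longrightarrow> z i \<in> Y" "\<And>i. i \<notin> I \<Longrightarrow> z i = undefined" "S \<subseteq> I" "card S = K y"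
        "\<And>i. i \<in> S \<Longrightarrow> z i = undefined" "\<And>y. y \<in> Y \<Longrightarrow> card {i \<in> I - S. z i = y} = K y"
      if "(S, z) \<in> ?Sig" for S z
    proof -
      have S: "S \<subseteq> I" "card S = K y" and zt: "z \<in> seqs_of_type (I - S) Y K" using that by blast+
      have zP: "z \<in> I - S \<rightarrow>\<^sub>E Y" using zt by (simp add: seqs_of_type_def)
      show "S \<subseteq> I" "card S = K y" by (fact S)+
      show "z i \<in> Y" if "i \<in> I" "i \<notin> S" for i using PiE_mem[OF zP] that by blast
      show "z i = undefined" if "i \<notin> I" for i using PiE_arb[OF zP] that by blast
      show "z i = undefined" if "i \<in> S" for i using PiE_arb[OF zP] that by blast
      show "card {i \<in> I - S. z i = y} = K y" if "y \<in> Y" for y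
        using zt that unfolding seqs_of_type_def by blast
    qed
    have fib: "{i \<in> I. ?g (S, z) i = y} = S" if "(S, z) \<in> ?Sig" for S z
      using z(1,3)[OF that] insert.hyps by auto
    show "\<forall>p\<in>?Sig. ?f (?g p) = p"
    proof
      fix p assume p: "p \<in> ?Sig"
      obtain S z where Sz: "p = (S, z)" by force
      have *: "(S, z) \<in> ?Sig" using p unfolding Sz .
      have "restrict (?g (S, z)) (I - S) = z"
        using z[OF *] by (intro ext) (auto simp: restrict_def)
      thus "?f (?g p) = p" unfolding Sz fib[OF *] by simp
    qed
    show "?f ` seqs_of_type I (insert y Y) K \<subseteq> ?Sig"
    proof (rule image_subsetI)
      fix z assume zt: "z \<in> seqs_of_type I (insert y Y) K"
      let ?S = "{i \<in> I. z i = y}"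
      have "{i \<in> I - ?S. restrict z (I - ?S) i = y'} = {i \<in> I. z i = y'}" if "y' \<in> Y" for y'
        using that insert.hyps by auto
      moreover have "restrict z (I - ?S) \<in> (I - ?S) \<rightarrow>\<^sub>E Y" using zt by (auto simp: seqs_of_type_def)
      ultimately have "restrict z (I - ?S) \<in> seqs_of_type (I - ?S) Y K"
        using zt by (simp add: seqs_of_type_def)
      moreover have "?S \<in> ?Sub" using zt by (auto simp: seqs_of_type_def)
      ultimately show "?f z \<in> ?Sig" by blast
    qed
    show "?g ` ?Sig \<subseteq> seqs_of_type I (insert y Y) K"
    proof (rule image_subsetI)
      fix p assume p: "p \<in> ?Sig"
      obtain S z where Sz: "p = (S, z)" by force
      have *: "(S, z) \<in> ?Sig" using p unfolding Sz .
      have "{i \<in> I. ?g (S, z) i = y'} = {i \<in> I - S. z i = y'}" if "y' \<in> Y" for y'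
        using that insert.hyps by auto
      moreover have "?g (S, z) \<in> I \<rightarrow>\<^sub>E insert y Y"
        using z(1,2,3)[OF *] by (auto simp: PiE_def extensional_def)
      ultimately show "?g p \<in> seqs_of_type I (insert y Y) K"
        using z(4,6)[OF *] fib[OF *] unfolding Sz seqs_of_type_def by simp
    qed
  qed
  also have "\<dots> = (\<Sum>S\<in>?Sub. card (seqs_of_type (I - S) Y K))"
    using insert.hyps insert.prems by (intro card_SigmaI) (auto intro: finite_subset)
  finally have "card (seqs_of_type I (insert y Y) K) * (\<Prod>y\<in>insert y Y. fact (K y))
      = (\<Sum>S\<in>?Sub. card (seqs_of_type (I - S) Y K) * (\<Prod>y\<in>Y. fact (K y))) * fact (K y)"
    using insert.hyps by (simp add: sum_distrib_left mult_ac)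
  also have "(\<Sum>S\<in>?Sub. card (seqs_of_type (I - S) Y K) * (\<Prod>y\<in>Y. fact (K y))) = (\<Sum>S\<in>?Sub. fact (card I - K y))"
  proof (rule sum.cong[OF refl])
    fix S assume S: "S \<in> ?Sub"
    hence c: "card (I - S) = card I - K y"
      using insert.prems finite_subset[of S I] by (simp add: card_Diff_subset)
    show "card (seqs_of_type (I - S) Y K) * (\<Prod>y\<in>Y. fact (K y)) = fact (card I - K y)"
      using insert.IH[of "I - S"] insert.prems insert.hyps c by simp
  qed
  also have "\<dots> = (card I choose K y) * fact (card I - K y)"
    using insert.prems by (simp add: n_subsets)
  also have "\<dots> * fact (K y) = fact (card I)"
    using binomial_fact_lemma[OF le] by (simp add: mult_ac)
  finally show ?case .
qed

text \<open>Averages \<open>potts_cover_le\<close> over all covers, counting only colourings of the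
  given types. For fixed colours at both ends a uniform permutation realises \<open>Ke e\<close>
  with probability \<open>M e / (T (a e) * T (b e))\<close>, independently over the edges.\<close>

lemma potts_cover_average:
  fixes w :: "'e \<Rightarrow> real" and Kv :: "'v \<Rightarrow> nat \<Rightarrow> nat" and Ke :: "'e \<Rightarrow> nat \<times> nat \<Rightarrow> nat" and I :: "'i set"
  assumes fin: "finite V" "finite E" "finite I" and q: "q \<ge> 1" and w: "\<And>e. e \<in> E \<Longrightarrow> w e > 0"
    and ends: "\<And>e. e \<in> E \<Longrightarrow> a e \<in> V \<and> b e \<in> V"
    and margins: "\<And>e s. e \<in> E \<Longrightarrow> s \<in> {1..q} \<Longrightarrow> (\<Sum>s'\<in>{1..q}. Ke e (s, s')) = Kv (a e) s"
      "\<And>e s'. e \<in> E \<Longrightarrow> s' \<in> {1..q} \<Longrightarrow> (\<Sum>s\<in>{1..q}. Ke e (s, s')) = Kv (b e) s'"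
    and T: "\<And>v. T v = real (card (seqs_of_type I {1..q} (Kv v)))"
    and M: "\<And>e. M e = real (card (seqs_of_type I ({1..q} \<times> {1..q}) (Ke e)))"
    and Tpos: "\<And>v. v \<in> V \<Longrightarrow> T v > 0"
  shows "(\<Prod>v\<in>V. T v) * (\<Prod>e\<in>E. M e / (T (a e) * T (b e)) * (1 + w e) ^ (\<Sum>s\<in>{1..q}. Ke e (s, s)))
    \<le> potts_sum V E a b q w ^ card I"
proof -
  let ?X = "{1..q}" and ?S = "{\<pi>. \<pi> permutes I}"
  let ?N = "fact (card I) :: real"
  let ?Ts = "\<lambda>v. seqs_of_type I {1..q} (Kv v)"
  let ?D = "\<lambda>e. \<Sum>s\<in>?X. Ke e (s, s)"
  let ?h = "\<lambda>e x y \<pi>. \<Prod>i\<in>I. 1 + w e * of_bool (x i = (y (\<pi> i) :: nat))"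
  have finS: "finite ?S" using fin by (intro finite_permutations)
  have cS: "card ?S = fact (card I)" using card_permutations[OF refl fin(3)] .
  have h_nonneg: "?h e x y \<pi> \<ge> 0" if "e \<in> E" for e x y \<pi>
    using w[OF that] by (intro prod_nonneg) auto
  have edge: "?N * (M e / (T (a e) * T (b e)) * (1 + w e) ^ ?D e) \<le> (\<Sum>\<pi>\<in>?S. ?h e x y \<pi>)"
    if e: "e \<in> E" and xy: "x \<in> ?Ts (a e)" "y \<in> ?Ts (b e)" for e x y
  proof -
    let ?Mt = "matchings I ?X (Ke e) x y"
    have "T (a e) * T (b e) * card ?Mt = ?N * M e"
      using card_matchings[of I ?X "Ke e" "Kv (a e)" "Kv (b e)" x y] e xy margins fin
      unfolding T M by (metis (no_types, lifting) finite_atLeastAtMost of_nat_fact of_nat_mult)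
    hence c: "real (card ?Mt) = ?N * M e / (T (a e) * T (b e))"
      using Tpos[of "a e"] Tpos[of "b e"] ends[OF e] by (simp add: field_simps)
    have val: "?h e x y \<pi> = (1 + w e) ^ ?D e" if \<pi>: "\<pi> \<in> ?Mt" for \<pi>
    proof -
      have xX: "x i \<in> ?X" if "i \<in> I" for i using xy(1) that by (auto simp: seqs_of_type_def)
      have "?h e x y \<pi> = (\<Prod>i\<in>I. if x i = y (\<pi> i) then 1 + w e else 1)" by (intro prod.cong) auto
      also have "\<dots> = (1 + w e) ^ card {i \<in> I. x i = y (\<pi> i)}"
        using fin by (simp add: prod.If_cases Int_def)
      also have "{i \<in> I. x i = y (\<pi> i)} = (\<Union>s\<in>?X. {i \<in> I. x i = s \<and> y (\<pi> i) = s})"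
        using xX by fastforce
      also have "card \<dots> = (\<Sum>s\<in>?X. card {i \<in> I. x i = s \<and> y (\<pi> i) = s})"
        using fin by (intro card_UN_disjoint) auto
      also have "\<dots> = ?D e" using \<pi> by (intro sum.cong) (auto simp: matchings_def)
      finally show ?thesis .
    qed
    have "?N * (M e / (T (a e) * T (b e)) * (1 + w e) ^ ?D e) = (\<Sum>\<pi>\<in>?Mt. ?h e x y \<pi>)"
      using val c by simp
    \<comment> \<open>Permutations with other pair frequencies are added; their terms are
      nonnegative.\<close>
    also have "\<dots> \<le> (\<Sum>\<pi>\<in>?S. ?h e x y \<pi>)"
      using finS h_nonneg[OF e] by (intro sum_mono2) (auto simp: matchings_def)
    finally show ?thesis .
  qed
  let ?P = "\<Pi>\<^sub>E e\<in>E. ?S" and ?Q = "\<Pi>\<^sub>E v\<in>V. ?Ts v"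
  let ?C = "\<Prod>e\<in>E. M e / (T (a e) * T (b e)) * (1 + w e) ^ ?D e"
  have finQ: "finite ?Q" using fin by (intro finite_PiE) auto
  have nonneg: "?N * (M e / (T (a e) * T (b e)) * (1 + w e) ^ ?D e) \<ge> 0" if "e \<in> E" for e
    using w[OF that] by (auto simp: T M)
  \<comment> \<open>\<open>?N ^ card E\<close> is the number of covers. Keeping it as a factor on
    both sides, to be cancelled at the end, turns the average into a plain sum.\<close>
  have "?N ^ card E * ((\<Prod>v\<in>V. T v) * ?C) = (\<Sum>x\<in>?Q. \<Prod>e\<in>E. ?N * (M e / (T (a e) * T (b e)) * (1 + w e) ^ ?D e))"
  proof -
    have "real (card ?Q) = (\<Prod>v\<in>V. T v)" using fin by (simp add: card_PiE T)
    moreover have "(\<Prod>e\<in>E. ?N * (M e / (T (a e) * T (b e)) * (1 + w e) ^ ?D e)) = ?N ^ card E * ?C"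
      by (simp only: prod.distrib prod_constant)
    ultimately show ?thesis by (simp only: sum_constant mult.left_commute)
  qed
  also have "\<dots> \<le> (\<Sum>x\<in>?Q. \<Prod>e\<in>E. \<Sum>\<pi>\<in>?S. ?h e (x (a e)) (x (b e)) \<pi>)"
    using ends by (intro sum_mono prod_mono conjI edge nonneg) auto
  also have "\<dots> = (\<Sum>x\<in>?Q. \<Sum>\<pi>\<in>?P. \<Prod>e\<in>E. ?h e (x (a e)) (x (b e)) (\<pi> e))"
    using fin finS by (intro sum.cong refl prod_sum_PiE) auto
  also have "\<dots> = (\<Sum>\<pi>\<in>?P. \<Sum>x\<in>?Q. \<Prod>e\<in>E. ?h e (x (a e)) (x (b e)) (\<pi> e))" by (rule sum.swap)
  also have "\<dots> \<le> (\<Sum>\<pi>\<in>?P. potts_sum V E a b q w ^ card I)"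
  proof (rule sum_mono)
    fix \<pi> assume \<pi>: "\<pi> \<in> ?P"
    hence perm: "\<pi> e permutes I" if "e \<in> E" for e using that by auto
    let ?W = "\<lambda>\<sigma>. \<Prod>e\<in>E. \<Prod>i\<in>I. 1 + w e * of_bool (\<sigma> (a e, i) = (\<sigma> (b e, \<pi> e i) :: nat))"
    let ?j = "\<lambda>x. restrict (\<lambda>(v, i). x v i) (V \<times> I)"
    have inj: "inj_on ?j ?Q"
    proof (rule inj_onI)
      fix x x' assume xx: "x \<in> ?Q" "x' \<in> ?Q" "?j x = ?j x'"
      show "x = x'"
      proof (rule PiE_ext[OF xx(1,2)])
        fix v assume v: "v \<in> V"
        have "x v \<in> I \<rightarrow>\<^sub>E ?X" "x' v \<in> I \<rightarrow>\<^sub>E ?X" using xx v by (auto simp: seqs_of_type_def PiE_iff)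
        thus "x v = x' v"
        proof (rule PiE_ext)
          fix i assume "i \<in> I"
          thus "x v i = x' v i" using fun_cong[OF xx(3), of "(v, i)"] v by simp
        qed
      qed
    qed
    have "(\<Sum>x\<in>?Q. \<Prod>e\<in>E. ?h e (x (a e)) (x (b e)) (\<pi> e)) = (\<Sum>x\<in>?Q. ?W (?j x))"
      using ends permutes_in_image[OF perm] by (intro sum.cong refl prod.cong) auto
    also have "\<dots> = (\<Sum>\<sigma>\<in>?j ` ?Q. ?W \<sigma>)" using inj by (simp add: sum.reindex)
    \<comment> \<open>Families of typed sequences are particular colourings of the cover; all the
      others contribute nonnegative terms.\<close>
    also have "\<dots> \<le> (\<Sum>\<sigma>\<in>V \<times> I \<rightarrow>\<^sub>E {1..q}. ?W \<sigma>)"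
    proof (rule sum_mono2)
      show "finite (V \<times> I \<rightarrow>\<^sub>E {1..q})" using fin by (intro finite_PiE) auto
      show "?j ` ?Q \<subseteq> V \<times> I \<rightarrow>\<^sub>E {1..q}"
      proof (rule image_subsetI)
        fix x assume x: "x \<in> ?Q"
        have "x v i \<in> {1..q}" if "v \<in> V" "i \<in> I" for v i
        proof -
          have "x v \<in> I \<rightarrow>\<^sub>E ?X" using x that(1) by (auto simp: seqs_of_type_def PiE_iff)
          thus ?thesis using that(2) by auto
        qed
        thus "?j x \<in> V \<times> I \<rightarrow>\<^sub>E {1..q}" by (auto simp del: atLeastAtMost_iff)
      qed
      show "?W \<sigma> \<ge> 0" for \<sigma> using w by (intro prod_nonneg) (auto simp: less_imp_le)
    qed
    also have "\<dots> \<le> potts_sum V E a b q w ^ card I"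
      by (rule potts_cover_le[OF fin q w ends perm])
    finally show "(\<Sum>x\<in>?Q. \<Prod>e\<in>E. ?h e (x (a e)) (x (b e)) (\<pi> e)) \<le> potts_sum V E a b q w ^ card I" .
  qed
  also have "\<dots> = ?N ^ card E * potts_sum V E a b q w ^ card I"
    using fin cS by (simp add: card_PiE)
  finally show ?thesis by (simp add: mult_le_cancel_left_pos)
qed

section \<open>Large covers\<close>

lemma ln_Suc_diff_bounds:
  assumes "n \<ge> 1"
  shows "real n * (ln (real n + 1) - ln (real n)) \<le> 1"
    and "1 \<le> (real n + 1) * (ln (real n + 1) - ln (real n))"
proof -
  have n: "real n > 0" using assms by simp
  have "ln (real n + 1) - ln (real n) = ln ((real n + 1) / real n)"
    using n by (simp add: ln_div)
  also have "\<dots> \<le> (real n + 1) / real n - 1" using n by (intro ln_le_minus_one) auto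
  finally show "real n * (ln (real n + 1) - ln (real n)) \<le> 1" using n by (simp add: field_simps)
  have "ln (real n) - ln (real n + 1) = ln (real n / (real n + 1))"
    using n by (simp add: ln_div)
  also have "\<dots> \<le> real n / (real n + 1) - 1" using n by (intro ln_le_minus_one) auto
  also have "\<dots> = - 1 / (real n + 1)" using n by (simp add: field_simps)
  finally show "1 \<le> (real n + 1) * (ln (real n + 1) - ln (real n))" using n by (simp add: field_simps)
qed

text \<open>A crude Stirling formula suffices, because a gap of logarithmic order vanishes after
  division by the number of sheets. As \<open>ln 0 = 0\<close>, vanishing counts are covered
  too.\<close>

lemma ln_fact_bounds:
  "real n * ln (real n) - real n \<le> ln (fact n)"
  "ln (fact n) \<le> real n * ln (real n) - real n + ln (real n) + 1"
proof (induction n)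
  case (Suc n)
  have f: "ln (fact (Suc n) :: real) = ln (real n + 1) + ln (fact n)"
    by (simp only: fact_Suc of_nat_mult) (subst ln_mult, auto simp: add.commute)
  have r: "real (Suc n) = real n + 1" by simp
  { case 1
    show ?case using ln_Suc_diff_bounds(1)[of n] Suc unfolding f r
      by (cases "n = 0") (auto simp: algebra_simps)
  next
    case 2
    show ?case using ln_Suc_diff_bounds(2)[of n] Suc unfolding f r
      by (cases "n = 0") (auto simp: algebra_simps) }
qed auto

text \<open>Pseudomarginals may have zero entries. There \<open>ln\<close> is not continuous, but
  \<open>y * ln y\<close> tends to 0 from the right, in agreement with its value at 0.\<close>

lemma tendsto_mult_ln:
  fixes f :: "'a \<Rightarrow> real"
  assumes "(f \<longlongrightarrow> p) F" "\<forall>\<^sub>F x in F. f x \<ge> 0" "p \<ge> 0"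
  shows "((\<lambda>x. f x * ln (f x)) \<longlongrightarrow> p * ln p) F"
proof (cases "p = 0")
  case False
  with assms show ?thesis by (intro tendsto_intros) auto
next
  case True
  have "((\<lambda>y :: real. y * ln y) \<longlongrightarrow> 0) (at 0 within {0..})"
  proof -
    have "((\<lambda>y :: real. y * ln y) \<longlongrightarrow> 0) (at_right 0)" by real_asymp
    thus ?thesis by (simp add: at_within_Ici_at_right)
  qed
  hence "continuous (at 0 within {0..}) (\<lambda>y :: real. y * ln y)"
    by (simp add: continuous_within)
  from continuous_within_tendsto_compose[OF this, of f F] assms True
  have "((\<lambda>x. f x * ln (f x)) \<longlongrightarrow> 0 * ln 0) F"
    by auto
  thus ?thesis using True by simp
qed

text \<open>The subtracted term is the divergent part of Stirling's formula. It is linear in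
  \<open>k n\<close>, so it cancels in a multinomial coefficient whose counts add up to
  \<open>N n\<close>.\<close>

lemma ln_fact_limit:
  fixes k N :: "nat \<Rightarrow> nat"
  assumes N: "filterlim N at_top sequentially" and pos: "\<And>n. N n \<ge> 1" and le: "\<And>n. k n \<le> N n"
    and lim: "(\<lambda>n. real (k n) / real (N n)) \<longlonglongrightarrow> p" and p: "p \<ge> 0"
  shows "(\<lambda>n. (ln (fact (k n)) - real (k n) * (ln (real (N n)) - 1)) / real (N n)) \<longlonglongrightarrow> p * ln p"
proof -
  let ?err = "\<lambda>n. (ln (fact (k n)) - (real (k n) * ln (real (k n)) - real (k n))) / real (N n)"
  have "(\<lambda>n. (ln (real (N n)) + 1) / real (N n)) \<longlonglongrightarrow> 0"
  proof (rule filterlim_compose[of "\<lambda>x. (ln (real x) + 1) / real x", OF _ N])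
    show "((\<lambda>x. (ln (real x) + 1) / real x) \<longlongrightarrow> 0) at_top" by real_asymp
  qed
  hence err: "?err \<longlonglongrightarrow> 0"
  proof (rule tendsto_sandwich[OF _ _ tendsto_const, rotated 2])
    have "?err n \<ge> 0" for n using ln_fact_bounds(1)[of "k n"] by simp
    thus "\<forall>\<^sub>F n in sequentially. 0 \<le> ?err n" by simp
    have "?err n \<le> (ln (real (N n)) + 1) / real (N n)" for n
    proof (rule divide_right_mono)
      have "ln (real (k n)) \<le> ln (real (N n))"
        using le[of n] pos[of n] by (cases "k n = 0") auto
      thus "ln (fact (k n)) - (real (k n) * ln (real (k n)) - real (k n)) \<le> ln (real (N n)) + 1"
        using ln_fact_bounds(2)[of "k n"] by simp
    qed simp
    thus "\<forall>\<^sub>F n in sequentially. ?err n \<le> (ln (real (N n)) + 1) / real (N n)" by simp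
  qed
  have "(\<lambda>n. ?err n + (real (k n) / real (N n)) * ln (real (k n) / real (N n))) \<longlonglongrightarrow> 0 + p * ln p"
    using lim p by (intro tendsto_add err tendsto_mult_ln) auto
  also have "(\<lambda>n. ?err n + (real (k n) / real (N n)) * ln (real (k n) / real (N n)))
      = (\<lambda>n. (ln (fact (k n)) - real (k n) * (ln (real (N n)) - 1)) / real (N n))"
  proof
    fix n
    have "real (k n) * ln (real (k n) / real (N n)) = real (k n) * ln (real (k n)) - real (k n) * ln (real (N n))"
      using pos[of n] by (cases "k n = 0") (auto simp: ln_div algebra_simps)
    moreover have "real (N n) > 0" using pos[of n] by simp
    ultimately show "?err n + (real (k n) / real (N n)) * ln (real (k n) / real (N n))
      = (ln (fact (k n)) - real (k n) * (ln (real (N n)) - 1)) / real (N n)"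
      by (simp add: field_simps)
  qed
  finally show ?thesis by simp
qed

lemma ln_card_seqs_of_type:
  assumes "finite Y" "finite I" "(\<Sum>y\<in>Y. K y) = card I"
  shows "card (seqs_of_type I Y K) > 0"
    and "ln (real (card (seqs_of_type I Y K))) = ln (fact (card I)) - (\<Sum>y\<in>Y. ln (fact (K y)))"
proof -
  have *: "card (seqs_of_type I Y K) * (\<Prod>y\<in>Y. fact (K y)) = fact (card I)"
    by (rule card_seqs_of_type[OF assms])
  show pos: "card (seqs_of_type I Y K) > 0" using * by (metis fact_nonzero gr0I mult_0)
  have "ln (real (card (seqs_of_type I Y K) * (\<Prod>y\<in>Y. fact (K y)))) = ln (fact (card I))"
    unfolding * by simp
  moreover have "ln (\<Prod>y\<in>Y. fact (K y) :: real) = (\<Sum>y\<in>Y. ln (fact (K y)))"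
    using assms(1) by (intro ln_prod) auto
  moreover have "(\<Prod>y\<in>Y. fact (K y) :: real) > 0" by (intro prod_pos) auto
  ultimately show "ln (real (card (seqs_of_type I Y K))) = ln (fact (card I)) - (\<Sum>y\<in>Y. ln (fact (K y)))"
    using pos by (simp add: ln_mult)
qed

lemma entropy_limit:
  fixes N :: "nat \<Rightarrow> nat" and K :: "nat \<Rightarrow> 'y \<Rightarrow> nat"
  assumes Y: "finite Y" and N: "filterlim N at_top sequentially" and pos: "\<And>n. N n \<ge> 1"
    and sum: "\<And>n. (\<Sum>y\<in>Y. K n y) = N n"
    and lim: "\<And>y. y \<in> Y \<Longrightarrow> (\<lambda>n. real (K n y) / real (N n)) \<longlonglongrightarrow> p y" and p: "\<And>y. y \<in> Y \<Longrightarrow> p y \<ge> 0"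
  shows "(\<lambda>n. ln (real (card (seqs_of_type {..<N n} Y (K n)))) / real (N n)) \<longlonglongrightarrow> - (\<Sum>y\<in>Y. p y * ln (p y))"
proof -
  let ?g = "\<lambda>n k. (ln (fact k) - real k * (ln (real (N n)) - 1)) / real (N n)"
  have K: "K n y \<le> N n" if "y \<in> Y" for n y
    using member_le_sum[OF that, of "K n"] Y sum[of n] by simp
  \<comment> \<open>The numerator of the multinomial coefficient obeys the same limit with
    \<open>p = 1\<close>, and contributes \<open>1 * ln 1 = 0\<close>.\<close>
  have "(\<lambda>n. real (N n) / real (N n)) \<longlonglongrightarrow> 1"
    using pos by (auto intro!: tendsto_eventually eventuallyI simp: Suc_le_eq)
  hence "(\<lambda>n. ?g n (N n) - (\<Sum>y\<in>Y. ?g n (K n y))) \<longlonglongrightarrow> 1 * ln 1 - (\<Sum>y\<in>Y. p y * ln (p y))"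
    by (intro tendsto_diff tendsto_sum ln_fact_limit N pos K lim p) auto
  also have "(\<lambda>n. ?g n (N n) - (\<Sum>y\<in>Y. ?g n (K n y)))
      = (\<lambda>n. ln (real (card (seqs_of_type {..<N n} Y (K n)))) / real (N n))"
  proof
    fix n
    have "(\<Sum>y\<in>Y. ?g n (K n y)) = ((\<Sum>y\<in>Y. ln (fact (K n y))) - real (\<Sum>y\<in>Y. K n y) * (ln (real (N n)) - 1)) / real (N n)"
      by (simp add: sum_divide_distrib[symmetric] sum_subtractf sum_distrib_right)
    thus "?g n (N n) - (\<Sum>y\<in>Y. ?g n (K n y)) = ln (real (card (seqs_of_type {..<N n} Y (K n)))) / real (N n)"
      using ln_card_seqs_of_type(2)[OF Y, of "{..<N n}" "K n"] sum[of n]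
      by (simp add: diff_divide_distrib)
  qed
  finally show ?thesis by simp
qed

text \<open>Integral counts with the exact margins of a pseudomarginal scaled by \<open>n\<close>: the colour \<open>z\<close> absorbs
  all rounding errors, and the slack \<open>c\<close> in the total \<open>n + c\<close> keeps its counts nonnegative.\<close>

definition round_vertex :: "'x set \<Rightarrow> 'x \<Rightarrow> nat \<Rightarrow> ('x \<Rightarrow> real) \<Rightarrow> nat \<Rightarrow> 'x \<Rightarrow> int" where
  "round_vertex X z c t n s =
    (if s = z then int (n + c) - (\<Sum>r\<in>X - {z}. \<lceil>real n * t r\<rceil>) else \<lceil>real n * t s\<rceil>)"

text \<open>Entries outside row and column \<open>z\<close> are free, and the margins force the
  others, the corner by inclusion-exclusion. Vertex counts are rounded up and edge counts down,
  which keeps the forced entries off the corner nonnegative; the corner relies on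
  \<open>c\<close>.\<close>

definition round_edge ::
  "'x set \<Rightarrow> 'x \<Rightarrow> nat \<Rightarrow> ('x \<Rightarrow> real) \<Rightarrow> ('x \<Rightarrow> real) \<Rightarrow> ('x \<times> 'x \<Rightarrow> real) \<Rightarrow> nat \<Rightarrow> 'x \<times> 'x \<Rightarrow> int" where
  "round_edge X z c t t' \<tau> n = (\<lambda>(s, s').
    if s \<noteq> z then
      if s' \<noteq> z then \<lfloor>real n * \<tau> (s, s')\<rfloor>
      else round_vertex X z c t n s - (\<Sum>r\<in>X - {z}. \<lfloor>real n * \<tau> (s, r)\<rfloor>)
    else
      if s' \<noteq> z then round_vertex X z c t' n s' - (\<Sum>r\<in>X - {z}. \<lfloor>real n * \<tau> (r, s')\<rfloor>)
      else int (n + c) - (\<Sum>r\<in>X - {z}. round_vertex X z c t n r) - (\<Sum>r\<in>X - {z}. round_vertex X z c t' n r)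
        + (\<Sum>r\<in>X - {z}. \<Sum>r'\<in>X - {z}. \<lfloor>real n * \<tau> (r, r')\<rfloor>))"

lemma sum_Diff_point:
  fixes f :: "'x \<Rightarrow> 'b::ab_group_add"
  assumes "finite X" "z \<in> X"
  shows "(\<Sum>r\<in>X - {z}. f r) = (\<Sum>r\<in>X. f r) - f z"
  using sum.remove[OF assms, of f] by simp

lemma round_vertex_sum:
  assumes "finite X" "z \<in> X"
  shows "(\<Sum>s\<in>X. round_vertex X z c t n s) = int (n + c)"
proof -
  have "(\<Sum>s\<in>X - {z}. round_vertex X z c t n s) = (\<Sum>r\<in>X - {z}. \<lceil>real n * t r\<rceil>)"
    by (intro sum.cong) (auto simp: round_vertex_def)
  thus ?thesis using sum.remove[OF assms, of "round_vertex X z c t n"] by (simp add: round_vertex_def)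
qed

text \<open>Away from \<open>z\<close> this is rounding up. At \<open>z\<close> the ceilings
  overshoot by at most \<open>card X - 1\<close> in total, which the slack \<open>c\<close>
  absorbs.\<close>

lemma round_vertex_ge:
  assumes "finite X" "z \<in> X" "s \<in> X" "c \<ge> card X" "(\<Sum>s\<in>X. t s) = 1"
  shows "real n * t s \<le> real_of_int (round_vertex X z c t n s)"
proof (cases "s = z")
  case True
  have "(\<Sum>r\<in>X - {z}. real_of_int \<lceil>real n * t r\<rceil>) \<le> (\<Sum>r\<in>X - {z}. real n * t r + 1)"
    by (intro sum_mono) linarith
  also have "\<dots> = real n * (1 - t z) + (real (card X) - 1)"
    using assms card_gt_0_iff[of X]
    by (auto simp: sum.distrib sum_distrib_left[symmetric] sum_Diff_point of_nat_diff Suc_le_eq)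
  finally show ?thesis using True assms by (simp add: round_vertex_def algebra_simps)
qed (simp add: round_vertex_def)

lemma round_edge_margins:
  assumes "finite X" "z \<in> X"
  shows "s \<in> X \<Longrightarrow> (\<Sum>s'\<in>X. round_edge X z c t t' \<tau> n (s, s')) = round_vertex X z c t n s"
    and "s' \<in> X \<Longrightarrow> (\<Sum>s\<in>X. round_edge X z c t t' \<tau> n (s, s')) = round_vertex X z c t' n s'"
proof -
  let ?k = "round_edge X z c t t' \<tau> n" and ?v = "round_vertex X z c t n" and ?v' = "round_vertex X z c t' n"
  have v: "(\<Sum>r\<in>X - {z}. ?v r) = int (n + c) - ?v z" "(\<Sum>r\<in>X - {z}. ?v' r) = int (n + c) - ?v' z"
    using assms by (simp_all add: sum_Diff_point round_vertex_sum)
  {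
    assume "s \<in> X"
    have "(\<Sum>s'\<in>X. ?k (s, s')) = ?k (s, z) + (\<Sum>s'\<in>X - {z}. ?k (s, s'))" by (rule sum.remove[OF assms])
    also have "\<dots> = ?v s"
    proof (cases "s = z")
      case True
      have "(\<Sum>s'\<in>X - {z}. ?k (s, s')) = (\<Sum>s'\<in>X - {z}. ?v' s' - (\<Sum>r\<in>X - {z}. \<lfloor>real n * \<tau> (r, s')\<rfloor>))"
        using True by (intro sum.cong) (auto simp: round_edge_def)
      moreover have "(\<Sum>s'\<in>X - {z}. \<Sum>r\<in>X - {z}. \<lfloor>real n * \<tau> (r, s')\<rfloor>) = (\<Sum>r\<in>X - {z}. \<Sum>s'\<in>X - {z}. \<lfloor>real n * \<tau> (r, s')\<rfloor>)"
        by (rule sum.swap)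
      ultimately show ?thesis using True by (simp add: round_edge_def sum_subtractf v)
    next
      case False
      have "(\<Sum>s'\<in>X - {z}. ?k (s, s')) = (\<Sum>s'\<in>X - {z}. \<lfloor>real n * \<tau> (s, s')\<rfloor>)"
        using False by (intro sum.cong) (auto simp: round_edge_def)
      thus ?thesis using False by (simp add: round_edge_def)
    qed
    finally show "(\<Sum>s'\<in>X. ?k (s, s')) = ?v s" .
  next
    assume "s' \<in> X"
    have "(\<Sum>s\<in>X. ?k (s, s')) = ?k (z, s') + (\<Sum>s\<in>X - {z}. ?k (s, s'))" by (rule sum.remove[OF assms])
    also have "\<dots> = ?v' s'"
    proof (cases "s' = z")
      case True
      have "(\<Sum>s\<in>X - {z}. ?k (s, s')) = (\<Sum>s\<in>X - {z}. ?v s - (\<Sum>r\<in>X - {z}. \<lfloor>real n * \<tau> (s, r)\<rfloor>))"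
        using True by (intro sum.cong) (auto simp: round_edge_def)
      thus ?thesis using True by (simp add: round_edge_def sum_subtractf v)
    next
      case False
      have "(\<Sum>s\<in>X - {z}. ?k (s, s')) = (\<Sum>s\<in>X - {z}. \<lfloor>real n * \<tau> (s, s')\<rfloor>)"
        using False by (intro sum.cong) (auto simp: round_edge_def)
      thus ?thesis using False by (simp add: round_edge_def)
    qed
    finally show "(\<Sum>s\<in>X. ?k (s, s')) = ?v' s'" .
  }
qed

lemma round_edge_nonneg:
  assumes X: "finite X" "z \<in> X" and ss': "s \<in> X" "s' \<in> X" and c: "c = (card X + 1)^2"
    and t: "(\<Sum>s\<in>X. t s) = 1" "(\<Sum>s\<in>X. t' s) = 1"
    and nonneg: "\<And>p. p \<in> X \<times> X \<Longrightarrow> \<tau> p \<ge> 0"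
    and row: "\<And>s. s \<in> X \<Longrightarrow> (\<Sum>s'\<in>X. \<tau> (s, s')) = t s"
    and col: "\<And>s'. s' \<in> X \<Longrightarrow> (\<Sum>s\<in>X. \<tau> (s, s')) = t' s'"
  shows "round_edge X z c t t' \<tau> n (s, s') \<ge> 0"
proof -
  let ?v = "round_vertex X z c t n" and ?v' = "round_vertex X z c t' n"
  have cX: "card X \<le> c" by (simp add: c power2_eq_square)
  have ge: "real n * t s \<le> ?v s" "real n * t' s \<le> ?v' s" if "s \<in> X" for s
    using that X cX t by (auto intro: round_vertex_ge)
  consider "s \<noteq> z" "s' \<noteq> z" | "s \<noteq> z" "s' = z" | "s = z" "s' \<noteq> z" | "s = z" "s' = z" by blast
  thus ?thesis
  proof cases
    case 1
    thus ?thesis using nonneg[of "(s, s')"] ss' by (simp add: round_edge_def)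
  next
    case 2
    have "(\<Sum>r\<in>X - {z}. real_of_int \<lfloor>real n * \<tau> (s, r)\<rfloor>) \<le> (\<Sum>r\<in>X - {z}. real n * \<tau> (s, r))"
      by (intro sum_mono) linarith
    also have "\<dots> = real n * (t s - \<tau> (s, z))"
      using X row[OF ss'(1)] by (simp add: sum_distrib_left[symmetric] sum_Diff_point)
    also have "\<dots> \<le> real n * t s" using nonneg[of "(s, z)"] ss' X by (intro mult_left_mono) auto
    also have "\<dots> \<le> ?v s" by (rule ge[OF ss'(1)])
    finally have "(\<Sum>r\<in>X - {z}. \<lfloor>real n * \<tau> (s, r)\<rfloor>) \<le> ?v s" by (simp flip: of_int_sum)
    thus ?thesis using 2 by (simp add: round_edge_def)
  next
    case 3
    have "(\<Sum>r\<in>X - {z}. real_of_int \<lfloor>real n * \<tau> (r, s')\<rfloor>) \<le> (\<Sum>r\<in>X - {z}. real n * \<tau> (r, s'))"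
      by (intro sum_mono) linarith
    also have "\<dots> = real n * (t' s' - \<tau> (z, s'))"
      using X col[OF ss'(2)] by (simp add: sum_distrib_left[symmetric] sum_Diff_point)
    also have "\<dots> \<le> real n * t' s'" using nonneg[of "(z, s')"] ss' X by (intro mult_left_mono) auto
    also have "\<dots> \<le> ?v' s'" by (rule ge[OF ss'(2)])
    finally have "(\<Sum>r\<in>X - {z}. \<lfloor>real n * \<tau> (r, s')\<rfloor>) \<le> ?v' s'" by (simp flip: of_int_sum)
    thus ?thesis using 3 by (simp add: round_edge_def)
  next
    case 4
    \<comment> \<open>At the corner the two vertex sums lose at most \<open>m\<close> each to
      ceilings and the double sum at most \<open>m * m\<close> to floors. The constant
      \<open>c\<close> equals \<open>(m + 2) * (m + 2)\<close>, more than
      \<open>m * m + 2 * m\<close>.\<close>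
    define m where "m = real (card (X - {z}))"
    have m: "m + 1 = real (card X)" using X card_gt_0_iff[of X] by (auto simp: m_def of_nat_diff Suc_le_eq)
    have v: "(\<Sum>r\<in>X - {z}. real_of_int (round_vertex X z c u n r)) \<le> real n * (1 - u z) + m"
      if "(\<Sum>s\<in>X. u s) = 1" for u
    proof -
      have "(\<Sum>r\<in>X - {z}. real_of_int (round_vertex X z c u n r)) \<le> (\<Sum>r\<in>X - {z}. real n * u r + 1)"
      proof (rule sum_mono)
        fix r assume "r \<in> X - {z}"
        hence "round_vertex X z c u n r = \<lceil>real n * u r\<rceil>" by (simp add: round_vertex_def)
        thus "real_of_int (round_vertex X z c u n r) \<le> real n * u r + 1" by linarith
      qed
      also have "\<dots> = real n * (1 - u z) + m"
        using X that by (simp add: sum.distrib sum_distrib_left[symmetric] sum_Diff_point m_def)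
      finally show ?thesis .
    qed
    have "(\<Sum>r\<in>X - {z}. \<Sum>r'\<in>X - {z}. real n * \<tau> (r, r') - 1)
        = (\<Sum>r\<in>X - {z}. real n * (t r - \<tau> (r, z)) - m)"
      using X row by (intro sum.cong) (auto simp: sum_subtractf sum_distrib_left[symmetric] sum_Diff_point m_def)
    also have "\<dots> = real n * ((1 - t z) - (t' z - \<tau> (z, z))) - m * m"
      using X t col[of z] by (simp add: sum_subtractf sum_distrib_left[symmetric] sum_Diff_point m_def)
    finally have eq: "(\<Sum>r\<in>X - {z}. \<Sum>r'\<in>X - {z}. real n * \<tau> (r, r') - 1)
        = real n * ((1 - t z) - (t' z - \<tau> (z, z))) - m * m" .
    have fl: "real n * ((1 - t z) - (t' z - \<tau> (z, z))) - m * m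
        \<le> (\<Sum>r\<in>X - {z}. \<Sum>r'\<in>X - {z}. real_of_int \<lfloor>real n * \<tau> (r, r')\<rfloor>)"
      unfolding eq[symmetric] by (intro sum_mono) linarith
    have cm: "real c = (m + 2) * (m + 2)"
      unfolding c of_nat_power of_nat_add m[symmetric] by (simp add: power2_eq_square add.commute)
    have "real n * \<tau> (z, z) \<ge> 0" using nonneg[of "(z, z)"] X by simp
    moreover have "m \<ge> 0" by (simp add: m_def)
    ultimately have "0 \<le> real (n + c) - (\<Sum>r\<in>X - {z}. real_of_int (?v r)) - (\<Sum>r\<in>X - {z}. real_of_int (?v' r))
        + (\<Sum>r\<in>X - {z}. \<Sum>r'\<in>X - {z}. real_of_int \<lfloor>real n * \<tau> (r, r')\<rfloor>)"
      using v[OF t(1)] v[OF t(2)] fl cm by (simp add: algebra_simps)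
    also have "\<dots> = real_of_int (round_edge X z c t t' \<tau> n (s, s'))"
      using 4 by (simp add: round_edge_def)
    finally show ?thesis by simp
  qed
qed

lemma tendsto_of_bounded_diff:
  assumes "\<And>n. \<bar>x n - real n * t\<bar> \<le> 1"
  shows "(\<lambda>n. x n / real (n + c)) \<longlonglongrightarrow> t"
proof -
  have 1: "(\<lambda>n. real n / real (n + c)) \<longlonglongrightarrow> 1" by real_asymp
  have "(\<lambda>n. (x n - real n * t) / real (n + c)) \<longlonglongrightarrow> 0"
  proof (rule Lim_null_comparison)
    show "\<forall>\<^sub>F n in sequentially. norm ((x n - real n * t) / real (n + c)) \<le> 1 / real (n + c)"
      using assms by (auto simp: divide_right_mono)
    show "(\<lambda>n. 1 / real (n + c)) \<longlonglongrightarrow> 0" by real_asymp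
  qed
  from tendsto_add[OF this tendsto_mult[OF 1 tendsto_const[of t]]]
  show ?thesis by (simp add: diff_divide_distrib)
qed

lemma tendsto_round_vertex:
  assumes "finite X" "z \<in> X" "s \<in> X" "(\<Sum>s\<in>X. t s) = 1"
  shows "(\<lambda>n. real_of_int (round_vertex X z c t n s) / real (n + c)) \<longlonglongrightarrow> t s"
proof -
  have ceil: "(\<lambda>n. real_of_int \<lceil>real n * t r\<rceil> / real (n + c)) \<longlonglongrightarrow> t r" for r
    by (rule tendsto_of_bounded_diff) linarith
  show ?thesis
  proof (cases "s = z")
    case True
    have "(\<lambda>n. real (n + c) / real (n + c) - (\<Sum>r\<in>X - {z}. real_of_int \<lceil>real n * t r\<rceil> / real (n + c)))
        \<longlonglongrightarrow> 1 - (\<Sum>r\<in>X - {z}. t r)"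
      by (intro tendsto_diff tendsto_sum ceil) real_asymp
    thus ?thesis using True assms
      by (simp add: round_vertex_def sum_Diff_point diff_divide_distrib sum_divide_distrib)
  qed (use ceil in \<open>simp add: round_vertex_def\<close>)
qed

lemma tendsto_round_edge:
  assumes X: "finite X" "z \<in> X" and ss': "s \<in> X" "s' \<in> X"
    and t: "(\<Sum>s\<in>X. t s) = 1" "(\<Sum>s\<in>X. t' s) = 1"
    and row: "\<And>s. s \<in> X \<Longrightarrow> (\<Sum>s'\<in>X. \<tau> (s, s')) = t s"
    and col: "\<And>s'. s' \<in> X \<Longrightarrow> (\<Sum>s\<in>X. \<tau> (s, s')) = t' s'"
  shows "(\<lambda>n. real_of_int (round_edge X z c t t' \<tau> n (s, s')) / real (n + c)) \<longlonglongrightarrow> \<tau> (s, s')"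
proof -
  let ?N = "\<lambda>n. real (n + c)"
  have fl: "(\<lambda>n. real_of_int \<lfloor>real n * \<tau> p\<rfloor> / ?N n) \<longlonglongrightarrow> \<tau> p" for p
    by (rule tendsto_of_bounded_diff) linarith
  have one: "(\<lambda>n. ?N n / ?N n) \<longlonglongrightarrow> 1" by real_asymp
  have v: "(\<lambda>n. real_of_int (round_vertex X z c t n r) / ?N n) \<longlonglongrightarrow> t r"
    "(\<lambda>n. real_of_int (round_vertex X z c t' n r) / ?N n) \<longlonglongrightarrow> t' r" if "r \<in> X" for r
    using tendsto_round_vertex[OF X that] t by auto
  consider "s \<noteq> z" "s' \<noteq> z" | "s \<noteq> z" "s' = z" | "s = z" "s' \<noteq> z" | "s = z" "s' = z" by blast
  thus ?thesis
  proof cases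
    case 1
    thus ?thesis using fl by (simp add: round_edge_def)
  next
    case 2
    have "(\<lambda>n. real_of_int (round_vertex X z c t n s) / ?N n - (\<Sum>r\<in>X - {z}. real_of_int \<lfloor>real n * \<tau> (s, r)\<rfloor> / ?N n))
        \<longlonglongrightarrow> t s - (\<Sum>r\<in>X - {z}. \<tau> (s, r))"
      by (intro tendsto_diff tendsto_sum fl v ss')
    thus ?thesis using 2 X row[OF ss'(1)]
      by (simp add: round_edge_def sum_Diff_point diff_divide_distrib sum_divide_distrib)
  next
    case 3
    have "(\<lambda>n. real_of_int (round_vertex X z c t' n s') / ?N n - (\<Sum>r\<in>X - {z}. real_of_int \<lfloor>real n * \<tau> (r, s')\<rfloor> / ?N n))
        \<longlonglongrightarrow> t' s' - (\<Sum>r\<in>X - {z}. \<tau> (r, s'))"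
      by (intro tendsto_diff tendsto_sum fl v ss')
    thus ?thesis using 3 X col[OF ss'(2)]
      by (simp add: round_edge_def sum_Diff_point diff_divide_distrib sum_divide_distrib)
  next
    case 4
    have "(\<lambda>n. ?N n / ?N n - (\<Sum>r\<in>X - {z}. real_of_int (round_vertex X z c t n r) / ?N n)
        - (\<Sum>r\<in>X - {z}. real_of_int (round_vertex X z c t' n r) / ?N n)
        + (\<Sum>r\<in>X - {z}. \<Sum>r'\<in>X - {z}. real_of_int \<lfloor>real n * \<tau> (r, r')\<rfloor> / ?N n))
      \<longlonglongrightarrow> 1 - (\<Sum>r\<in>X - {z}. t r) - (\<Sum>r\<in>X - {z}. t' r) + (\<Sum>r\<in>X - {z}. \<Sum>r'\<in>X - {z}. \<tau> (r, r'))"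
      by (intro tendsto_add tendsto_diff tendsto_sum fl v one) auto
    also have "(\<Sum>r\<in>X - {z}. \<Sum>r'\<in>X - {z}. \<tau> (r, r')) = (\<Sum>r\<in>X - {z}. t r - \<tau> (r, z))"
      using X row by (intro sum.cong) (auto simp: sum_Diff_point)
    also have "1 - (\<Sum>r\<in>X - {z}. t r) - (\<Sum>r\<in>X - {z}. t' r) + (\<Sum>r\<in>X - {z}. t r - \<tau> (r, z)) = \<tau> (z, z)"
      using X t col[of z] by (simp add: sum_subtractf sum_Diff_point)
    finally show ?thesis using 4
      by (simp add: round_edge_def diff_divide_distrib add_divide_distrib sum_divide_distrib)
  qed
qed

text \<open>Along the rounded counts the logarithm of \<open>potts_cover_average\<close>, divided by
  the number of sheets, has the Bethe value as the limit of its left side, while the right side is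
  constant.\<close>

lemma bethe_value_le_potts:
  fixes w :: "'e \<Rightarrow> real" and t :: "'v \<Rightarrow> nat \<Rightarrow> real" and \<tau> :: "'e \<Rightarrow> nat \<times> nat \<Rightarrow> real"
  assumes fin: "finite V" "finite E" and q: "q \<ge> 1" and w: "\<And>e. e \<in> E \<Longrightarrow> w e > 0"
    and ends: "\<And>e. e \<in> E \<Longrightarrow> a e \<in> V \<and> b e \<in> V"
    and t0: "\<And>v s. v \<in> V \<Longrightarrow> s \<in> {1..q} \<Longrightarrow> t v s \<ge> 0"
    and t1: "\<And>v. v \<in> V \<Longrightarrow> (\<Sum>s\<in>{1..q}. t v s) = 1"
    and \<tau>0: "\<And>e p. e \<in> E \<Longrightarrow> p \<in> {1..q} \<times> {1..q} \<Longrightarrow> \<tau> e p \<ge> 0"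
    and row: "\<And>e s. e \<in> E \<Longrightarrow> s \<in> {1..q} \<Longrightarrow> (\<Sum>s'\<in>{1..q}. \<tau> e (s, s')) = t (a e) s"
    and col: "\<And>e s'. e \<in> E \<Longrightarrow> s' \<in> {1..q} \<Longrightarrow> (\<Sum>s\<in>{1..q}. \<tau> e (s, s')) = t (b e) s'"
  defines "h \<equiv> \<lambda>v. - (\<Sum>s\<in>{1..q}. t v s * ln (t v s))"
  shows "(\<Sum>v\<in>V. h v) + (\<Sum>e\<in>E. - (\<Sum>p\<in>{1..q} \<times> {1..q}. \<tau> e p * ln (\<tau> e p)) - h (a e) - h (b e)
      + (\<Sum>s\<in>{1..q}. \<tau> e (s, s)) * ln (1 + w e)) \<le> ln (potts_sum V E a b q w)"
proof -
  let ?X = "{1..q}"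
  define c where "c = (card ?X + 1)^2"
  define N where "N = (\<lambda>n. n + c)"
  define rv where "rv = (\<lambda>n v. round_vertex ?X 1 c (t v) n)"
  define re where "re = (\<lambda>n e. round_edge ?X 1 c (t (a e)) (t (b e)) (\<tau> e) n)"
  define Kv where "Kv = (\<lambda>n v s. nat (rv n v s))"
  define Ke where "Ke = (\<lambda>n e p. nat (re n e p))"
  define T where "T = (\<lambda>n v. real (card (seqs_of_type {..<N n} ?X (Kv n v))))"
  define M where "M = (\<lambda>n e. real (card (seqs_of_type {..<N n} (?X \<times> ?X) (Ke n e))))"
  define D where "D = (\<lambda>n e. \<Sum>s\<in>?X. Ke n e (s, s))"
  let ?P = "potts_sum V E a b q w"
  have X: "finite ?X" "1 \<in> ?X" using q by auto
  have cX: "card ?X \<le> c" by (simp add: c_def power2_eq_square)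
  have Npos: "N n \<ge> 1" for n by (simp add: N_def c_def power2_eq_square)
  have Ninf: "filterlim N at_top sequentially" unfolding N_def by (rule filterlim_add_const_nat_at_top)
  have rv0: "rv n v s \<ge> 0" if "v \<in> V" "s \<in> ?X" for n v s
  proof -
    have "0 \<le> real n * t v s" using t0[OF that] by simp
    also have "\<dots> \<le> rv n v s" unfolding rv_def by (rule round_vertex_ge[OF X that(2) cX t1[OF that(1)]])
    finally show ?thesis by simp
  qed
  have re0: "re n e p \<ge> 0" if ep: "e \<in> E" "p \<in> ?X \<times> ?X" for n e p
  proof -
    obtain s s' where p: "p = (s, s')" "s \<in> ?X" "s' \<in> ?X" using ep(2) by blast
    have "a e \<in> V" "b e \<in> V" using ends that(1) by auto
    thus ?thesis unfolding re_def p(1) using that(1) p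
      by (intro round_edge_nonneg[OF X p(2,3) c_def t1 t1] \<tau>0 row col) auto
  qed
  have sumv: "(\<Sum>s\<in>?X. Kv n v s) = N n" if "v \<in> V" for n v
  proof -
    have "int (\<Sum>s\<in>?X. Kv n v s) = (\<Sum>s\<in>?X. rv n v s)"
      unfolding Kv_def of_nat_sum using rv0[OF that] by (intro sum.cong) auto
    also have "\<dots> = int (N n)" unfolding rv_def N_def by (rule round_vertex_sum[OF X])
    finally show ?thesis by (simp only: of_nat_eq_iff)
  qed
  have mrow: "(\<Sum>s'\<in>?X. Ke n e (s, s')) = Kv n (a e) s" if "e \<in> E" "s \<in> ?X" for n e s
  proof -
    have "int (\<Sum>s'\<in>?X. Ke n e (s, s')) = (\<Sum>s'\<in>?X. re n e (s, s'))"
      unfolding Ke_def of_nat_sum using re0[OF that(1)] that by (intro sum.cong) auto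
    also have "\<dots> = rv n (a e) s" unfolding re_def rv_def by (rule round_edge_margins(1)[OF X that(2)])
    also have "\<dots> = int (Kv n (a e) s)" using rv0 ends that by (simp add: Kv_def)
    finally show ?thesis by (simp only: of_nat_eq_iff)
  qed
  have mcol: "(\<Sum>s\<in>?X. Ke n e (s, s')) = Kv n (b e) s'" if "e \<in> E" "s' \<in> ?X" for n e s'
  proof -
    have "int (\<Sum>s\<in>?X. Ke n e (s, s')) = (\<Sum>s\<in>?X. re n e (s, s'))"
      unfolding Ke_def of_nat_sum using re0[OF that(1)] that by (intro sum.cong) auto
    also have "\<dots> = rv n (b e) s'" unfolding re_def rv_def by (rule round_edge_margins(2)[OF X that(2)])
    also have "\<dots> = int (Kv n (b e) s')" using rv0 ends that by (simp add: Kv_def)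
    finally show ?thesis by (simp only: of_nat_eq_iff)
  qed
  have sume: "(\<Sum>p\<in>?X \<times> ?X. Ke n e p) = N n" if "e \<in> E" for n e
  proof -
    have "(\<Sum>p\<in>?X \<times> ?X. Ke n e p) = (\<Sum>s\<in>?X. \<Sum>s'\<in>?X. Ke n e (s, s'))"
      by (simp add: sum.cartesian_product)
    thus ?thesis using mrow[OF that] sumv[of "a e" n] ends[OF that] by simp
  qed
  have limv: "(\<lambda>n. real (Kv n v s) / real (N n)) \<longlonglongrightarrow> t v s" if "v \<in> V" "s \<in> ?X" for v s
    using tendsto_round_vertex[OF X that(2) t1[OF that(1)], of c] rv0[OF that]
    by (simp add: Kv_def N_def rv_def)
  have lime: "(\<lambda>n. real (Ke n e p) / real (N n)) \<longlonglongrightarrow> \<tau> e p" if ep: "e \<in> E" "p \<in> ?X \<times> ?X" for e p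
  proof -
    obtain s s' where p: "p = (s, s')" "s \<in> ?X" "s' \<in> ?X" using ep(2) by blast
    have ab: "a e \<in> V" "b e \<in> V" using ends that(1) by auto
    have "(\<lambda>n. real_of_int (re n e (s, s')) / real (n + c)) \<longlonglongrightarrow> \<tau> e (s, s')"
      unfolding re_def using that(1) by (intro tendsto_round_edge[OF X p(2,3) t1[OF ab(1)] t1[OF ab(2)]] row col)
    thus ?thesis using re0[OF that] by (simp add: Ke_def N_def p(1))
  qed
  have Tpos: "T n v > 0" if "v \<in> V" for n v
    unfolding T_def using ln_card_seqs_of_type(1)[OF X(1), of "{..<N n}" "Kv n v"] sumv[OF that] by simp
  have Mpos: "M n e > 0" if "e \<in> E" for n e
    unfolding M_def using ln_card_seqs_of_type(1)[of "?X \<times> ?X" "{..<N n}" "Ke n e"] sume[OF that] by simp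
  have limT: "(\<lambda>n. ln (T n v) / real (N n)) \<longlonglongrightarrow> h v" if "v \<in> V" for v
    unfolding T_def h_def using that by (intro entropy_limit X Ninf Npos sumv limv t0)
  have limM: "(\<lambda>n. ln (M n e) / real (N n)) \<longlonglongrightarrow> - (\<Sum>p\<in>?X \<times> ?X. \<tau> e p * ln (\<tau> e p))" if "e \<in> E" for e
    unfolding M_def using that by (intro entropy_limit Ninf Npos sume lime \<tau>0) auto
  have limD: "(\<lambda>n. real (D n e) / real (N n)) \<longlonglongrightarrow> (\<Sum>s\<in>?X. \<tau> e (s, s))" if "e \<in> E" for e
    unfolding D_def of_nat_sum sum_divide_distrib using that by (intro tendsto_sum lime) auto
  let ?x = "\<lambda>n. (\<Sum>v\<in>V. ln (T n v) / real (N n)) + (\<Sum>e\<in>E. ln (M n e) / real (N n)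
      - ln (T n (a e)) / real (N n) - ln (T n (b e)) / real (N n) + real (D n e) / real (N n) * ln (1 + w e))"
  have bound: "?x n \<le> ln ?P" for n
  proof -
    let ?L = "(\<Prod>v\<in>V. T n v) * (\<Prod>e\<in>E. M n e / (T n (a e) * T n (b e)) * (1 + w e) ^ D n e)"
    have L: "?L \<le> ?P ^ card {..<N n}"
      unfolding D_def
      by (rule potts_cover_average[where Kv = "Kv n" and Ke = "Ke n"])
         (use fin q w ends mrow mcol Tpos in \<open>auto simp: T_def M_def\<close>)
    have Vpos: "(\<Prod>v\<in>V. T n v) > 0" using Tpos by (intro prod_pos) auto
    have Epos1: "M n e / (T n (a e) * T n (b e)) * (1 + w e) ^ D n e > 0" if "e \<in> E" for e
      using Tpos[of "a e" n] Tpos[of "b e" n] Mpos[OF that, of n] ends[OF that] w[OF that]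
      by (intro mult_pos_pos divide_pos_pos zero_less_power) auto
    hence Epos: "(\<Prod>e\<in>E. M n e / (T n (a e) * T n (b e)) * (1 + w e) ^ D n e) > 0"
      by (intro prod_pos) auto
    \<comment> \<open>Strict positivity of \<open>?P\<close> comes from the bound itself, whose left
      side is positive; \<open>N n \<ge> 1\<close> excludes the case
      \<open>0 ^ 0 = 1\<close>.\<close>
    have "?P \<ge> 0" unfolding potts_sum_def using w by (intro sum_nonneg prod_nonneg) (auto simp: less_imp_le)
    moreover have "?P ^ N n > 0" using L mult_pos_pos[OF Vpos Epos] by simp
    ultimately have Ppos: "?P > 0" using Npos[of n] by (cases "?P = 0") (auto simp: power_0_left)
    have "ln ?L \<le> ln (?P ^ N n)" using L mult_pos_pos[OF Vpos Epos] by (intro ln_mono) auto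
    also have "ln (?P ^ N n) = real (N n) * ln ?P" by (rule ln_realpow)
    also have "ln ?L = (\<Sum>v\<in>V. ln (T n v)) + (\<Sum>e\<in>E. ln (M n e / (T n (a e) * T n (b e)) * (1 + w e) ^ D n e))"
    proof -
      have "ln ?L = ln (\<Prod>v\<in>V. T n v) + ln (\<Prod>e\<in>E. M n e / (T n (a e) * T n (b e)) * (1 + w e) ^ D n e)"
        using Vpos Epos by (rule ln_mult_pos)
      moreover have "ln (\<Prod>v\<in>V. T n v) = (\<Sum>v\<in>V. ln (T n v))"
        using fin Tpos by (intro ln_prod) (auto simp: less_imp_neq[symmetric])
      moreover have "ln (\<Prod>e\<in>E. M n e / (T n (a e) * T n (b e)) * (1 + w e) ^ D n e)
          = (\<Sum>e\<in>E. ln (M n e / (T n (a e) * T n (b e)) * (1 + w e) ^ D n e))"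
        by (intro ln_prod less_imp_neq[THEN not_sym] Epos1 fin)
      ultimately show ?thesis by simp
    qed
    also have "(\<Sum>e\<in>E. ln (M n e / (T n (a e) * T n (b e)) * (1 + w e) ^ D n e))
        = (\<Sum>e\<in>E. ln (M n e) - ln (T n (a e)) - ln (T n (b e)) + real (D n e) * ln (1 + w e))"
    proof (rule sum.cong[OF refl])
      fix e assume e: "e \<in> E"
      have pos: "M n e > 0" "T n (a e) > 0" "T n (b e) > 0" "1 + w e > 0"
        using Mpos[OF e] Tpos ends[OF e] w[OF e] by auto
      have "ln (M n e / (T n (a e) * T n (b e)) * (1 + w e) ^ D n e)
          = ln (M n e / (T n (a e) * T n (b e))) + ln ((1 + w e) ^ D n e)"
        using pos by (intro ln_mult_pos) auto
      also have "ln ((1 + w e) ^ D n e) = real (D n e) * ln (1 + w e)" by (rule ln_realpow)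
      also have "ln (M n e / (T n (a e) * T n (b e))) = ln (M n e) - (ln (T n (a e)) + ln (T n (b e)))"
        using pos by (simp add: ln_div ln_mult_pos)
      finally show "ln (M n e / (T n (a e) * T n (b e)) * (1 + w e) ^ D n e)
          = ln (M n e) - ln (T n (a e)) - ln (T n (b e)) + real (D n e) * ln (1 + w e)" by simp
    qed
    finally have "((\<Sum>v\<in>V. ln (T n v)) + (\<Sum>e\<in>E. ln (M n e) - ln (T n (a e)) - ln (T n (b e)) + real (D n e) * ln (1 + w e)))
        / real (N n) \<le> ln ?P"
      using Npos[of n] by (simp add: divide_le_eq mult.commute)
    thus ?thesis by (simp add: add_divide_distrib diff_divide_distrib sum_divide_distrib)
  qed
  have "?x \<longlonglongrightarrow> (\<Sum>v\<in>V. h v) + (\<Sum>e\<in>E. - (\<Sum>p\<in>?X \<times> ?X. \<tau> e p * ln (\<tau> e p)) - h (a e) - h (b e)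
      + (\<Sum>s\<in>?X. \<tau> e (s, s)) * ln (1 + w e))"
    using ends by (intro tendsto_add tendsto_sum tendsto_diff tendsto_mult tendsto_const limT limM limD) auto
  thus ?thesis using bound by (intro LIMSEQ_le_const2) auto
qed

section \<open>The Bethe functional of the Potts model\<close>

lemma sum_by_value:
  fixes f :: "('v \<Rightarrow> 'x) \<Rightarrow> real"
  assumes "finite \<alpha>" "finite X" "i \<in> \<alpha>"
  shows "(\<Sum>x\<in>\<alpha> \<rightarrow>\<^sub>E X. f x) = (\<Sum>s\<in>X. \<Sum>x\<in>{x \<in> \<alpha> \<rightarrow>\<^sub>E X. x i = s}. f x)"
  using assms by (intro sum.group[symmetric] finite_PiE) auto

lemma pseudomarginal_le:
  assumes "finite \<alpha>" "finite X" "i \<in> \<alpha>" "x \<in> \<alpha> \<rightarrow>\<^sub>E X"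
    and T: "\<And>x. x \<in> \<alpha> \<rightarrow>\<^sub>E X \<Longrightarrow> (0::real) \<le> T x"
    and marg: "(\<Sum>y\<in>{y \<in> \<alpha> \<rightarrow>\<^sub>E X. y i = x i}. T y) = t (x i)"
  shows "T x \<le> t (x i)"
proof -
  have "finite (\<alpha> \<rightarrow>\<^sub>E X)" using assms by (intro finite_PiE) auto
  hence "T x \<le> (\<Sum>y\<in>{y \<in> \<alpha> \<rightarrow>\<^sub>E X. y i = x i}. T y)"
    using assms by (intro member_le_sum) auto
  thus ?thesis using marg by simp
qed

text \<open>The real form of \<open>log_bethe\<close> on the polytope. The marginal conditions turn
  the sums of \<open>T e x * ln (t i (x i))\<close> into vertex entropies, so each edge contributes
  its entropy minus those of its ends.\<close>

definition potts_log_bethe ::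
  "'v set \<Rightarrow> 'v set set \<Rightarrow> ('v set \<Rightarrow> real) \<Rightarrow> nat \<Rightarrow> ('v, nat) pseudomarginal \<Rightarrow> real" where
  "potts_log_bethe V E J q = (\<lambda>(t, T).
     (\<Sum>e\<in>E. \<Sum>x\<in>e \<rightarrow>\<^sub>E {1..q}. T e x * (J e * edge_delta e x))
   - (\<Sum>i\<in>V. \<Sum>s\<in>{1..q}. t i s * ln (t i s))
   - (\<Sum>e\<in>E. (\<Sum>x\<in>e \<rightarrow>\<^sub>E {1..q}. T e x * ln (T e x)) - (\<Sum>i\<in>e. \<Sum>s\<in>{1..q}. t i s * ln (t i s))))"

text \<open>At \<open>r = 0\<close> the left side is \<open>0 * -\<infinity> = 0\<close>, in
  agreement with the vanishing factor on the right.\<close>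

lemma ereal_mult_elog: "ereal r * elog r = ereal (r * ln r)"
  by (simp add: elog_def)

lemma log_bethe_potts:
  assumes G: "finite_simple_graph V E" and \<tau>: "\<tau> \<in> local_marginal_polytope V E {1..q}"
  shows "log_bethe V E {1..q} (\<lambda>i s. 1) (potts_potential J) \<tau> = ereal (potts_log_bethe V E J q \<tau>)"
proof -
  let ?X = "{1..q}"
  obtain t T where tT: "\<tau> = (t, T)" by force
  have t0: "\<And>i s. i \<in> V \<Longrightarrow> s \<in> ?X \<Longrightarrow> 0 \<le> t i s"
    and T0: "\<And>e x. e \<in> E \<Longrightarrow> x \<in> e \<rightarrow>\<^sub>E ?X \<Longrightarrow> 0 \<le> T e x"
    and marg: "\<And>e i s. e \<in> E \<Longrightarrow> i \<in> e \<Longrightarrow> s \<in> ?X \<Longrightarrow> (\<Sum>x\<in>{x \<in> e \<rightarrow>\<^sub>E ?X. x i = s}. T e x) = t i s"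
    using \<tau> unfolding tT local_marginal_polytope_def by auto
  have e: "finite e" "e \<subseteq> V" if "e \<in> E" for e
    using G that unfolding finite_simple_graph_def by (auto intro: finite_subset)
  have 1: "(\<Sum>i\<in>V. \<Sum>s\<in>?X. ereal (t i s) * elog 1) = 0"
    by (simp add: elog_def zero_ereal_def[symmetric])
  have 2: "(\<Sum>e\<in>E. \<Sum>x\<in>e \<rightarrow>\<^sub>E ?X. ereal (T e x) * elog (potts_potential J e x))
      = ereal (\<Sum>e\<in>E. \<Sum>x\<in>e \<rightarrow>\<^sub>E ?X. T e x * (J e * edge_delta e x))"
    by (simp add: elog_def potts_potential_def)
  have 3: "(\<Sum>i\<in>V. \<Sum>s\<in>?X. ereal (t i s) * elog (t i s)) = ereal (\<Sum>i\<in>V. \<Sum>s\<in>?X. t i s * ln (t i s))"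
    by (simp add: ereal_mult_elog)
  have T_ln: "ereal (T e x) * elog (T e x / (\<Prod>i\<in>e. t i (x i)))
      = ereal (T e x * ln (T e x) - (\<Sum>i\<in>e. T e x * ln (t i (x i))))"
    if ex: "e \<in> E" "x \<in> e \<rightarrow>\<^sub>E ?X" for e x
  proof (cases "T e x = 0")
    case True
    thus ?thesis by (simp add: zero_ereal_def[symmetric])
  next
    case False
    hence pos: "T e x > 0" using T0[OF ex] by simp
    \<comment> \<open>A configuration of positive mass has positive vertex marginals, so the
      logarithm of the quotient splits into finite terms.\<close>
    have tpos: "t i (x i) > 0" if i: "i \<in> e" for i
    proof -
      have "x i \<in> ?X" using ex(2) i by blast
      from marg[OF ex(1) i this] have "T e x \<le> t i (x i)"
        by (rule pseudomarginal_le[where t = "t i" and X = ?X and T = "T e", OF e(1)[OF ex(1)] finite_atLeastAtMost i ex(2) T0[OF ex(1)], rotated])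
      thus ?thesis using pos by simp
    qed
    have "(\<Prod>i\<in>e. t i (x i)) > 0" using tpos by (intro prod_pos) auto
    moreover have "ln (\<Prod>i\<in>e. t i (x i)) = (\<Sum>i\<in>e. ln (t i (x i)))"
      using e[OF ex(1)] tpos by (intro ln_prod) (auto simp: less_imp_neq[symmetric])
    ultimately show ?thesis using pos
      by (simp add: elog_def ln_div right_diff_distrib sum_distrib_left)
  qed
  have "(\<Sum>e\<in>E. \<Sum>x\<in>e \<rightarrow>\<^sub>E ?X. ereal (T e x) * elog (T e x / (\<Prod>i\<in>e. t i (x i))))
      = (\<Sum>e\<in>E. ereal ((\<Sum>x\<in>e \<rightarrow>\<^sub>E ?X. T e x * ln (T e x)) - (\<Sum>i\<in>e. \<Sum>s\<in>?X. t i s * ln (t i s))))"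
  proof (rule sum.cong[OF refl])
    fix e assume eE: "e \<in> E"
    have "(\<Sum>x\<in>e \<rightarrow>\<^sub>E ?X. T e x * ln (t i (x i))) = (\<Sum>s\<in>?X. t i s * ln (t i s))" if i: "i \<in> e" for i
    proof -
      have "(\<Sum>x\<in>e \<rightarrow>\<^sub>E ?X. T e x * ln (t i (x i)))
          = (\<Sum>s\<in>?X. \<Sum>x\<in>{x \<in> e \<rightarrow>\<^sub>E ?X. x i = s}. T e x * ln (t i (x i)))"
        using e[OF eE] i by (intro sum_by_value) auto
      also have "\<dots> = (\<Sum>s\<in>?X. (\<Sum>x\<in>{x \<in> e \<rightarrow>\<^sub>E ?X. x i = s}. T e x) * ln (t i s))"
        unfolding sum_distrib_right by (intro sum.cong) auto
      also have "\<dots> = (\<Sum>s\<in>?X. t i s * ln (t i s))" using marg[OF eE i] by simp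
      finally show ?thesis .
    qed
    hence "(\<Sum>x\<in>e \<rightarrow>\<^sub>E ?X. \<Sum>i\<in>e. T e x * ln (t i (x i))) = (\<Sum>i\<in>e. \<Sum>s\<in>?X. t i s * ln (t i s))"
      by (subst sum.swap) simp
    moreover have "(\<Sum>x\<in>e \<rightarrow>\<^sub>E ?X. ereal (T e x) * elog (T e x / (\<Prod>i\<in>e. t i (x i))))
        = ereal (\<Sum>x\<in>e \<rightarrow>\<^sub>E ?X. T e x * ln (T e x) - (\<Sum>i\<in>e. T e x * ln (t i (x i))))"
      unfolding sum_ereal[symmetric] using T_ln[OF eE] by (intro sum.cong) auto
    ultimately show "(\<Sum>x\<in>e \<rightarrow>\<^sub>E ?X. ereal (T e x) * elog (T e x / (\<Prod>i\<in>e. t i (x i))))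
      = ereal ((\<Sum>x\<in>e \<rightarrow>\<^sub>E ?X. T e x * ln (T e x)) - (\<Sum>i\<in>e. \<Sum>s\<in>?X. t i s * ln (t i s)))"
      by (simp add: sum_subtractf)
  qed
  thus ?thesis unfolding tT log_bethe_def potts_log_bethe_def prod.case 1 2 3 sum_ereal by simp
qed

lemma sum_pair: "i \<noteq> j \<Longrightarrow> sum f {i, j} = f i + (f j :: real)"
  by simp

text \<open>Distinguishing one end of an unordered edge identifies its configurations with ordered
  colour pairs, the form in which the cover argument needs them.\<close>

definition pair_config :: "'v set \<Rightarrow> 'v \<Rightarrow> 'x \<times> 'x \<Rightarrow> 'v \<Rightarrow> 'x" where
  "pair_config e i p = restrict (\<lambda>v. if v = i then fst p else snd p) e"

lemma bij_betw_pair_config: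
  assumes "i \<noteq> j"
  shows "bij_betw (pair_config {i, j} i) (X \<times> X) ({i, j} \<rightarrow>\<^sub>E X)"
  by (rule bij_betw_byWitness[where f' = "\<lambda>x. (x i, x j)"])
     (use assms in \<open>auto simp: pair_config_def fun_eq_iff restrict_def PiE_def extensional_def\<close>)

lemma potts_log_bethe_le:
  assumes G: "finite_simple_graph V E" and q: "q \<ge> 1" and J: "\<And>e. e \<in> E \<Longrightarrow> J e > 0"
    and \<tau>: "\<tau> \<in> local_marginal_polytope V E {1..q}"
  shows "potts_log_bethe V E J q \<tau> \<le> ln (Z_Potts V E J q)"
proof -
  let ?X = "{1..q}"
  obtain t T where tT: "\<tau> = (t, T)" by force
  have t0: "\<And>i s. i \<in> V \<Longrightarrow> s \<in> ?X \<Longrightarrow> 0 \<le> t i s"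
    and T0: "\<And>e x. e \<in> E \<Longrightarrow> x \<in> e \<rightarrow>\<^sub>E ?X \<Longrightarrow> 0 \<le> T e x"
    and t1: "\<And>i. i \<in> V \<Longrightarrow> (\<Sum>s\<in>?X. t i s) = 1"
    and marg: "\<And>e i s. e \<in> E \<Longrightarrow> i \<in> e \<Longrightarrow> s \<in> ?X \<Longrightarrow> (\<Sum>x\<in>{x \<in> e \<rightarrow>\<^sub>E ?X. x i = s}. T e x) = t i s"
    using \<tau> unfolding tT local_marginal_polytope_def by auto
  have fin: "finite V" "finite E" and card2: "\<And>e. e \<in> E \<Longrightarrow> e \<subseteq> V \<and> card e = 2"
    using G finite_subset[of E "Pow V"] unfolding finite_simple_graph_def by auto
  have "\<exists>i j. e = {i, j} \<and> i \<noteq> j" if "e \<in> E" for e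
    using card2[OF that] by (metis card_2_iff)
  \<comment> \<open>An arbitrary orientation: covers need a first and a second end for each
    edge.\<close>
  then obtain a b where ab: "\<And>e. e \<in> E \<Longrightarrow> e = {a e, b e} \<and> a e \<noteq> b e" by metis
  define \<tau>' where "\<tau>' = (\<lambda>e p. T e (pair_config e (a e) p))"
  define h where "h = (\<lambda>v. - (\<Sum>s\<in>?X. t v s * ln (t v s)))"
  have bij: "bij_betw (pair_config e (a e)) (?X \<times> ?X) (e \<rightarrow>\<^sub>E ?X)" if "e \<in> E" for e
    using bij_betw_pair_config[of "a e" "b e" ?X] ab[OF that] by metis
  have pa: "pair_config e (a e) p (a e) = fst p" "pair_config e (a e) p (b e) = snd p" if "e \<in> E" for e p
  proof -
    have "a e \<in> e" "b e \<in> e" "a e \<noteq> b e" using ab[OF that] by auto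
    thus "pair_config e (a e) p (a e) = fst p" "pair_config e (a e) p (b e) = snd p"
      by (auto simp: pair_config_def)
  qed
  have ends: "a e \<in> V \<and> b e \<in> V" if "e \<in> E" for e using ab[OF that] card2[OF that] by auto
  have sumT: "(\<Sum>x\<in>e \<rightarrow>\<^sub>E ?X. f (T e x)  x) = (\<Sum>p\<in>?X \<times> ?X. f (\<tau>' e p) (pair_config e (a e) p))" if "e \<in> E"
    for e and f :: "real \<Rightarrow> ('a \<Rightarrow> nat) \<Rightarrow> real"
    unfolding \<tau>'_def using sum.reindex_bij_betw[OF bij[OF that], of "\<lambda>x. f (T e x) x"] by simp
  have marg': "(\<Sum>p\<in>?X \<times> ?X. if pair_config e (a e) p i = s then \<tau>' e p else 0) = t i s"
    if "e \<in> E" "i \<in> e" "s \<in> ?X" for e i s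
  proof -
    have "finite (e \<rightarrow>\<^sub>E ?X)" using card2[OF that(1)] finite_subset[OF _ fin(1)] by (intro finite_PiE) auto
    hence "t i s = (\<Sum>x\<in>e \<rightarrow>\<^sub>E ?X. if x i = s then T e x else 0)"
      unfolding marg[OF that, symmetric] by (intro sum.mono_neutral_cong_left) auto
    thus ?thesis using sumT[OF that(1), of "\<lambda>r x. if x i = s then r else 0"] by simp
  qed
  have row: "(\<Sum>s'\<in>?X. \<tau>' e (s, s')) = t (a e) s" if "e \<in> E" "s \<in> ?X" for e s
  proof -
    have in_e: "a e \<in> e" using ab[OF that(1)] by auto
    have "t (a e) s = (\<Sum>p\<in>?X \<times> ?X. if fst p = s then \<tau>' e p else 0)"
      using marg'[OF that(1) in_e that(2)] by (simp add: pa[OF that(1)])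
    also have "\<dots> = (\<Sum>r\<in>?X. \<Sum>s'\<in>?X. if r = s then \<tau>' e (r, s') else 0)"
      unfolding sum.cartesian_product by (intro sum.cong) auto
    also have "\<dots> = (\<Sum>r\<in>?X. if r = s then \<Sum>s'\<in>?X. \<tau>' e (r, s') else 0)"
      by (intro sum.cong) auto
    finally show ?thesis using that(2) by simp
  qed
  have col: "(\<Sum>s\<in>?X. \<tau>' e (s, s')) = t (b e) s'" if "e \<in> E" "s' \<in> ?X" for e s'
  proof -
    have in_e: "b e \<in> e" using ab[OF that(1)] by auto
    have "t (b e) s' = (\<Sum>p\<in>?X \<times> ?X. if snd p = s' then \<tau>' e p else 0)"
      using marg'[OF that(1) in_e that(2)] by (simp add: pa[OF that(1)])
    also have "\<dots> = (\<Sum>s\<in>?X. \<Sum>r\<in>?X. if r = s' then \<tau>' e (s, r) else 0)"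
      unfolding sum.cartesian_product by (intro sum.cong) auto
    finally show ?thesis using that(2) by simp
  qed
  have \<tau>'0: "\<tau>' e p \<ge> 0" if "e \<in> E" "p \<in> ?X \<times> ?X" for e p
    unfolding \<tau>'_def using T0[OF that(1)] bij_betwE[OF bij[OF that(1)]] that(2) by blast
  have delta: "edge_delta e x = of_bool (x (a e) = x (b e))" if "e \<in> E" for e and x :: "'a \<Rightarrow> nat"
    using edge_delta_pair[of "a e" "b e" x] ab[OF that] by (metis of_bool_def)
  \<comment> \<open>A monochromatic edge has weight \<open>exp (J e)\<close> and any other edge
    weight 1, so \<open>w e = exp (J e) - 1\<close>, which is positive since
    \<open>J e > 0\<close>.\<close>
  have Z: "Z_Potts V E J q = potts_sum V E a b q (\<lambda>e. exp (J e) - 1)"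
    unfolding Z_Potts_def potts_sum_def by (intro sum.cong prod.cong refl) (auto simp: delta)
  have "potts_log_bethe V E J q \<tau> = (\<Sum>v\<in>V. h v) + (\<Sum>e\<in>E. (\<Sum>x\<in>e \<rightarrow>\<^sub>E ?X. T e x * (J e * edge_delta e x))
      - (\<Sum>x\<in>e \<rightarrow>\<^sub>E ?X. T e x * ln (T e x)) + (\<Sum>i\<in>e. \<Sum>s\<in>?X. t i s * ln (t i s)))"
    unfolding tT potts_log_bethe_def h_def by (simp add: sum_negf sum.distrib sum_subtractf)
  also have "\<dots> = (\<Sum>v\<in>V. h v) + (\<Sum>e\<in>E. - (\<Sum>p\<in>?X \<times> ?X. \<tau>' e p * ln (\<tau>' e p)) - h (a e) - h (b e)
      + (\<Sum>s\<in>?X. \<tau>' e (s, s)) * ln (1 + (exp (J e) - 1)))"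
  proof (rule arg_cong2[where f = "(+)", OF refl], rule sum.cong[OF refl])
    fix e assume e: "e \<in> E"
    have "(\<Sum>x\<in>e \<rightarrow>\<^sub>E ?X. T e x * (J e * edge_delta e x)) = (\<Sum>p\<in>?X \<times> ?X. \<tau>' e p * (J e * of_bool (fst p = snd p)))"
      using sumT[OF e, of "\<lambda>r x. r * (J e * edge_delta e x)"] by (simp add: delta[OF e] pa[OF e])
    also have "\<dots> = (\<Sum>s\<in>?X. \<Sum>s'\<in>?X. if s' = s then \<tau>' e (s, s') * J e else 0)"
      unfolding sum.cartesian_product by (intro sum.cong) auto
    also have "\<dots> = (\<Sum>s\<in>?X. \<tau>' e (s, s)) * J e" by (simp add: sum_distrib_right)
    finally have 1: "(\<Sum>x\<in>e \<rightarrow>\<^sub>E ?X. T e x * (J e * edge_delta e x)) = (\<Sum>s\<in>?X. \<tau>' e (s, s)) * J e" .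
    have 2: "(\<Sum>x\<in>e \<rightarrow>\<^sub>E ?X. T e x * ln (T e x)) = (\<Sum>p\<in>?X \<times> ?X. \<tau>' e p * ln (\<tau>' e p))"
      using sumT[OF e, of "\<lambda>r x. r * ln r"] by simp
    have "(\<Sum>i\<in>e. h i) = (\<Sum>i\<in>{a e, b e}. h i)" using ab[OF e] by simp
    also have "\<dots> = h (a e) + h (b e)" using conjunct2[OF ab[OF e]] by (rule sum_pair)
    finally have 3: "(\<Sum>i\<in>e. \<Sum>s\<in>?X. t i s * ln (t i s)) = - h (a e) - h (b e)"
      by (simp add: h_def sum_negf)
    show "(\<Sum>x\<in>e \<rightarrow>\<^sub>E ?X. T e x * (J e * edge_delta e x))
      - (\<Sum>x\<in>e \<rightarrow>\<^sub>E ?X. T e x * ln (T e x)) + (\<Sum>i\<in>e. \<Sum>s\<in>?X. t i s * ln (t i s))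
      = - (\<Sum>p\<in>?X \<times> ?X. \<tau>' e p * ln (\<tau>' e p)) - h (a e) - h (b e)
      + (\<Sum>s\<in>?X. \<tau>' e (s, s)) * ln (1 + (exp (J e) - 1))"
      unfolding 1 2 3 by simp
  qed
  also have "\<dots> \<le> ln (potts_sum V E a b q (\<lambda>e. exp (J e) - 1))"
    unfolding h_def
    by (rule bethe_value_le_potts) (use fin q J ends t0 t1 \<tau>'0 row col in auto)
  finally show ?thesis by (simp add: Z)
qed

section \<open>Compactness and attainment of the maxima\<close>

lemma compact_coordinatewise:
  fixes S :: "'a \<Rightarrow> 'b::topological_space set"
  assumes "\<And>i. compact (S i)"
  shows "compact {f. \<forall>i. f i \<in> S i}"
proof -
  \<comment> \<open>Tychonoff's theorem, since the index type may be infinite.\<close>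
  have "compactin (product_topology (\<lambda>i. euclidean) UNIV) (PiE UNIV S)"
    using assms unfolding compactin_PiE by (simp add: compactin_euclidean_iff)
  moreover have "PiE UNIV S = {f. \<forall>i. f i \<in> S i}" by (auto simp: PiE_def Pi_def extensional_def)
  ultimately show ?thesis by (simp add: euclidean_product_topology compactin_euclidean_iff)
qed

lemma continuous_on_pseudomarginal:
  "continuous_on A (\<lambda>p :: ('v, 'x) pseudomarginal. fst p i s)"
  "continuous_on A (\<lambda>p :: ('v, 'x) pseudomarginal. snd p e x)"
proof -
  note coord = continuous_on_product_then_coordinatewise[OF continuous_on_product_then_coordinatewise]
  show "continuous_on A (\<lambda>p :: ('v, 'x) pseudomarginal. fst p i s)"
    by (rule coord[OF continuous_on_fst[OF continuous_on_id]])
  show "continuous_on A (\<lambda>p :: ('v, 'x) pseudomarginal. snd p e x)"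
    by (rule coord[OF continuous_on_snd[OF continuous_on_id]])
qed

lemma continuous_on_mult_ln:
  fixes f :: "'a::topological_space \<Rightarrow> real"
  assumes "continuous_on A f" "\<And>x. x \<in> A \<Longrightarrow> f x \<ge> 0"
  shows "continuous_on A (\<lambda>x. f x * ln (f x))"
  unfolding continuous_on_def
proof
  fix x assume x: "x \<in> A"
  have "\<forall>\<^sub>F y in at x within A. f y \<ge> 0" using assms(2) by (auto simp: eventually_at_filter)
  thus "((\<lambda>x. f x * ln (f x)) \<longlongrightarrow> f x * ln (f x)) (at x within A)"
    using assms x by (intro tendsto_mult_ln) (auto simp: continuous_on_def)
qed

text \<open>The polytope leaves the values outside the index sets unconstrained, so it becomes compact only
  after these are set to \<open>0\<close>.\<close>

definition zero_outside :: "'v set \<Rightarrow> 'v set set \<Rightarrow> 'x set \<Rightarrow> ('v, 'x) pseudomarginal \<Rightarrow> ('v, 'x) pseudomarginal" where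
  "zero_outside V E X = (\<lambda>(t, T). (\<lambda>i s. if i \<in> V \<and> s \<in> X then t i s else 0,
     \<lambda>e x. if e \<in> E \<and> x \<in> e \<rightarrow>\<^sub>E X then T e x else 0))"

definition reduced_polytope :: "'v set \<Rightarrow> 'v set set \<Rightarrow> 'x set \<Rightarrow> ('v, 'x) pseudomarginal set" where
  "reduced_polytope V E X = {p \<in> local_marginal_polytope V E X.
     (\<forall>i s. i \<notin> V \<or> s \<notin> X \<longrightarrow> fst p i s = 0) \<and> (\<forall>e x. e \<notin> E \<or> x \<notin> e \<rightarrow>\<^sub>E X \<longrightarrow> snd p e x = 0)}"

lemma zero_outside_in_polytope:
  assumes "\<And>e. e \<in> E \<Longrightarrow> e \<subseteq> V" "\<tau> \<in> local_marginal_polytope V E X"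
  shows "zero_outside V E X \<tau> \<in> reduced_polytope V E X"
proof -
  obtain t T where tT: "\<tau> = (t, T)" by force
  have "(\<Sum>x\<in>{x \<in> e \<rightarrow>\<^sub>E X. x i = s}. if e \<in> E \<and> x \<in> e \<rightarrow>\<^sub>E X then T e x else 0)
      = (if i \<in> V \<and> s \<in> X then t i s else 0)" if "e \<in> E" "i \<in> e" "s \<in> X" for e i s
  proof -
    have "(\<Sum>x\<in>{x \<in> e \<rightarrow>\<^sub>E X. x i = s}. if e \<in> E \<and> x \<in> e \<rightarrow>\<^sub>E X then T e x else 0)
        = (\<Sum>x\<in>{x \<in> e \<rightarrow>\<^sub>E X. x i = s}. T e x)"
      using that by (intro sum.cong) auto
    also have "\<dots> = t i s" using assms(2) that by (simp add: tT local_marginal_polytope_def)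
    finally show ?thesis using that assms(1) by auto
  qed
  thus ?thesis using assms(2)
    by (simp add: reduced_polytope_def zero_outside_def local_marginal_polytope_def tT)
qed

lemma closed_Collect_ball:
  assumes "\<And>x. x \<in> A \<Longrightarrow> closed {p. P p x}"
  shows "closed {p. \<forall>x\<in>A. P p x}"
proof -
  have "{p. \<forall>x\<in>A. P p x} = (\<Inter>x\<in>A. {p. P p x})" by blast
  thus ?thesis using assms by (simp only:) (intro closed_INT ballI)
qed

lemma closed_Collect_imp_const: "(Q \<Longrightarrow> closed {p. P p}) \<Longrightarrow> closed {p. Q \<longrightarrow> P p}"
  by (cases Q) auto

text \<open>The constraints are closed, and all coordinates lie in \<open>{0..1}\<close>: an edge
  value is bounded by the marginal at any vertex of the edge.\<close>

lemma compact_reduced_polytope: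
  assumes V: "finite V" and E: "\<And>e. e \<in> E \<Longrightarrow> e \<subseteq> V \<and> e \<noteq> {}" and X: "finite X"
  shows "compact (reduced_polytope V E X :: ('v, 'x) pseudomarginal set)"
proof -
  let ?B = "{t :: 'v \<Rightarrow> 'x \<Rightarrow> real. \<forall>i. t i \<in> {f. \<forall>s. f s \<in> {0..1}}} \<times>
    {T :: 'v set \<Rightarrow> ('v \<Rightarrow> 'x) \<Rightarrow> real. \<forall>e. T e \<in> {f. \<forall>x. f x \<in> {0..1}}}"
  let ?P = "reduced_polytope V E X"
  have B: "compact ?B" by (intro compact_Times compact_coordinatewise compact_Icc)
  have closed: "closed ?P"
    unfolding reduced_polytope_def local_marginal_polytope_def split_beta mem_Collect_eq
    by (intro closed_Collect_conj closed_Collect_ball closed_Collect_all closed_Collect_imp_const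
        closed_Collect_le closed_Collect_eq continuous_on_pseudomarginal continuous_on_sum continuous_on_const)
  have "?P \<subseteq> ?B"
  proof
    fix p assume p: "p \<in> ?P"
    obtain t T where tT: "p = (t, T)" by force
    have t0: "\<And>i s. i \<in> V \<Longrightarrow> s \<in> X \<Longrightarrow> 0 \<le> t i s"
      and T0: "\<And>e x. e \<in> E \<Longrightarrow> x \<in> e \<rightarrow>\<^sub>E X \<Longrightarrow> 0 \<le> T e x"
      and t1: "\<And>i. i \<in> V \<Longrightarrow> (\<Sum>s\<in>X. t i s) = 1"
      and marg: "\<And>e i s. e \<in> E \<Longrightarrow> i \<in> e \<Longrightarrow> s \<in> X \<Longrightarrow> (\<Sum>x\<in>{x \<in> e \<rightarrow>\<^sub>E X. x i = s}. T e x) = t i s"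
      and z: "\<And>i s. i \<notin> V \<or> s \<notin> X \<Longrightarrow> t i s = 0" "\<And>e x. e \<notin> E \<or> x \<notin> e \<rightarrow>\<^sub>E X \<Longrightarrow> T e x = 0"
      using p unfolding tT reduced_polytope_def local_marginal_polytope_def by auto
    have tle: "t i s \<le> 1" if "i \<in> V" "s \<in> X" for i s
      using member_le_sum[OF that(2), of "t i"] t0[OF that(1)] t1[OF that(1)] X by simp
    have Tle: "T e x \<le> 1" if ex: "e \<in> E" "x \<in> e \<rightarrow>\<^sub>E X" for e x
    proof -
      obtain i where i: "i \<in> e" using E[OF ex(1)] by blast
      have xi: "x i \<in> X" using ex(2) i by blast
      have fe: "finite e" using E[OF ex(1)] V finite_subset by blast
      from marg[OF ex(1) i xi] have "T e x \<le> t i (x i)"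
        by (rule pseudomarginal_le[where t = "t i" and X = X and T = "T e", OF fe X i ex(2) T0[OF ex(1)], rotated])
      also have "\<dots> \<le> 1" using E[OF ex(1)] i xi by (intro tle) auto
      finally show ?thesis .
    qed
    have "t i s \<in> {0..1}" for i s
      using t0 tle z(1) by (cases "i \<in> V \<and> s \<in> X") auto
    moreover have "T e x \<in> {0..1}" for e x
      using T0[of e x] Tle[of e x] z(2)[of e x] by (cases "e \<in> E \<and> x \<in> e \<rightarrow>\<^sub>E X") auto
    ultimately show "p \<in> ?B" by (simp add: tT)
  qed
  hence "?P = ?B \<inter> ?P" by blast
  thus ?thesis using compact_Int_closed[OF B closed] by simp
qed

lemma potts_log_bethe_zero_outside:
  assumes "\<And>e. e \<in> E \<Longrightarrow> e \<subseteq> V"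
  shows "potts_log_bethe V E J q (zero_outside V E {1..q} \<tau>) = potts_log_bethe V E J q \<tau>"
proof -
  obtain t T where tT: "\<tau> = (t, T)" by force
  show ?thesis unfolding tT zero_outside_def potts_log_bethe_def prod.case
    using assms by (intro arg_cong2[where f = "(-)"] sum.cong refl) (auto intro!: sum.cong)
qed

lemma continuous_on_potts_log_bethe:
  fixes V :: "'v set"
  assumes "\<And>e. e \<in> E \<Longrightarrow> e \<subseteq> V"
  shows "continuous_on (reduced_polytope V E {1..q}) (potts_log_bethe V E J q)"
proof -
  have nonneg: "fst p i s \<ge> 0" "snd p e x \<ge> 0"
    if "p \<in> reduced_polytope V E {1..q}" for p :: "('v, nat) pseudomarginal" and i s e x
  proof -
    obtain t T where tT: "p = (t, T)" by force
    have t0: "i \<in> V \<Longrightarrow> s \<in> {1..q} \<Longrightarrow> 0 \<le> t i s" and T0: "e \<in> E \<Longrightarrow> x \<in> e \<rightarrow>\<^sub>E {1..q} \<Longrightarrow> 0 \<le> T e x"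
      and z: "i \<notin> V \<or> s \<notin> {1..q} \<Longrightarrow> t i s = 0" "e \<notin> E \<or> x \<notin> e \<rightarrow>\<^sub>E {1..q} \<Longrightarrow> T e x = 0"
      using that unfolding tT reduced_polytope_def local_marginal_polytope_def by auto
    show "fst p i s \<ge> 0"
      using t0 z(1) unfolding tT fst_conv by (cases "i \<in> V \<and> s \<in> {1..q}") (blast, simp)
    show "snd p e x \<ge> 0"
      using T0 z(2) unfolding tT snd_conv by (cases "e \<in> E \<and> x \<in> e \<rightarrow>\<^sub>E {1..q}") (blast, simp)
  qed
  show ?thesis
    unfolding potts_log_bethe_def split_beta
    by (intro continuous_on_diff continuous_on_sum continuous_on_mult_ln continuous_on_mult_right continuous_on_pseudomarginal nonneg)
qed

text \<open>A feasible point for both problems, so that neither maximum is taken over the empty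
  set.\<close>

lemma uniform_pseudomarginal:
  assumes V: "finite V" and E: "\<And>e. e \<in> E \<Longrightarrow> e \<subseteq> V" and X: "finite X" "X \<noteq> {}"
  defines "\<tau> \<equiv> (\<lambda>_ _. 1 / real (card X), \<lambda>e x. \<Prod>i\<in>e. 1 / real (card X))"
  shows "\<tau> \<in> local_marginal_polytope V E X" "product_form E X \<tau>"
proof -
  let ?u = "1 / real (card X)"
  have u: "(\<Sum>s\<in>X. ?u) = 1" using X by simp
  have "(\<Sum>x\<in>{x \<in> e \<rightarrow>\<^sub>E X. x i = s}. \<Prod>k\<in>e. ?u) = ?u" if e: "e \<in> E" and i: "i \<in> e" and s: "s \<in> X" for e i s
  proof -
    have fe: "finite e" using E[OF e] V finite_subset by blast
    have "{x \<in> e \<rightarrow>\<^sub>E X. x i = s} = PiE e (\<lambda>k. if k = i then {s} else X)"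
      using i s by (auto simp: PiE_def Pi_def split: if_splits)
    hence "(\<Sum>x\<in>{x \<in> e \<rightarrow>\<^sub>E X. x i = s}. \<Prod>k\<in>e. ?u) = (\<Prod>k\<in>e. \<Sum>r\<in>(if k = i then {s} else X). ?u)"
      using fe X by (subst prod_sum_PiE) auto
    also have "\<dots> = (\<Prod>k\<in>e. if k = i then ?u else 1)" using u by (intro prod.cong) auto
    also have "\<dots> = ?u" using fe i by simp
    finally show ?thesis .
  qed
  thus "\<tau> \<in> local_marginal_polytope V E X"
    using u by (auto simp: \<tau>_def local_marginal_polytope_def intro!: prod_nonneg)
  show "product_form E X \<tau>" by (simp add: \<tau>_def product_form_def)
qed

text \<open>\<open>GREATEST\<close> is informative only once a maximum exists. The predicate
  \<open>Q\<close> serves both problems, being constantly true for Bethe and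
  \<open>product_form\<close> for mean field; \<open>Q0\<close> confines the search to the compact
  reduced polytope.\<close>

lemma potts_log_bethe_attains_max:
  assumes G: "finite_simple_graph V E" and Q: "closed {p. Q p}"
    and ne: "\<exists>\<tau>\<in>local_marginal_polytope V E {1..q}. Q \<tau>"
    and Q0: "\<And>\<tau>. Q \<tau> \<Longrightarrow> Q (zero_outside V E {1..q} \<tau>)"
  obtains \<tau>0 where "\<tau>0 \<in> local_marginal_polytope V E {1..q}" "Q \<tau>0"
    "(GREATEST z. \<exists>\<tau>\<in>local_marginal_polytope V E {1..q}. Q \<tau> \<and>
        z = eexp (log_bethe V E {1..q} (\<lambda>i s. 1) (potts_potential J) \<tau>)) = exp (potts_log_bethe V E J q \<tau>0)"
    "\<And>\<tau>. \<lbrakk>\<tau> \<in> local_marginal_polytope V E {1..q}; Q \<tau>\<rbrakk> \<Longrightarrow> potts_log_bethe V E J q \<tau> \<le> potts_log_bethe V E J q \<tau>0"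
proof -
  let ?L = "local_marginal_polytope V E {1..q}" and ?R = "reduced_polytope V E {1..q}"
  let ?F = "potts_log_bethe V E J q"
  have fin: "finite V" and E: "\<And>e. e \<in> E \<Longrightarrow> e \<subseteq> V \<and> e \<noteq> {}"
    using G unfolding finite_simple_graph_def by auto
  have RL: "?R \<subseteq> ?L" by (auto simp: reduced_polytope_def)
  have zo: "zero_outside V E {1..q} \<tau> \<in> ?R" if "\<tau> \<in> ?L" for \<tau>
    using E that by (intro zero_outside_in_polytope) auto
  have comp: "compact (?R \<inter> {p. Q p})"
    using E by (intro compact_Int_closed compact_reduced_polytope fin Q) auto
  have "?R \<inter> {p. Q p} \<noteq> {}" using ne zo Q0 by blast
  moreover have "continuous_on (?R \<inter> {p. Q p}) ?F"
    using E by (intro continuous_on_subset[OF continuous_on_potts_log_bethe]) auto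
  ultimately obtain \<tau>0 where \<tau>0: "\<tau>0 \<in> ?R" "Q \<tau>0" "\<And>\<tau>. \<lbrakk>\<tau> \<in> ?R; Q \<tau>\<rbrakk> \<Longrightarrow> ?F \<tau> \<le> ?F \<tau>0"
    using continuous_attains_sup[OF comp] by blast
  have max: "?F \<tau> \<le> ?F \<tau>0" if "\<tau> \<in> ?L" "Q \<tau>" for \<tau>
  proof -
    have "?F (zero_outside V E {1..q} \<tau>) = ?F \<tau>"
      using E by (intro potts_log_bethe_zero_outside) blast
    thus ?thesis using \<tau>0(3)[OF zo[OF that(1)] Q0[OF that(2)]] by linarith
  qed
  have val: "eexp (log_bethe V E {1..q} (\<lambda>i s. 1) (potts_potential J) \<tau>) = exp (?F \<tau>)" if "\<tau> \<in> ?L" for \<tau>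
    using log_bethe_potts[OF G that, of J] by (simp add: eexp_def)
  have "(GREATEST z. \<exists>\<tau>\<in>?L. Q \<tau> \<and> z = eexp (log_bethe V E {1..q} (\<lambda>i s. 1) (potts_potential J) \<tau>)) = exp (?F \<tau>0)"
  proof (rule Greatest_equality)
    show "\<exists>\<tau>\<in>?L. Q \<tau> \<and> exp (?F \<tau>0) = eexp (log_bethe V E {1..q} (\<lambda>i s. 1) (potts_potential J) \<tau>)"
      using \<tau>0(1,2) RL val[of \<tau>0] by (intro bexI[of _ \<tau>0]) auto
    fix y assume "\<exists>\<tau>\<in>?L. Q \<tau> \<and> y = eexp (log_bethe V E {1..q} (\<lambda>i s. 1) (potts_potential J) \<tau>)"
    then obtain \<tau> where "\<tau> \<in> ?L" "Q \<tau>" "y = eexp (log_bethe V E {1..q} (\<lambda>i s. 1) (potts_potential J) \<tau>)" by blast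
    thus "y \<le> exp (?F \<tau>0)" using val max by (metis exp_le_cancel_iff)
  qed
  thus ?thesis using that \<tau>0(1,2) RL max by blast
qed

theorem theorem5p2:
  fixes V :: "'v set" and E :: "'v set set" and J :: "'v set \<Rightarrow> real" and q :: nat
  assumes "finite_simple_graph V E"
    and "q \<ge> 1"
    and "\<And>e. e \<in> E \<Longrightarrow> J e > 0"
  shows "Z_MF V E J q \<le> Z_B V E J q \<and> Z_B V E J q \<le> Z_Potts V E J q"
proof -
  let ?L = "local_marginal_polytope V E {1..q}" and ?F = "potts_log_bethe V E J q"
  have fin: "finite V" and E: "\<And>e. e \<in> E \<Longrightarrow> e \<subseteq> V" using assms(1) unfolding finite_simple_graph_def by auto
  let ?u = "(\<lambda>_ _. 1 / real (card {1..q}), \<lambda>e x. \<Prod>i\<in>e. 1 / real (card {1..q}))"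
  have u: "?u \<in> ?L" "product_form E {1..q} ?u"
    using uniform_pseudomarginal[OF fin E, of E "{1..q}"] assms(2) by auto
  obtain \<tau>B where B: "\<tau>B \<in> ?L" "Z_B V E J q = exp (?F \<tau>B)" "\<And>\<tau>. \<tau> \<in> ?L \<Longrightarrow> ?F \<tau> \<le> ?F \<tau>B"
  proof (rule potts_log_bethe_attains_max[OF assms(1), where Q = "\<lambda>_. True" and q = q and J = J])
    show "\<exists>\<tau>\<in>?L. True" using u(1) by blast
  qed (simp_all only: Z_B_def bethe_partition_function_def simp_thms closed_UNIV UNIV_def[symmetric])
  have closed: "closed {p :: ('v, nat) pseudomarginal. product_form E {1..q} p}"
    unfolding product_form_def split_beta
    by (intro closed_Collect_ball closed_Collect_eq continuous_on_pseudomarginal continuous_on_prod)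
  \<comment> \<open>On an edge only vertices in \<open>V\<close> and colours in
    \<open>{1..q}\<close> occur, so none of the factors is set to 0.\<close>
  have zo: "product_form E {1..q} (zero_outside V E {1..q} \<tau>)" if "product_form E {1..q} \<tau>"
    for \<tau> :: "('v, nat) pseudomarginal"
  proof -
    obtain t T where tT: "\<tau> = (t, T)" by force
    have "(\<Prod>i\<in>e. if i \<in> V \<and> x i \<in> {1..q} then t i (x i) else 0) = (\<Prod>i\<in>e. t i (x i))"
      if "e \<in> E" "x \<in> e \<rightarrow>\<^sub>E {1..q}" for e x
      using E[OF that(1)] that(2) by (intro prod.cong) auto
    thus ?thesis using that unfolding tT product_form_def zero_outside_def prod.case by auto
  qed
  \<comment> \<open>The mean field maximiser lies in the same polytope, so its value cannot exceed
    that of \<open>\<tau>B\<close>.\<close>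
  obtain \<tau>M where M: "\<tau>M \<in> ?L" "Z_MF V E J q = exp (?F \<tau>M)"
  proof (rule potts_log_bethe_attains_max[OF assms(1) closed _ zo, where J = J])
    show "\<exists>\<tau>\<in>?L. product_form E {1..q} \<tau>" using u by blast
  qed (simp_all only: Z_MF_def mean_field_partition_function_def)
  have pos: "Z_Potts V E J q > 0"
    unfolding Z_Potts_def using fin assms(2) by (intro sum_pos prod_pos finite_PiE) (auto simp: PiE_eq_empty_iff)
  have "Z_B V E J q \<le> exp (ln (Z_Potts V E J q))"
    unfolding B(2) exp_le_cancel_iff using assms B(1) by (intro potts_log_bethe_le)
  thus ?thesis using B(3)[OF M(1)] pos by (simp add: B(2) M(2))
qed

end
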